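(* Let $\mathcal A$ be an essential arrangement of affine hyperplanes in a finite-dimensional complex vector space $V$. Then the poset of layers $\mathcal P(\mathcal A)$ is supersolvable if and only if $\mathcal A$ is fiber-type.
   Context: An affine hyperplane arrangement is a finite set $\mathcal A$ of affine hyperplanes in $V$; its complement is $M(\mathcal A)=V\setminus\bigcup_{H\in\mathcal A}H$. It is essential if the linear parts of the defining affine functionals span the dual space $V^*$. Its poset of layers $\mathcal P(\mathcal A)$ is the set of nonempty intersections of subsets of $\mathcal A$ (including $V$), ordered by reverse inclusion; it is a geometric semilattice, in particular a locally geometric poset (graded, bounded below, each $\mathcal P_{\le x}$ a geometric lattice). Fiber-type (inductive): $\mathcal A$ is fiber-type if $\dim V=1$, or there is a choice of coordinates $V\cong\mathbb C^n$ and a fiber-type affine arrangement $\mathcal B$ in $\mathbb C^{n-1}$ such that the projection $\mathbb C^n\to\mathbb C^{n-1}$ onto the first $n-1$ coordinates restricts to a fiber bundle $M(\mathcal A)\to M(\mathcal B)$ whose fibers are homeomorphic to $\mathbb C$ with finitely many points removed. Supersolvability: $x\vee y$ is the set of minimal common upper bounds. An element of a geometric lattice is modular if its complements form an antichain. An order ideal $\mathcal Q$ is pure if its maximal elements share a rank $\operatorname{rk}(\mathcal Q)$, join-closed if it contains all minimal upper bounds of its subsets. An M-ideal of $\mathcal P$ is a pure join-closed order ideal $\mathcal Q$ with (M1) if $y\in\mathcal Q$, $a$ an atom, $a\vee y=\emptyset$, then $a\in\mathcal Q$; (M2) for every maximal $x\in\mathcal P$ some maximal $y\in\mathcal Q$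 is modular in $\mathcal P_{\le x}$. $\mathcal P$ is supersolvable if there is a chain $\{\hat0\}=\mathcal Q_0\subset\cdots\subset\mathcal Q_n=\mathcal P$ with each $\mathcal Q_i$ an M-ideal of $\mathcal Q_{i+1}$ and $\operatorname{rk}(\mathcal Q_i)=i$. *)

theory Defs
  imports "HOL-Analysis.Analysis" "HOL-Library.Function_Algebras"
begin

section \<open>Supersolvable posets\<close>

text \<open>Posets are given by a carrier \<open>P\<close> and an order \<open>le\<close>, which is only used on \<open>P\<close>.\<close>

definition bottom_of :: "'a set \<Rightarrow> ('a \<Rightarrow> 'a \<Rightarrow> bool) \<Rightarrow> 'a \<Rightarrow> bool" where
  "bottom_of P le b \<longleftrightarrow> b \<in> P \<and> (\<forall>x\<in>P. le b x)"

definition maximals :: "'a set \<Rightarrow> ('a \<Rightarrow> 'a \<Rightarrow> bool) \<Rightarrow> 'a set" where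
  "maximals P le = {x \<in> P. \<forall>y\<in>P. le x y \<longrightarrow> y = x}"

definition minimals :: "'a set \<Rightarrow> ('a \<Rightarrow> 'a \<Rightarrow> bool) \<Rightarrow> 'a set" where
  "minimals P le = {x \<in> P. \<forall>y\<in>P. le y x \<longrightarrow> y = x}"

definition joins :: "'a set \<Rightarrow> ('a \<Rightarrow> 'a \<Rightarrow> bool) \<Rightarrow> 'a set \<Rightarrow> 'a set" where
  "joins P le S = minimals {u \<in> P. \<forall>s\<in>S. le s u} le"

definition meets :: "'a set \<Rightarrow> ('a \<Rightarrow> 'a \<Rightarrow> bool) \<Rightarrow> 'a set \<Rightarrow> 'a set" where
  "meets P le S = maximals {l \<in> P. \<forall>s\<in>S. le l s} le"

definition below :: "'a set \<Rightarrow> ('a \<Rightarrow> 'a \<Rightarrow> bool) \<Rightarrow> 'a \<Rightarrow> 'a set" where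
  "below P le x = {y \<in> P. le y x}"

definition atoms :: "'a set \<Rightarrow> ('a \<Rightarrow> 'a \<Rightarrow> bool) \<Rightarrow> 'a set" where
  "atoms P le = minimals {a \<in> P. \<not> bottom_of P le a} le"

definition elem_rank :: "'a set \<Rightarrow> ('a \<Rightarrow> 'a \<Rightarrow> bool) \<Rightarrow> 'a \<Rightarrow> nat" where
  "elem_rank P le x =
     Max {card C | C. finite C \<and> C \<subseteq> below P le x \<and> Complete_Partial_Order.chain le C} - 1"

definition pure :: "'a set \<Rightarrow> ('a \<Rightarrow> 'a \<Rightarrow> bool) \<Rightarrow> bool" where
  "pure P le \<longleftrightarrow> (\<exists>r. \<forall>x\<in>maximals P le. elem_rank P le x = r)"

text \<open>For pure \<open>P\<close> the maximum is over a single value, the common rank of the maximal elements.\<close>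

definition poset_rank :: "'a set \<Rightarrow> ('a \<Rightarrow> 'a \<Rightarrow> bool) \<Rightarrow> nat" where
  "poset_rank P le = Max (elem_rank P le ` maximals P le)"

definition order_ideal :: "'a set \<Rightarrow> ('a \<Rightarrow> 'a \<Rightarrow> bool) \<Rightarrow> 'a set \<Rightarrow> bool" where
  "order_ideal P le Q \<longleftrightarrow> Q \<subseteq> P \<and> (\<forall>y\<in>Q. \<forall>x\<in>P. le x y \<longrightarrow> x \<in> Q)"

definition join_closed :: "'a set \<Rightarrow> ('a \<Rightarrow> 'a \<Rightarrow> bool) \<Rightarrow> 'a set \<Rightarrow> bool" where
  "join_closed P le Q \<longleftrightarrow> (\<forall>S\<subseteq>Q. joins P le S \<subseteq> Q)"

text \<open>In a bounded poset \<open>maximals L le\<close> and \<open>minimals L le\<close> are the singletons of top and bottom.\<close>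

definition complements :: "'a set \<Rightarrow> ('a \<Rightarrow> 'a \<Rightarrow> bool) \<Rightarrow> 'a \<Rightarrow> 'a set" where
  "complements L le y =
     {z \<in> L. joins L le {y, z} = maximals L le \<and> meets L le {y, z} = minimals L le}"

definition modular_in :: "'a set \<Rightarrow> ('a \<Rightarrow> 'a \<Rightarrow> bool) \<Rightarrow> 'a \<Rightarrow> bool" where
  "modular_in L le y \<longleftrightarrow> y \<in> L \<and>
     (\<forall>z\<in>complements L le y. \<forall>w\<in>complements L le y. le z w \<longrightarrow> z = w)"

definition M_ideal :: "'a set \<Rightarrow> ('a \<Rightarrow> 'a \<Rightarrow> bool) \<Rightarrow> 'a set \<Rightarrow> bool" where
  "M_ideal P le Q \<longleftrightarrow>
     order_ideal P le Q \<and> pure Q le \<and> join_closed P le Q \<and>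
     (\<forall>y\<in>Q. \<forall>a\<in>atoms P le. joins P le {a, y} = {} \<longrightarrow> a \<in> Q) \<and>
     (\<forall>x\<in>maximals P le. \<exists>y\<in>maximals Q le. modular_in (below P le x) le y)"

definition supersolvable :: "'a set \<Rightarrow> ('a \<Rightarrow> 'a \<Rightarrow> bool) \<Rightarrow> bool" where
  "supersolvable P le \<longleftrightarrow>
     (\<exists>n Q. (\<exists>b. bottom_of P le b \<and> Q 0 = {b}) \<and> Q n = P \<and>
            (\<forall>i<n. Q i \<subset> Q (Suc i) \<and> M_ideal (Q (Suc i)) le (Q i)) \<and>
            (\<forall>i\<le>n. poset_rank (Q i) le = i))"


section \<open>Affine hyperplane arrangements\<close>

text \<open>
  The ambient space of an arrangement is a subspace \<open>V\<close> of a complex vector space with scalar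
  multiplication \<open>s\<close>: the whole type for an abstract vector space, or \<open>Cn n\<close> below.
\<close>

definition affine_hyperplane ::
  "(complex \<Rightarrow> 'v::ab_group_add \<Rightarrow> 'v) \<Rightarrow> 'v set \<Rightarrow> 'v set \<Rightarrow> bool" where
  "affine_hyperplane s V H \<longleftrightarrow>
     (\<exists>f c. Vector_Spaces.linear s (*) f \<and> (\<exists>v\<in>V. f v \<noteq> 0) \<and> H = {v \<in> V. f v = c})"

definition affine_arrangement ::
  "(complex \<Rightarrow> 'v::ab_group_add \<Rightarrow> 'v) \<Rightarrow> 'v set \<Rightarrow> 'v set set \<Rightarrow> bool" where
  "affine_arrangement s V A \<longleftrightarrow> finite A \<and> (\<forall>H\<in>A. affine_hyperplane s V H)"

definition arr_complement :: "'v set \<Rightarrow> 'v set set \<Rightarrow> 'v set" where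
  "arr_complement V A = V - \<Union>A"

definition layers :: "'v set \<Rightarrow> 'v set set \<Rightarrow> 'v set set" where
  "layers V A = {L. L \<noteq> {} \<and> (\<exists>S\<subseteq>A. L = V \<inter> \<Inter>S)}"

definition fun_scale :: "complex \<Rightarrow> ('i \<Rightarrow> complex) \<Rightarrow> 'i \<Rightarrow> complex" where
  "fun_scale c f = (\<lambda>i. c * f i)"

definition dual_space :: "(complex \<Rightarrow> 'v::ab_group_add \<Rightarrow> 'v) \<Rightarrow> ('v \<Rightarrow> complex) set" where
  "dual_space s = {f. Vector_Spaces.linear s (*) f}"

text \<open>A hyperplane determines its defining functional up to a nonzero scalar; all choices are
  collected here, which does not affect the span.\<close>

definition linear_parts ::
  "(complex \<Rightarrow> 'v::ab_group_add \<Rightarrow> 'v) \<Rightarrow> 'v set set \<Rightarrow> ('v \<Rightarrow> complex) set" where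
  "linear_parts s A = {f \<in> dual_space s. f \<noteq> 0 \<and> (\<exists>c. {v. f v = c} \<in> A)}"

definition essential :: "(complex \<Rightarrow> 'v::ab_group_add \<Rightarrow> 'v) \<Rightarrow> 'v set set \<Rightarrow> bool" where
  "essential s A \<longleftrightarrow> module.span fun_scale (linear_parts s A) = dual_space s"


section \<open>Fiber-type arrangements\<close>

definition fiber_bundle ::
  "'e topology \<Rightarrow> 'b topology \<Rightarrow> ('e \<Rightarrow> 'b) \<Rightarrow> 'f topology \<Rightarrow> bool" where
  "fiber_bundle E B p F \<longleftrightarrow>
     continuous_map E B p \<and>
     (\<forall>b\<in>topspace B. \<exists>U h. openin B U \<and> b \<in> U \<and>
        homeomorphic_map (subtopology E {e \<in> topspace E. p e \<in> U})
          (prod_topology (subtopology B U) F) h \<and>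
        (\<forall>e\<in>topspace E. p e \<in> U \<longrightarrow> fst (h e) = p e))"

text \<open>
  \<open>\<complex>\<^sup>n\<close> as the sequences vanishing from index \<open>n\<close> on, so that all \<open>n\<close> share one type. Its
  topology is the subspace topology of the product topology on \<open>nat \<Rightarrow> complex\<close>, and its scalar
  multiplication is \<open>fun_scale\<close>.
\<close>

definition Cn :: "nat \<Rightarrow> (nat \<Rightarrow> complex) set" where
  "Cn n = {x. \<forall>i\<ge>n. x i = 0}"

definition proj :: "nat \<Rightarrow> (nat \<Rightarrow> complex) \<Rightarrow> nat \<Rightarrow> complex" where
  "proj n x = (\<lambda>i. if i < n then x i else 0)"

definition coordinates ::
  "(complex \<Rightarrow> 'v::ab_group_add \<Rightarrow> 'v) \<Rightarrow> 'v set \<Rightarrow> nat \<Rightarrow> ('v \<Rightarrow> nat \<Rightarrow> complex) \<Rightarrow> bool" where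
  "coordinates s V n \<phi> \<longleftrightarrow>
     bij_betw \<phi> V (Cn n) \<and>
     (\<forall>x\<in>V. \<forall>y\<in>V. \<phi> (x + y) = \<phi> x + \<phi> y) \<and>
     (\<forall>c. \<forall>x\<in>V. \<phi> (s c x) = fun_scale c (\<phi> x))"

definition fibers_over ::
  "(complex \<Rightarrow> 'v::ab_group_add \<Rightarrow> 'v) \<Rightarrow> 'v set \<Rightarrow> 'v set set \<Rightarrow>
   nat \<Rightarrow> (nat \<Rightarrow> complex) set set \<Rightarrow> bool" where
  "fibers_over s V A n B \<longleftrightarrow>
     (\<exists>\<phi> S. coordinates s V (Suc n) \<phi> \<and> finite S \<and>
        fiber_bundle (top_of_set (\<phi> ` arr_complement V A))
          (top_of_set (arr_complement (Cn n) B)) (proj n) (top_of_set (UNIV - S :: complex set)))"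

text \<open>The recursion is carried out for arrangements in \<open>Cn n\<close>, because an inductive predicate
  lives on one type; \<open>coord_fiber_type_iff\<close> confirms that it is \<open>fiber_type\<close> on \<open>Cn n\<close>.\<close>

inductive coord_fiber_type :: "nat \<Rightarrow> (nat \<Rightarrow> complex) set set \<Rightarrow> bool" where
  line: "affine_arrangement fun_scale (Cn 1) A \<Longrightarrow> coord_fiber_type 1 A"
| step: "affine_arrangement fun_scale (Cn (Suc n)) A \<Longrightarrow> coord_fiber_type n B \<Longrightarrow>
         fibers_over fun_scale (Cn (Suc n)) A n B \<Longrightarrow> coord_fiber_type (Suc n) A"

definition fiber_type ::
  "(complex \<Rightarrow> 'v::ab_group_add \<Rightarrow> 'v) \<Rightarrow> 'v set \<Rightarrow> 'v set set \<Rightarrow> bool" where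
  "fiber_type s V A \<longleftrightarrow>
     affine_arrangement s V A \<and>
     (vector_space.dim s V = 1 \<or> (\<exists>n B. coord_fiber_type n B \<and> fibers_over s V A n B))"

interpretation fun_vs: vector_space fun_scale
  by unfold_locales (auto simp: fun_scale_def algebra_simps fun_eq_iff)

definition unit_seq :: "nat \<Rightarrow> nat \<Rightarrow> complex" where
  "unit_seq j = (\<lambda>i. if i = j then 1 else 0)"

lemma subspace_Cn: "fun_vs.subspace (Cn n)"
  by (auto simp: fun_vs.subspace_def Cn_def fun_scale_def)

lemma unit_seq_inj: "inj unit_seq"
  by (auto simp: inj_def unit_seq_def fun_eq_iff split: if_splits)

lemma sum_unit_seq:
  assumes "finite J"
  shows "(\<Sum>j\<in>J. fun_scale (u j) (unit_seq j)) i = (if i \<in> J then u i else 0)"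
  using assms by (induction J rule: finite_induct) (auto simp: fun_scale_def unit_seq_def)

lemma dim_Cn: "fun_vs.dim (Cn n) = n"
proof -
  let ?B = "unit_seq ` {..<n}"
  have ind: "fun_vs.independent ?B"
  proof (rule fun_vs.independent_if_scalars_zero)
    fix f x assume *: "(\<Sum>x\<in>?B. fun_scale (f x) x) = 0" and "x \<in> ?B"
    then obtain i where i: "i < n" "x = unit_seq i" by auto
    have "(\<Sum>x\<in>?B. fun_scale (f x) x) = (\<Sum>j<n. fun_scale (f (unit_seq j)) (unit_seq j))"
      by (subst sum.reindex) (auto intro: inj_on_subset[OF unit_seq_inj])
    then have "(\<Sum>j<n. fun_scale (f (unit_seq j)) (unit_seq j)) i = 0" using * by simp
    then show "f x = 0" using i by (simp add: sum_unit_seq)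
  qed simp
  have sub: "?B \<subseteq> Cn n" by (auto simp: Cn_def unit_seq_def)
  have "Cn n \<subseteq> fun_vs.span ?B"
  proof
    fix x assume x: "x \<in> Cn n"
    have "x = (\<Sum>j<n. fun_scale (x j) (unit_seq j))"
      using x by (auto simp: fun_eq_iff sum_unit_seq Cn_def not_less)
    also have "\<dots> \<in> fun_vs.span ?B"
      by (intro fun_vs.span_sum fun_vs.span_scale fun_vs.span_base) auto
    finally show "x \<in> fun_vs.span ?B" .
  qed
  from fun_vs.dim_unique[OF sub this ind] show ?thesis
    by (simp add: card_image inj_on_subset[OF unit_seq_inj])
qed

lemma coordinates_Cn_dim:
  assumes "coordinates fun_scale (Cn n) m \<phi>"
  shows "m = n"
proof -
  have bij: "bij_betw \<phi> (Cn n) (Cn m)"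
    and add: "\<And>x y. x \<in> Cn n \<Longrightarrow> y \<in> Cn n \<Longrightarrow> \<phi> (x + y) = \<phi> x + \<phi> y"
    and sc: "\<And>c x. x \<in> Cn n \<Longrightarrow> \<phi> (fun_scale c x) = fun_scale c (\<phi> x)"
    using assms by (auto simp: coordinates_def)
  define \<psi> where "\<psi> x = \<phi> (proj n x)" for x
  have pC: "proj n x \<in> Cn n" for x by (simp add: proj_def Cn_def)
  have pid: "proj n x = x" if "x \<in> Cn n" for x
    using that by (auto simp: proj_def Cn_def fun_eq_iff)
  have lin: "Vector_Spaces.linear fun_scale fun_scale \<psi>"
  proof
    fix x y :: "nat \<Rightarrow> complex" and c
    have "proj n (x + y) = proj n x + proj n y" by (auto simp: proj_def fun_eq_iff)
    then show "\<psi> (x + y) = \<psi> x + \<psi> y" by (simp add: \<psi>_def add pC)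
    have "proj n (fun_scale c x) = fun_scale c (proj n x)"
      by (auto simp: proj_def fun_eq_iff fun_scale_def)
    then show "\<psi> (fun_scale c x) = fun_scale c (\<psi> x)" by (simp add: \<psi>_def sc pC)
  qed
  interpret psi: Vector_Spaces.linear fun_scale fun_scale \<psi> by (rule lin)
  have im: "\<psi> ` Cn n = Cn m" and inj: "inj_on \<psi> (Cn n)"
    using bij by (auto simp: \<psi>_def pid bij_betw_def inj_on_def image_def)
  obtain B where B: "B \<subseteq> Cn n" "fun_vs.independent B" "Cn n \<subseteq> fun_vs.span B"
      "card B = fun_vs.dim (Cn n)"
    by (rule fun_vs.basis_exists)
  have span: "fun_vs.span B = Cn n"
    using B(1,3) fun_vs.span_minimal[OF _ subspace_Cn] by blast
  have "fun_vs.dim (\<psi> ` Cn n) = card (\<psi> ` B)"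
  proof (rule fun_vs.dim_eq_card)
    show "fun_vs.span (\<psi> ` B) = fun_vs.span (\<psi> ` Cn n)"
      by (simp add: psi.span_image span fun_vs.span_eq_iff[THEN iffD2, OF subspace_Cn])
    show "fun_vs.independent (\<psi> ` B)"
      using B(2) inj by (intro psi.independent_injective_image) (auto simp: span)
  qed
  also have "\<dots> = fun_vs.dim (Cn n)"
    using B(1,4) inj by (simp add: card_image inj_on_subset)
  finally have "fun_vs.dim (\<psi> ` Cn n) = fun_vs.dim (Cn n)" .
  then show ?thesis by (simp add: im dim_Cn)
qed

lemma coord_fiber_type_iff: "coord_fiber_type n A \<longleftrightarrow> fiber_type fun_scale (Cn n) A"
proof
  assume "coord_fiber_type n A"
  then show "fiber_type fun_scale (Cn n) A"
    by cases (auto simp: fiber_type_def dim_Cn)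
next
  assume A: "fiber_type fun_scale (Cn n) A"
  show "coord_fiber_type n A"
  proof (cases "n = 1")
    case True
    with A show ?thesis using coord_fiber_type.line by (simp add: fiber_type_def)
  next
    case False
    with A obtain m B where B: "coord_fiber_type m B" "fibers_over fun_scale (Cn n) A m B"
      by (auto simp: fiber_type_def dim_Cn)
    then have "Suc m = n" using coordinates_Cn_dim by (auto simp: fibers_over_def)
    with A B show ?thesis by (auto simp: fiber_type_def intro: coord_fiber_type.step)
  qed
qed

end

theory Submission
  imports Defs
begin

text \<open>
  For an essential arrangement, an M-ideal of corank one is the set of layers containing a fixed
  direction \<open>v\<close>: its maximal elements are parallel lines, and modularity says that two intersecting
  hyperplanes transverse to \<open>v\<close> meet inside a hyperplane parallel to \<open>v\<close>. Projecting along \<open>v\<close>, the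
  transverse hyperplanes are graphs of affine functions on the base, and this condition says that
  the graphs never meet over the complement of the projected parallel hyperplanes. In that case
  the complement is a bundle of punctured planes, trivialised locally by moving the punctures with
  bump functions; conversely, a bundle has a constant number of punctures in its fibers, because
  that number is determined by the number of ends of the fiber. The ideal is isomorphic to the
  poset of layers of the projected arrangement, so the theorem follows by induction on the
  dimension.
\<close>

section \<open>Supersolvable posets\<close>

lemma maximals_eq_singletonI:
  assumes "g \<in> Q" "\<And>x. x \<in> Q \<Longrightarrow> le x g" "antisymp_on Q le"
  shows "maximals Q le = {g}"
proof (intro equalityI subsetI)
  fix x assume "x \<in> maximals Q le"
  then show "x \<in> {g}" using assms(1,2) by (auto simp: maximals_def)
next
  fix x assume "x \<in> {g}"
  then show "x \<in> maximals Q le" using assms by (auto simp: maximals_def dest: antisymp_onD)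
qed

lemma minimals_eq_singletonI:
  assumes "g \<in> Q" "\<And>x. x \<in> Q \<Longrightarrow> le g x" "antisymp_on Q le"
  shows "minimals Q le = {g}"
proof -
  have "antisymp_on Q (\<lambda>x y. le y x)" using assms(3) by (simp add: antisymp_on_def)
  from maximals_eq_singletonI[OF assms(1) _ this] show ?thesis
    using assms(2) by (simp add: maximals_def minimals_def)
qed

lemma joins_eq_singletonI:
  assumes "j \<in> P" "\<And>s. s \<in> S \<Longrightarrow> le s j" "\<And>u. u \<in> P \<Longrightarrow> \<forall>s\<in>S. le s u \<Longrightarrow> le j u" "antisymp_on P le"
  shows "joins P le S = {j}"
  unfolding joins_def
proof (rule minimals_eq_singletonI)
  show "antisymp_on {u \<in> P. \<forall>s\<in>S. le s u} le" using assms(4) by (rule antisymp_on_subset) blast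
qed (use assms in auto)

lemma maximals_eq_bottom_iff:
  assumes "bottom_of Q le b"
  shows "maximals Q le = {b} \<longleftrightarrow> Q = {b}"
proof
  assume max: "maximals Q le = {b}"
  have "x = b" if "x \<in> Q" for x
    using that assms max by (auto simp: maximals_def bottom_of_def set_eq_iff)
  then show "Q = {b}" using assms by (auto simp: bottom_of_def)
qed (auto simp: maximals_def)

lemma elem_rank_order_ideal:
  assumes "order_ideal P le Q" "x \<in> Q"
  shows "elem_rank Q le x = elem_rank P le x"
proof -
  have "below Q le x = below P le x"
    using assms unfolding below_def order_ideal_def by blast
  then show ?thesis by (simp add: elem_rank_def)
qed

lemma poset_rank_eqI:
  assumes "maximals P le \<noteq> {}" "\<And>x. x \<in> maximals P le \<Longrightarrow> elem_rank P le x = r"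
  shows "poset_rank P le = r"
proof -
  have "elem_rank P le ` maximals P le = {r}" using assms by auto
  then show ?thesis by (simp add: poset_rank_def)
qed

lemma elem_rank_maximal_if_pure:
  assumes "pure P le" "x \<in> maximals P le"
  shows "elem_rank P le x = poset_rank P le"
proof -
  obtain r where r: "\<And>y. y \<in> maximals P le \<Longrightarrow> elem_rank P le y = r"
    using assms(1) by (auto simp: pure_def)
  then have "poset_rank P le = r" using assms(2) by (intro poset_rank_eqI) auto
  then show ?thesis using r assms(2) by simp
qed

definition rank_function :: "'a set \<Rightarrow> ('a \<Rightarrow> 'a \<Rightarrow> bool) \<Rightarrow> ('a \<Rightarrow> nat) \<Rightarrow> bool" where
  "rank_function P le \<rho> \<longleftrightarrow>
     (\<forall>x\<in>P. \<forall>y\<in>P. le x y \<longrightarrow> x \<noteq> y \<longrightarrow> \<rho> x < \<rho> y) \<and>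
     (\<forall>y\<in>P. 0 < \<rho> y \<longrightarrow> (\<exists>x\<in>P. le x y \<and> \<rho> y = Suc (\<rho> x)))"

lemma rank_function_less: "rank_function P le \<rho> \<Longrightarrow> x \<in> P \<Longrightarrow> y \<in> P \<Longrightarrow> le x y \<Longrightarrow> x \<noteq> y \<Longrightarrow> \<rho> x < \<rho> y"
  by (simp add: rank_function_def)

lemma card_chain_below_le:
  assumes \<rho>: "rank_function P le \<rho>" and z: "z \<in> P"
    and C: "C \<subseteq> below P le z" "Complete_Partial_Order.chain le C"
  shows "card C \<le> Suc (\<rho> z)"
proof -
  have CP: "x \<in> P \<and> le x z" if "x \<in> C" for x using that C(1) by (auto simp: below_def)
  have "inj_on \<rho> C"
  proof (rule inj_onI)
    fix x y assume xy: "x \<in> C" "y \<in> C" "\<rho> x = \<rho> y"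
    then have "le x y \<or> le y x" using C(2) by (auto simp: Complete_Partial_Order.chain_def)
    then show "x = y"
      using rank_function_less[OF \<rho>, of x y] rank_function_less[OF \<rho>, of y x] CP xy by auto
  qed
  moreover have "\<rho> x \<le> \<rho> z" if "x \<in> C" for x
    using rank_function_less[OF \<rho>, of x z] CP[OF that] z by (cases "x = z") auto
  then have "\<rho> ` C \<subseteq> {..\<rho> z}" by auto
  ultimately show ?thesis using card_inj_on_le[of \<rho> C "{..\<rho> z}"] by simp
qed

lemma exists_chain_below:
  assumes \<rho>: "rank_function P le \<rho>" and refl: "reflp_on P le" and trans: "transp_on P le"
    and "z \<in> P"
  shows "\<exists>C. finite C \<and> C \<subseteq> below P le z \<and> Complete_Partial_Order.chain le C \<and> card C = Suc (\<rho> z)"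
  using \<open>z \<in> P\<close>
proof (induction "\<rho> z" arbitrary: z)
  case 0
  then show ?case
    using reflp_onD[OF refl]
    by (intro exI[of _ "{z}"]) (auto simp: below_def Complete_Partial_Order.chain_def)
next
  case (Suc r)
  then obtain y where y: "y \<in> P" "le y z" "\<rho> z = Suc (\<rho> y)"
    using \<rho> unfolding rank_function_def by (metis zero_less_Suc)
  then obtain C where C: "finite C" "C \<subseteq> below P le y" "Complete_Partial_Order.chain le C"
      "card C = Suc (\<rho> y)"
    using Suc by (metis nat.inject)
  have C_below: "x \<in> P \<and> le x z" if "x \<in> C" for x
    using that C(2) y Suc.prems transp_onD[OF trans, of x y z] by (auto simp: below_def)
  have "z \<notin> C"
  proof
    assume "z \<in> C"
    then have "le z y" using C(2) by (auto simp: below_def)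
    then have "\<rho> z < \<rho> y" using rank_function_less[OF \<rho> Suc.prems y(1)] y(3) by force
    then show False using y(3) by simp
  qed
  then have "card (insert z C) = Suc (\<rho> z)" using C y by simp
  moreover have "le z z" using reflp_onD[OF refl Suc.prems] .
  then have "insert z C \<subseteq> below P le z" "Complete_Partial_Order.chain le (insert z C)"
    using C(3) C_below Suc.prems by (auto simp: below_def Complete_Partial_Order.chain_def)
  ultimately show ?case using C(1) by (intro exI[of _ "insert z C"]) simp
qed

lemma elem_rank_eq_rank_function:
  assumes "rank_function P le \<rho>" "reflp_on P le" "transp_on P le" "z \<in> P"
  shows "elem_rank P le z = \<rho> z"
proof -
  let ?S = "{card C | C. finite C \<and> C \<subseteq> below P le z \<and> Complete_Partial_Order.chain le C}"
  have upper: "k \<le> Suc (\<rho> z)" if "k \<in> ?S" for k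
    using that card_chain_below_le[OF assms(1,4)] by auto
  have "Max ?S = Suc (\<rho> z)"
  proof (rule Max_eqI)
    show "finite ?S" by (rule finite_subset[of _ "{..Suc (\<rho> z)}"]) (use upper in auto)
    show "Suc (\<rho> z) \<in> ?S"
      using exists_chain_below[OF assms] by (metis (mono_tags, lifting) mem_Collect_eq)
  qed (rule upper)
  then show ?thesis by (simp add: elem_rank_def)
qed

lemma supersolvable_singleton:
  assumes "le b b"
  shows "supersolvable {b} le"
proof -
  have "rank_function {b} le (\<lambda>_. 0)" by (simp add: rank_function_def)
  then have "elem_rank {b} le b = 0"
    using assms by (intro elem_rank_eq_rank_function[of "{b}" le "\<lambda>_. 0"])
      (auto intro: reflp_onI transp_onI)
  then have "poset_rank {b} le = 0" by (intro poset_rank_eqI) (auto simp: maximals_def)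
  then show ?thesis
    using assms unfolding supersolvable_def
    by (intro exI[of _ 0] exI[of _ "\<lambda>_. {b}"]) (auto simp: bottom_of_def)
qed

lemma supersolvable_M_ideal_exists:
  assumes "supersolvable P le" "poset_rank P le = Suc r"
  obtains Q where "M_ideal P le Q" "supersolvable Q le" "poset_rank Q le = r"
proof -
  obtain n Q b where Q: "bottom_of P le b" "Q 0 = {b}" "Q n = P"
    and step: "\<And>i. i < n \<Longrightarrow> Q i \<subset> Q (Suc i) \<and> M_ideal (Q (Suc i)) le (Q i)"
    and rank: "\<And>i. i \<le> n \<Longrightarrow> poset_rank (Q i) le = i"
    using assms(1) unfolding supersolvable_def by blast
  have n: "n = Suc r" using rank[of n] Q(3) assms(2) by simp
  have "b \<in> Q i" if "i \<le> n" for i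
    using that by (induction i) (use Q(2) step in \<open>auto simp: Suc_le_eq\<close>)
  then have "b \<in> Q r" by (simp add: n)
  moreover have "Q r \<subseteq> P" using step[of r] Q(3) n by auto
  ultimately have "bottom_of (Q r) le b" using Q(1) by (auto simp: bottom_of_def)
  then have "supersolvable (Q r) le"
    unfolding supersolvable_def using Q(2) step rank n by (intro exI[of _ r] exI[of _ Q]) auto
  then show thesis using that[of "Q r"] step[of r] rank[of r] Q(3) n by auto
qed

lemma supersolvable_if_M_ideal:
  assumes "bottom_of P le b" "antisymp_on P le" and M: "M_ideal P le Q" and "supersolvable Q le"
    and rank_P: "poset_rank P le = Suc (poset_rank Q le)"
  shows "supersolvable P le"
proof -
  obtain n R b' where R: "bottom_of Q le b'" "R 0 = {b'}" "R n = Q"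
    and step: "\<And>i. i < n \<Longrightarrow> R i \<subset> R (Suc i) \<and> M_ideal (R (Suc i)) le (R i)"
    and rank: "\<And>i. i \<le> n \<Longrightarrow> poset_rank (R i) le = i"
    using assms(4) unfolding supersolvable_def by blast
  have "order_ideal P le Q" using M by (simp add: M_ideal_def)
  then have ideal: "Q \<subseteq> P" "\<And>x y. y \<in> Q \<Longrightarrow> x \<in> P \<Longrightarrow> le x y \<Longrightarrow> x \<in> Q"
    unfolding order_ideal_def by blast+
  have b': "b' \<in> Q" "b' \<in> P" using R(1) ideal(1) by (auto simp: bottom_of_def)
  then have "b \<in> Q" using assms(1) ideal(2) by (auto simp: bottom_of_def)
  then have "b' = b" using assms(1,2) R(1) b' by (auto simp: bottom_of_def dest: antisymp_onD)
  have "Q \<subset> P" using ideal(1) rank_P by auto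
  define R' where "R' = R(Suc n := P)"
  have "R' i \<subset> R' (Suc i) \<and> M_ideal (R' (Suc i)) le (R' i)" if "i < Suc n" for i
    using that R(3) step[of i] M \<open>Q \<subset> P\<close> by (cases "i = n") (auto simp: R'_def)
  moreover have "poset_rank (R' i) le = i" if "i \<le> Suc n" for i
    using that R(3) rank[of i] rank[of n] rank_P by (cases "i = Suc n") (auto simp: R'_def)
  moreover have "bottom_of P le b" "R' 0 = {b}" "R' (Suc n) = P"
    using assms(1) R(2) \<open>b' = b\<close> by (auto simp: R'_def)
  ultimately show ?thesis unfolding supersolvable_def by blast
qed

subsection \<open>Invariance under order isomorphism\<close>

context
  includes lifting_syntax
  fixes R :: "'a \<Rightarrow> 'b \<Rightarrow> bool"
  assumes bi_unique [transfer_rule]: "bi_unique R"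
begin

lemma bottom_of_transfer [transfer_rule]:
  "(rel_set R ===> (R ===> R ===> (=)) ===> R ===> (=)) bottom_of bottom_of"
  unfolding bottom_of_def by transfer_prover

lemma maximals_transfer [transfer_rule]:
  "(rel_set R ===> (R ===> R ===> (=)) ===> rel_set R) maximals maximals"
  unfolding maximals_def Set.filter_eq[symmetric] by transfer_prover

lemma minimals_transfer [transfer_rule]:
  "(rel_set R ===> (R ===> R ===> (=)) ===> rel_set R) minimals minimals"
  unfolding minimals_def Set.filter_eq[symmetric] by transfer_prover

lemma joins_transfer [transfer_rule]:
  "(rel_set R ===> (R ===> R ===> (=)) ===> rel_set R ===> rel_set R) joins joins"
  unfolding joins_def Set.filter_eq[symmetric] by transfer_prover

lemma meets_transfer [transfer_rule]:
  "(rel_set R ===> (R ===> R ===> (=)) ===> rel_set R ===> rel_set R) meets meets"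
  unfolding meets_def Set.filter_eq[symmetric] by transfer_prover

lemma below_transfer [transfer_rule]:
  "(rel_set R ===> (R ===> R ===> (=)) ===> R ===> rel_set R) below below"
  unfolding below_def Set.filter_eq[symmetric] by transfer_prover

lemma atoms_transfer [transfer_rule]:
  "(rel_set R ===> (R ===> R ===> (=)) ===> rel_set R) atoms atoms"
  unfolding atoms_def Set.filter_eq[symmetric] by transfer_prover

lemma chain_transfer [transfer_rule]:
  "((R ===> R ===> (=)) ===> rel_set R ===> (=))
    Complete_Partial_Order.chain Complete_Partial_Order.chain"
  unfolding Complete_Partial_Order.chain_def by transfer_prover

lemma elem_rank_transfer [transfer_rule]:
  "(rel_set R ===> (R ===> R ===> (=)) ===> R ===> (=)) elem_rank elem_rank"
proof -
  have chain_cards: "{card C | C. finite C \<and> C \<subseteq> below P le x \<and> Complete_Partial_Order.chain le C}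
      = card ` Set.filter (\<lambda>C. finite C \<and> Complete_Partial_Order.chain le C) (Pow (below P le x))"
    for P :: "'c set" and le x by auto
  show ?thesis unfolding elem_rank_def chain_cards by transfer_prover
qed

lemma pure_transfer [transfer_rule]:
  "(rel_set R ===> (R ===> R ===> (=)) ===> (=)) pure pure"
  unfolding pure_def by transfer_prover

lemma poset_rank_transfer [transfer_rule]:
  "(rel_set R ===> (R ===> R ===> (=)) ===> (=)) poset_rank poset_rank"
  unfolding poset_rank_def by transfer_prover

lemma order_ideal_transfer [transfer_rule]:
  "(rel_set R ===> (R ===> R ===> (=)) ===> rel_set R ===> (=)) order_ideal order_ideal"
  unfolding order_ideal_def by transfer_prover

lemma join_closed_transfer [transfer_rule]:
  "(rel_set R ===> (R ===> R ===> (=)) ===> rel_set R ===> (=)) join_closed join_closed"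
  unfolding join_closed_def Pow_iff[symmetric] Ball_def[symmetric] by transfer_prover

lemma complements_transfer [transfer_rule]:
  "(rel_set R ===> (R ===> R ===> (=)) ===> R ===> rel_set R) complements complements"
  unfolding complements_def Set.filter_eq[symmetric] by transfer_prover

lemma modular_in_transfer [transfer_rule]:
  "(rel_set R ===> (R ===> R ===> (=)) ===> R ===> (=)) modular_in modular_in"
  unfolding modular_in_def by transfer_prover

lemma M_ideal_transfer [transfer_rule]:
  "(rel_set R ===> (R ===> R ===> (=)) ===> rel_set R ===> (=)) M_ideal M_ideal"
  unfolding M_ideal_def by transfer_prover

lemma supersolvable_transfer_imp:
  assumes P: "rel_set R P P'" and le: "(R ===> R ===> (=)) le le'" and "supersolvable P le"
  shows "supersolvable P' le'"
proof -
  obtain n Q b where Q: "bottom_of P le b" "Q 0 = {b}" "Q n = P"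
    and step: "\<And>i. i < n \<Longrightarrow> Q i \<subset> Q (Suc i) \<and> M_ideal (Q (Suc i)) le (Q i)"
    and rank: "\<And>i. i \<le> n \<Longrightarrow> poset_rank (Q i) le = i"
    using assms(3) unfolding supersolvable_def by blast
  define Q' where "Q' i = {y \<in> P'. \<exists>x\<in>Q i. R x y}" for i
  have QP: "Q i \<subseteq> P" if "i \<le> n" for i
    using that by (induction rule: inc_induct) (use Q(3) step in auto)
  have Q': "rel_set R (Q i) (Q' i)" if "i \<le> n" for i
    using P QP[OF that] unfolding Q'_def rel_set_def by blast
  obtain b' where b': "R b b'" "b' \<in> P'"
    using P Q(1) by (auto simp: bottom_of_def dest: rel_setD1)
  have "bottom_of P' le' b'"
    using bottom_of_transfer[THEN rel_funD, OF P, THEN rel_funD, OF le, THEN rel_funD, OF b'(1)]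
      Q(1)
    by simp
  moreover have "rel_set R {b} {b'}" using b'(1) by (simp add: rel_set_def)
  then have "Q' 0 = {b'}" using bi_uniqueDr[OF bi_unique_rel_set[OF bi_unique]] Q'[of 0] Q(2)
    by simp
  moreover have "Q' n = P'"
    using bi_uniqueDr[OF bi_unique_rel_set[OF bi_unique]] Q'[of n] Q(3) P by simp
  moreover have "Q' i \<subset> Q' (Suc i) \<and> M_ideal (Q' (Suc i)) le' (Q' i)" if "i < n" for i
  proof -
    have rel: "rel_set R (Q i) (Q' i)" "rel_set R (Q (Suc i)) (Q' (Suc i))" using Q' that by auto
    have "Q i \<subset> Q (Suc i) \<longleftrightarrow> Q' i \<subset> Q' (Suc i)"
      by (rule strict_subset_transfer[OF bi_unique, THEN rel_funD, OF rel(1),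
            THEN rel_funD, OF rel(2)])
    moreover have "M_ideal (Q (Suc i)) le (Q i) \<longleftrightarrow> M_ideal (Q' (Suc i)) le' (Q' i)"
      by (rule M_ideal_transfer[THEN rel_funD, OF rel(2), THEN rel_funD, OF le,
            THEN rel_funD, OF rel(1)])
    ultimately show ?thesis using step[OF that] by simp
  qed
  moreover have "poset_rank (Q' i) le' = i" if "i \<le> n" for i
    using poset_rank_transfer[THEN rel_funD, OF Q'[OF that], THEN rel_funD, OF le] rank[OF that]
    by simp
  ultimately show ?thesis unfolding supersolvable_def by blast
qed

end

lemma supersolvable_transfer:
  fixes R :: "'a \<Rightarrow> 'b \<Rightarrow> bool"
  assumes "bi_unique R" "rel_set R P P'" "rel_fun R (rel_fun R (=)) le le'"
  shows "supersolvable P le \<longleftrightarrow> supersolvable P' le'"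
proof
  show "supersolvable P' le'" if "supersolvable P le"
    using supersolvable_transfer_imp[OF assms that] .
  have "bi_unique R\<inverse>\<inverse>" "rel_set R\<inverse>\<inverse> P' P" "rel_fun R\<inverse>\<inverse> (rel_fun R\<inverse>\<inverse> (=)) le' le"
    using assms by (auto simp: rel_fun_def)
  then show "supersolvable P le" if "supersolvable P' le'"
    using supersolvable_transfer_imp that by blast
qed

section \<open>Layers of an affine arrangement\<close>

lemma layers_vimage:
  assumes "g ` V' = V"
  shows "layers V' ((\<lambda>H. V' \<inter> g -` H) ` A) = (\<lambda>X. V' \<inter> g -` X) ` layers V A"
proof -
  have Inter: "V' \<inter> \<Inter>((\<lambda>H. V' \<inter> g -` H) ` S) = V' \<inter> g -` (V \<inter> \<Inter>S)" for S
    using assms by blast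
  have nonempty: "V' \<inter> g -` (V \<inter> \<Inter>S) \<noteq> {} \<longleftrightarrow> V \<inter> \<Inter>S \<noteq> {}" for S
    using assms by blast
  show ?thesis
  proof (intro equalityI subsetI)
    fix L assume "L \<in> layers V' ((\<lambda>H. V' \<inter> g -` H) ` A)"
    then obtain S where "S \<subseteq> A" "L = V' \<inter> \<Inter>((\<lambda>H. V' \<inter> g -` H) ` S)" "L \<noteq> {}"
      unfolding layers_def subset_image_iff by blast
    then have "S \<subseteq> A" "L = V' \<inter> g -` (V \<inter> \<Inter>S)" "V \<inter> \<Inter>S \<noteq> {}"
      using Inter nonempty by auto
    then show "L \<in> (\<lambda>X. V' \<inter> g -` X) ` layers V A" unfolding layers_def by blast
  next
    fix L assume "L \<in> (\<lambda>X. V' \<inter> g -` X) ` layers V A"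
    then obtain S where "S \<subseteq> A" "L = V' \<inter> g -` (V \<inter> \<Inter>S)" "V \<inter> \<Inter>S \<noteq> {}"
      by (auto simp: layers_def)
    then show "L \<in> layers V' ((\<lambda>H. V' \<inter> g -` H) ` A)"
      unfolding layers_def mem_Collect_eq using nonempty Inter by (metis image_mono)
  qed
qed

lemma supersolvable_layers_vimage:
  assumes g: "g ` V' = V"
  shows "supersolvable (layers V' ((\<lambda>H. V' \<inter> g -` H) ` A)) (\<supseteq>) \<longleftrightarrow> supersolvable (layers V A) (\<supseteq>)"
proof -
  define R where "R X Y \<longleftrightarrow> Y \<subseteq> V \<and> X = V' \<inter> g -` Y" for X Y
  have le_iff: "V' \<inter> g -` X \<subseteq> V' \<inter> g -` Y \<longleftrightarrow> X \<subseteq> Y" if "X \<subseteq> V" for X Y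
    using g that by blast
  have "bi_unique R"
    unfolding bi_unique_def R_def using le_iff by (metis subset_antisym order_refl)
  moreover have "rel_fun R (rel_fun R (=)) (\<supseteq>) (\<supseteq>)"
    using le_iff by (auto simp: rel_fun_def R_def)
  moreover have "rel_set R (layers V' ((\<lambda>H. V' \<inter> g -` H) ` A)) (layers V A)"
  proof -
    have "X \<subseteq> V" if "X \<in> layers V A" for X using that by (auto simp: layers_def)
    then show ?thesis unfolding layers_vimage[OF g] rel_set_def R_def by blast
  qed
  ultimately show ?thesis using supersolvable_transfer by blast
qed

locale finite_dim_subspace = vector_space scale
  for scale :: "'a::field \<Rightarrow> 'v::ab_group_add \<Rightarrow> 'v" +
  fixes V :: "'v set"
  assumes subspace_V: "subspace V" and finite_dim_V: "\<exists>B. finite B \<and> V \<subseteq> span B"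
begin

lemma finite_basis_exists:
  assumes "W \<subseteq> V"
  obtains B where "B \<subseteq> W" "independent B" "W \<subseteq> span B" "finite B" "card B = dim W"
proof -
  obtain B where B: "B \<subseteq> W" "independent B" "W \<subseteq> span B" "card B = dim W" by (rule basis_exists)
  obtain C where "finite C" "V \<subseteq> span C" using finite_dim_V by blast
  then have "finite B" using independent_span_bound[of C B] B(1,2) assms by blast
  then show thesis using that B by blast
qed

lemma dim_subspace_less:
  assumes "W \<subseteq> V" "subspace U" "U \<subset> W"
  shows "dim U < dim W"
proof -
  obtain B where B: "B \<subseteq> U" "independent B" "U \<subseteq> span B" "finite B" "card B = dim U"
    using finite_basis_exists[of U] assms by blast
  obtain C where C: "C \<subseteq> W" "independent C" "W \<subseteq> span C" "finite C" "card C = dim W"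
    using finite_basis_exists[OF assms(1)] by blast
  obtain u where u: "u \<in> W" "u \<notin> U" using assms(3) by blast
  have "u \<notin> span B" using u(2) span_minimal[OF B(1) assms(2)] by blast
  then have "independent (insert u B)" using B(2) by (rule independent_insertI)
  moreover have "insert u B \<subseteq> span C" using u(1) B(1) C(3) assms(3) by blast
  ultimately have "card (insert u B) \<le> card C" using independent_span_bound[OF C(4)] by blast
  moreover have "u \<notin> B" using u(2) B(1) by blast
  ultimately show ?thesis using B(4,5) C(5) by simp
qed

lemma dim_subspace_le: "W \<subseteq> V \<Longrightarrow> subspace U \<Longrightarrow> U \<subseteq> W \<Longrightarrow> dim U \<le> dim W"
  using dim_subspace_less[of W U] by (cases "U = W") (auto simp: psubset_eq)

lemma subspace_eq_zero_if_dim_eq_0: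
  assumes "U \<subseteq> V" "subspace U" "dim U = 0"
  shows "U = {0}"
proof -
  obtain B where "U \<subseteq> span B" "finite B" "card B = dim U"
    using finite_basis_exists[OF assms(1)] by metis
  then have "U \<subseteq> {0}" using assms(3) by simp
  then show ?thesis using subspace_0[OF assms(2)] by blast
qed

lemma dim_le_Suc_dim_kernel:
  assumes U: "U \<subseteq> V" "subspace U" and f: "Vector_Spaces.linear scale (*) f"
  shows "dim U \<le> Suc (dim {x \<in> U. f x = 0})"
proof (cases "\<forall>x\<in>U. f x = 0")
  case True
  then have "{x \<in> U. f x = 0} = U" by blast
  then show ?thesis by simp
next
  case False
  then obtain u where u: "u \<in> U" "f u \<noteq> 0" by blast
  interpret f: Vector_Spaces.linear scale "(*)" f by (rule f)
  have "{x \<in> U. f x = 0} \<subseteq> V" using U(1) by blast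
  then obtain B where "B \<subseteq> {x \<in> U. f x = 0}" "independent B"
    and B: "{x \<in> U. f x = 0} \<subseteq> span B" "finite B" "card B = dim {x \<in> U. f x = 0}"
    by (rule finite_basis_exists)
  have "U \<subseteq> span (insert u B)"
  proof
    fix w assume w: "w \<in> U"
    then have "w - scale (f w / f u) u \<in> {x \<in> U. f x = 0}"
      using u U(2) by (auto intro!: subspace_diff subspace_scale simp: f.diff f.scale)
    then show "w \<in> span (insert u B)" using B(1) span_breakdown_eq by blast
  qed
  then have "dim U \<le> card (insert u B)" using B(2) dim_le_card by blast
  also have "\<dots> \<le> Suc (card B)" by (rule card_insert_le_m1) (auto simp: B(2))
  finally show ?thesis using B(3) by simp
qed

end

definition directions :: "'v::ab_group_add set \<Rightarrow> 'v set" where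
  "directions X = {v. \<forall>x\<in>X. x + v \<in> X}"

lemma directions_singleton: "directions {x} = {0}"
  by (auto simp: directions_def)

locale hyperplane_arrangement = finite_dim_subspace scale V
  for scale :: "complex \<Rightarrow> 'v::ab_group_add \<Rightarrow> 'v" and V +
  fixes A :: "'v set set"
  assumes arrangement: "affine_arrangement scale V A"
begin

lemmas V_closed = subspace_add[OF subspace_V] subspace_diff[OF subspace_V]
  subspace_scale[OF subspace_V] subspace_0[OF subspace_V]

lemma add_mem_V_iff: "x \<in> V \<Longrightarrow> x + v \<in> V \<longleftrightarrow> v \<in> V"
  using V_closed(1)[of x v] V_closed(2)[of "x + v" x] by auto

lemma finite_A: "finite A"
  using arrangement by (simp add: affine_arrangement_def)

definition linear_form :: "'v set \<Rightarrow> 'v \<Rightarrow> complex" where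
  "linear_form H = (SOME f. Vector_Spaces.linear scale (*) f \<and> (\<exists>v\<in>V. f v \<noteq> 0) \<and>
      (\<exists>c. H = {v \<in> V. f v = c}))"

definition level :: "'v set \<Rightarrow> complex" where
  "level H = (SOME c. H = {v \<in> V. linear_form H v = c})"

lemma
  assumes "H \<in> A"
  shows linear_linear_form: "Vector_Spaces.linear scale (*) (linear_form H)"
    and linear_form_nonzero: "\<exists>v\<in>V. linear_form H v \<noteq> 0"
    and hyperplane_eq: "H = {v \<in> V. linear_form H v = level H}"
proof -
  have "affine_hyperplane scale V H" using arrangement assms by (simp add: affine_arrangement_def)
  then have "\<exists>f. Vector_Spaces.linear scale (*) f \<and> (\<exists>v\<in>V. f v \<noteq> 0) \<and> (\<exists>c. H = {v \<in> V. f v = c})"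
    unfolding affine_hyperplane_def by blast
  from someI_ex[OF this, folded linear_form_def]
  show "Vector_Spaces.linear scale (*) (linear_form H)" "\<exists>v\<in>V. linear_form H v \<noteq> 0"
    and "H = {v \<in> V. linear_form H v = level H}"
    using someI_ex[of "\<lambda>c. H = {v \<in> V. linear_form H v = c}", folded level_def] by blast+
qed

lemma mem_hyperplane_iff: "H \<in> A \<Longrightarrow> x \<in> H \<longleftrightarrow> x \<in> V \<and> linear_form H x = level H"
  using hyperplane_eq by blast

lemma linear_form_simps:
  assumes "H \<in> A"
  shows "linear_form H (x + y) = linear_form H x + linear_form H y"
    "linear_form H (x - y) = linear_form H x - linear_form H y"
    "linear_form H (scale c x) = c * linear_form H x" "linear_form H 0 = 0"
proof -
  interpret Vector_Spaces.linear scale "(*)" "linear_form H" by (rule linear_linear_form[OF assms])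
  show "linear_form H (x + y) = linear_form H x + linear_form H y"
    "linear_form H (x - y) = linear_form H x - linear_form H y"
    "linear_form H (scale c x) = c * linear_form H x" "linear_form H 0 = 0"
    by (simp_all add: add diff scale)
qed

lemma hyperplane_subset: "H \<in> A \<Longrightarrow> H \<subseteq> V"
  using mem_hyperplane_iff by blast

lemma hyperplane_nonempty: assumes "H \<in> A" shows "H \<noteq> {}"
proof -
  obtain w where "w \<in> V" "linear_form H w \<noteq> 0" using linear_form_nonzero[OF assms] by blast
  then have "scale (level H / linear_form H w) w \<in> H"
    using assms by (simp add: mem_hyperplane_iff linear_form_simps V_closed)
  then show ?thesis by blast
qed

lemma hyperplane_neq_V: assumes "H \<in> A" shows "H \<noteq> V"
proof
  assume "H = V"
  obtain w where w: "w \<in> V" "linear_form H w \<noteq> 0" using linear_form_nonzero[OF assms] by blast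
  moreover from w have "w \<in> H" "0 \<in> H" using \<open>H = V\<close> V_closed by auto
  ultimately show False using assms by (simp add: mem_hyperplane_iff linear_form_simps)
qed

lemma hyperplane_translate_iff_linear_form:
  assumes "H \<in> A" "x \<in> H"
  shows "x + v \<in> H \<longleftrightarrow> v \<in> V \<and> linear_form H v = 0"
proof -
  have "x + v \<in> V \<longleftrightarrow> v \<in> V" using add_mem_V_iff assms hyperplane_subset by blast
  then show ?thesis using assms by (simp add: mem_hyperplane_iff linear_form_simps)
qed

lemma mem_directions_hyperplane:
  assumes "H \<in> A" shows "v \<in> directions H \<longleftrightarrow> v \<in> V \<and> linear_form H v = 0"
  using hyperplane_nonempty[OF assms] hyperplane_translate_iff_linear_form[OF assms]
  by (auto simp: directions_def)

lemma hyperplane_translate_iff: "H \<in> A \<Longrightarrow> x \<in> H \<Longrightarrow> x + v \<in> H \<longleftrightarrow> v \<in> directions H"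
  using hyperplane_translate_iff_linear_form mem_directions_hyperplane by simp

lemma subspace_directions_hyperplane: "H \<in> A \<Longrightarrow> subspace (directions H)"
  by (simp add: subspace_def mem_directions_hyperplane V_closed linear_form_simps)

lemma transverse_line_meets_hyperplane:
  assumes "H \<in> A" "v \<in> V" "v \<notin> directions H" "x \<in> V"
  shows "\<exists>t. x + scale t v \<in> H"
  using assms by (intro exI[of _ "(level H - linear_form H x) / linear_form H v"])
    (simp add: mem_hyperplane_iff mem_directions_hyperplane linear_form_simps V_closed)

abbreviation P :: "'v set set" where
  "P \<equiv> layers V A"

lemma layer_nonempty: "X \<in> P \<Longrightarrow> X \<noteq> {}" and layer_subset: "X \<in> P \<Longrightarrow> X \<subseteq> V"
  by (auto simp: layers_def)

lemma V_layer: "V \<in> P"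
  unfolding layers_def using V_closed(4) by (intro CollectI conjI exI[of _ "{}"]) auto

lemma hyperplane_layer: "H \<in> A \<Longrightarrow> H \<in> P"
  unfolding layers_def using hyperplane_nonempty hyperplane_subset
  by (intro CollectI conjI exI[of _ "{H}"]) auto

definition localization :: "'v set \<Rightarrow> 'v set set" where
  "localization X = {H \<in> A. X \<subseteq> H}"

lemma layer_eq_Inter_localization: "X \<in> P \<Longrightarrow> X = V \<inter> \<Inter>(localization X)"
  by (auto simp: layers_def localization_def)

lemma mem_layer_iff: "X \<in> P \<Longrightarrow> x \<in> X \<longleftrightarrow> x \<in> V \<and> (\<forall>H\<in>localization X. x \<in> H)"
  using layer_eq_Inter_localization by blast

lemma layer_subset_hyperplane: "X \<in> P \<Longrightarrow> X \<noteq> V \<Longrightarrow> \<exists>H\<in>A. X \<subseteq> H"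
  using layer_eq_Inter_localization[of X] by (auto simp: localization_def)

lemma Inter_layer:
  assumes "S \<subseteq> P" "V \<inter> \<Inter>S \<noteq> {}"
  shows "V \<inter> \<Inter>S \<in> P"
proof -
  have "V \<inter> \<Inter>S = V \<inter> \<Inter>(\<Union>X\<in>S. localization X)"
    using assms(1) mem_layer_iff by (auto 0 3 simp: subset_iff)
  moreover have "(\<Union>X\<in>S. localization X) \<subseteq> A" by (auto simp: localization_def)
  ultimately show ?thesis using assms(2) unfolding layers_def by blast
qed

lemma Int_layer: "X \<in> P \<Longrightarrow> Y \<in> P \<Longrightarrow> X \<inter> Y \<noteq> {} \<Longrightarrow> X \<inter> Y \<in> P"
  using Inter_layer[of "{X, Y}"] layer_subset[of X] by (simp add: Int_absorb1 inf.coboundedI1)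

lemma finite_layers: "finite P"
proof -
  have "P \<subseteq> (\<lambda>S. V \<inter> \<Inter>S) ` Pow A" by (auto simp: layers_def)
  then show ?thesis using finite_A finite_subset by blast
qed

lemma exists_maximal_layer:
  assumes "Q \<subseteq> P" "X \<in> Q"
  shows "\<exists>Y\<in>maximals Q (\<supseteq>). Y \<subseteq> X"
  using finite_has_minimal2[OF finite_subset[OF assms(1) finite_layers] assms(2)]
  by (auto simp: maximals_def)

lemma layer_translate_iff_localization:
  assumes "X \<in> P" "x \<in> X"
  shows "x + v \<in> X \<longleftrightarrow> v \<in> V \<and> (\<forall>H\<in>localization X. v \<in> directions H)"
proof -
  have "x + v \<in> H \<longleftrightarrow> v \<in> directions H" if "H \<in> localization X" for H
    using that assms(2) hyperplane_translate_iff by (auto simp: localization_def)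
  moreover have "x + v \<in> V \<longleftrightarrow> v \<in> V" using add_mem_V_iff layer_subset assms by blast
  ultimately show ?thesis using mem_layer_iff[OF assms(1), of "x + v"] by simp
qed

lemma directions_layer: "X \<in> P \<Longrightarrow> directions X = V \<inter> (\<Inter>H\<in>localization X. directions H)"
  using layer_nonempty[of X] layer_translate_iff_localization[of X]
  by (auto simp: directions_def[of X])

lemma layer_translate_iff: "X \<in> P \<Longrightarrow> x \<in> X \<Longrightarrow> x + v \<in> X \<longleftrightarrow> v \<in> directions X"
  using layer_translate_iff_localization directions_layer by simp

lemma diff_mem_directions_iff: "X \<in> P \<Longrightarrow> x \<in> X \<Longrightarrow> y - x \<in> directions X \<longleftrightarrow> y \<in> X"
  using layer_translate_iff[of X x "y - x"] by simp

lemma directions_subset: "X \<in> P \<Longrightarrow> directions X \<subseteq> V"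
  using directions_layer by blast

lemma subspace_directions: "X \<in> P \<Longrightarrow> subspace (directions X)"
  unfolding directions_layer
  by (intro subspace_inter subspace_Inter subspace_V ballI)
    (auto simp: localization_def subspace_directions_hyperplane)

lemma directions_Int:
  assumes "X \<in> P" "Y \<in> P" "X \<inter> Y \<noteq> {}"
  shows "directions (X \<inter> Y) = directions X \<inter> directions Y"
proof -
  obtain x where x: "x \<in> X" "x \<in> Y" using assms(3) by blast
  then have "v \<in> directions (X \<inter> Y) \<longleftrightarrow> x + v \<in> X \<inter> Y" for v
    using layer_translate_iff[OF Int_layer[OF assms]] by simp
  then show ?thesis
    using layer_translate_iff[OF assms(1) x(1)] layer_translate_iff[OF assms(2) x(2)] by auto
qed

lemma directions_mono: "X \<in> P \<Longrightarrow> Y \<in> P \<Longrightarrow> X \<subseteq> Y \<Longrightarrow> directions X \<subseteq> directions Y"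
  using directions_Int[of X Y] layer_nonempty[of X] by (simp add: inf.absorb1 le_iff_inf)

lemma directions_strict_mono:
  assumes "X \<in> P" "Y \<in> P" "X \<subset> Y"
  shows "directions X \<subset> directions Y"
proof -
  obtain x y where xy: "x \<in> X" "y \<in> Y" "y \<notin> X" using layer_nonempty assms by blast
  then have "y - x \<in> directions Y" "y - x \<notin> directions X"
    using diff_mem_directions_iff assms by blast+
  then show ?thesis using directions_mono assms by blast
qed

lemma directions_V: "directions V = V"
  using V_layer directions_subset V_closed(1) by (fastforce simp: directions_def)

lemma layer_eq_singleton:
  assumes "X \<in> P" "directions X = {0}" "x \<in> X"
  shows "X = {x}"
  using diff_mem_directions_iff[OF assms(1,3)] assms(2,3) by auto

lemma directions_subset_if_disjoint:
  assumes X: "X \<in> P" and H: "H \<in> A" and "X \<inter> H = {}"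
  shows "directions X \<subseteq> directions H"
proof (rule subsetI, rule ccontr)
  fix v assume v: "v \<in> directions X" "v \<notin> directions H"
  obtain x where x: "x \<in> X" using layer_nonempty[OF X] by blast
  then obtain t where "x + scale t v \<in> H"
    using transverse_line_meets_hyperplane[OF H _ v(2)] v(1) directions_subset[OF X]
      layer_subset[OF X] by blast
  moreover have "x + scale t v \<in> X"
    using layer_translate_iff[OF X x] subspace_scale[OF subspace_directions[OF X] v(1)] by blast
  ultimately show False using \<open>X \<inter> H = {}\<close> by blast
qed

lemma layer_hyperplane_exchange:
  assumes X: "X \<in> P" and K: "K \<in> A" and L: "L \<in> A"
    and "X \<inter> K \<noteq> {}" "X \<inter> K \<subseteq> L" "\<not> X \<subseteq> L"
  shows "X \<inter> L \<subseteq> K"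
proof
  fix y assume y: "y \<in> X \<inter> L"
  obtain x z where x: "x \<in> X" "x \<in> K" "x \<in> L" and z: "z \<in> X" "z \<notin> L" using assms by blast
  define w where "w = z - x"
  have w: "w \<in> directions X" using diff_mem_directions_iff[OF X x(1)] z(1) by (simp add: w_def)
  have "w \<notin> directions K" "w \<notin> directions L"
    using diff_mem_directions_iff[OF hyperplane_layer[OF K] x(2)]
      diff_mem_directions_iff[OF hyperplane_layer[OF L] x(3)] z assms(5) by (auto simp: w_def)
  then obtain t where t: "y + scale t w \<in> K"
    using transverse_line_meets_hyperplane[OF K, of w y] w y
      directions_subset[OF X] layer_subset[OF X]
    by blast
  have "y + scale t w \<in> X"
    using layer_translate_iff[OF X, of y] subspace_scale[OF subspace_directions[OF X] w] y by blast
  then have "y + scale t w \<in> L" using t assms(5) by blast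
  then have "scale t w \<in> directions L"
    using layer_translate_iff[OF hyperplane_layer[OF L]] y by blast
  then have "t = 0"
    using \<open>w \<notin> directions L\<close> w directions_subset[OF X]
    by (auto simp: mem_directions_hyperplane[OF L] linear_form_simps[OF L])
  then show "y \<in> K" using t by simp
qed

lemma hyperplane_subset_imp_eq:
  assumes "H \<in> A" "K \<in> A" "H \<subseteq> K"
  shows "H = K"
proof -
  have "V \<inter> H = H" "V \<inter> K = K" using hyperplane_subset assms by blast+
  moreover have "\<not> V \<subseteq> K" using hyperplane_neq_V hyperplane_subset assms by blast
  ultimately show ?thesis
    using layer_hyperplane_exchange[OF V_layer, of H K] hyperplane_nonempty assms by auto
qed

lemma dim_directions_le: "X \<in> P \<Longrightarrow> dim (directions X) \<le> dim V"
  using dim_subspace_le[OF order_refl subspace_directions directions_subset] .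

lemma dim_directions_strict_mono:
  "X \<in> P \<Longrightarrow> Y \<in> P \<Longrightarrow> X \<subset> Y \<Longrightarrow> dim (directions X) < dim (directions Y)"
  using dim_subspace_less[OF directions_subset subspace_directions directions_strict_mono] by blast

lemma layer_cover:
  assumes Y: "Y \<in> P" "Y \<noteq> V"
  shows "\<exists>X\<in>P. Y \<subset> X \<and> dim (directions X) = Suc (dim (directions Y))"
proof -
  define U where "U = {X \<in> P. Y \<subset> X}"
  have "finite U" "V \<in> U" using finite_layers V_layer layer_subset Y by (auto simp: U_def)
  then obtain X where "X \<in> U" and min: "\<And>Z. Z \<in> U \<Longrightarrow> Z \<subseteq> X \<Longrightarrow> X = Z"
    using finite_has_minimal2 by meson
  then have X: "X \<in> P" "Y \<subset> X" by (simp_all add: U_def)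
  obtain x where "x \<in> X" "x \<notin> Y" using X(2) by blast
  then obtain H where H: "H \<in> A" "Y \<subseteq> H" "\<not> X \<subseteq> H"
    using mem_layer_iff[OF Y(1), of x] layer_subset[OF X(1)] by (auto simp: localization_def)
  have "X \<inter> H \<noteq> {}" using layer_nonempty[OF Y(1)] H(2) X(2) by blast
  then have "X \<inter> H \<in> P" by (rule Int_layer[OF X(1) hyperplane_layer[OF H(1)]])
  have XH: "Y = X \<inter> H"
  proof (rule ccontr)
    assume "Y \<noteq> X \<inter> H"
    moreover have "Y \<subseteq> X \<inter> H" using H(2) X(2) by blast
    ultimately have "X \<inter> H \<in> U" using \<open>X \<inter> H \<in> P\<close> by (simp add: U_def psubset_eq)
    then have "X = X \<inter> H" by (rule min) simp
    then show False using H(3) by blast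
  qed
  have "directions Y = directions X \<inter> directions H"
    using directions_Int[OF X(1) hyperplane_layer[OF H(1)] \<open>X \<inter> H \<noteq> {}\<close>] by (simp add: XH)
  also have "\<dots> = {v \<in> directions X. linear_form H v = 0}"
    using directions_subset[OF X(1)] mem_directions_hyperplane[OF H(1)] by blast
  finally have "dim (directions X) \<le> Suc (dim (directions Y))"
    using dim_le_Suc_dim_kernel[OF directions_subset[OF X(1)] subspace_directions[OF X(1)]
        linear_linear_form[OF H(1)]]
    by simp
  then show ?thesis using dim_directions_strict_mono[OF Y(1) X(1,2)] X by (intro bexI[of _ X]) auto
qed

lemma elem_rank_layer:
  assumes "X \<in> P"
  shows "elem_rank P (\<supseteq>) X = dim V - dim (directions X)"
proof (rule elem_rank_eq_rank_function)
  show "rank_function P (\<supseteq>) (\<lambda>X. dim V - dim (directions X))"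
    unfolding rank_function_def
  proof (intro conjI ballI impI)
    fix X Y assume "X \<in> P" "Y \<in> P" "Y \<subseteq> X" "X \<noteq> Y"
    moreover from this have "Y \<subset> X" by blast
    ultimately show "dim V - dim (directions X) < dim V - dim (directions Y)"
      using dim_directions_strict_mono[of Y X] dim_directions_le[of X]
      by (simp add: diff_less_mono2)
  next
    fix Y assume Y: "Y \<in> P" "0 < dim V - dim (directions Y)"
    then have "Y \<noteq> V" by (auto simp: directions_V)
    then obtain X where "X \<in> P" "Y \<subset> X" "dim (directions X) = Suc (dim (directions Y))"
      using layer_cover[OF Y(1)] by blast
    then show "\<exists>X\<in>P. Y \<subseteq> X \<and> dim V - dim (directions Y) = Suc (dim V - dim (directions X))"
      using dim_directions_le[of X] by (intro bexI[of _ X]) auto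
  qed
qed (use assms in auto)

end

subsection \<open>Covers by hyperplanes\<close>

context hyperplane_arrangement
begin

lemma finite_line_Int_hyperplane:
  assumes "H \<in> A" "x \<in> V" "w \<in> V" "x \<notin> H"
  shows "finite {t. x + scale t w \<in> H}"
proof (rule finite_subset)
  show "{t. x + scale t w \<in> H} \<subseteq> {(level H - linear_form H x) / linear_form H w}"
    using assms by (auto simp: mem_hyperplane_iff linear_form_simps V_closed eq_divide_eq
        eq_diff_eq add.commute)
qed simp

lemma subset_hyperplane_if_subset_Union:
  assumes line_closed: "\<And>x y t. x \<in> Y \<Longrightarrow> y \<in> Y \<Longrightarrow> x + scale t (y - x) \<in> Y"
    and "Y \<subseteq> V" "Y \<noteq> {}" "S \<subseteq> A" "Y \<subseteq> \<Union>S"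
  shows "\<exists>H\<in>S. Y \<subseteq> H"
  using finite_subset[OF \<open>S \<subseteq> A\<close> finite_A] \<open>S \<subseteq> A\<close> \<open>Y \<subseteq> \<Union>S\<close>
proof (induction S)
  case empty
  then show ?case using \<open>Y \<noteq> {}\<close> by simp
next
  case (insert H S)
  show ?case
  proof (rule ccontr)
    assume none: "\<not> (\<exists>K\<in>insert H S. Y \<subseteq> K)"
    then have "\<not> Y \<subseteq> \<Union>S" using insert by blast
    then obtain x where x: "x \<in> Y" "x \<notin> \<Union>S" by blast
    then have "x \<in> H" using insert.prems(2) by blast
    obtain y where y: "y \<in> Y" "y \<notin> H" using none by blast
    have V: "x \<in> V" "y - x \<in> V" using x(1) y(1) \<open>Y \<subseteq> V\<close> V_closed(2) by blast+
    have "finite {t. x + scale t (y - x) \<in> K}" if "K \<in> S" for K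
      using that insert.prems(1) x(2) V by (intro finite_line_Int_hyperplane) auto
    then have "finite (\<Union>K\<in>S. {t. x + scale t (y - x) \<in> K})" using insert.hyps(1) by blast
    moreover have "UNIV - {0} \<subseteq> (\<Union>K\<in>S. {t. x + scale t (y - x) \<in> K})"
    proof
      fix t :: complex assume "t \<in> UNIV - {0}"
      moreover have "linear_form H y \<noteq> linear_form H x"
        using \<open>x \<in> H\<close> y insert.prems(1) \<open>Y \<subseteq> V\<close> by (auto simp: mem_hyperplane_iff)
      ultimately have "x + scale t (y - x) \<notin> H"
        using insert.prems(1) \<open>x \<in> H\<close> by (auto simp: mem_hyperplane_iff linear_form_simps)
      moreover have "x + scale t (y - x) \<in> \<Union>(insert H S)"
        using line_closed[OF x(1) y(1)] insert.prems(2) by blast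
      ultimately show "t \<in> (\<Union>K\<in>S. {t. x + scale t (y - x) \<in> K})" by blast
    qed
    ultimately have "finite (UNIV - {0 :: complex})" by (rule rev_finite_subset)
    then show False using infinite_UNIV_char_0[where 'a = complex] by simp
  qed
qed

lemma complement_nonempty: "arr_complement V A \<noteq> {}"
proof
  assume "arr_complement V A = {}"
  then have "V \<subseteq> \<Union>A" by (auto simp: arr_complement_def)
  moreover have "V \<noteq> {}" using V_closed(4) by blast
  ultimately have "\<exists>H\<in>A. V \<subseteq> H" by (intro subset_hyperplane_if_subset_Union) (auto simp: V_closed)
  then show False using hyperplane_neq_V hyperplane_subset by blast
qed

lemma hyperplane_translate_line: "H \<in> A \<Longrightarrow> x \<in> H \<Longrightarrow> y \<in> H \<Longrightarrow> x + scale t (y - x) \<in> H"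
  by (simp add: mem_hyperplane_iff linear_form_simps V_closed)

lemma affine_hyperplane_subset_if_subset_Union:
  assumes K: "affine_hyperplane scale V K" "K \<subseteq> \<Union>A"
  shows "\<exists>H\<in>A. K \<subseteq> H"
proof -
  interpret K: hyperplane_arrangement scale V "{K}"
    using K(1) by unfold_locales (simp add: affine_arrangement_def)
  show ?thesis
    using K.hyperplane_translate_line[of K] K.hyperplane_subset[of K] K.hyperplane_nonempty[of K]
      K(2)
    by (intro subset_hyperplane_if_subset_Union) auto
qed

end

lemma arr_complement_inject:
  fixes scale :: "complex \<Rightarrow> 'v::ab_group_add \<Rightarrow> 'v"
  assumes "hyperplane_arrangement scale V A" "hyperplane_arrangement scale V B"
    and complement: "arr_complement V A = arr_complement V B"
  shows "A = B"
proof -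
  have "A \<subseteq> B"
    if A: "hyperplane_arrangement scale V A" and B: "hyperplane_arrangement scale V B"
      and complement: "arr_complement V A = arr_complement V B" for A B
  proof
    interpret A: hyperplane_arrangement scale V A by (rule A)
    interpret B: hyperplane_arrangement scale V B by (rule B)
    have Union: "\<Union>A = \<Union>B"
      using complement A.hyperplane_subset B.hyperplane_subset unfolding arr_complement_def by blast
    have affine: "affine_hyperplane scale V H" if "H \<in> A \<union> B" for H
      using that A.arrangement B.arrangement by (auto simp: affine_arrangement_def)
    fix H assume H: "H \<in> A"
    then obtain K where K: "K \<in> B" "H \<subseteq> K"
      using B.affine_hyperplane_subset_if_subset_Union[of H] affine Union by blast
    then obtain L where L: "L \<in> A" "K \<subseteq> L"
      using A.affine_hyperplane_subset_if_subset_Union[of K] affine Union by blast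
    have "H = L" by (rule A.hyperplane_subset_imp_eq[OF H L(1) subset_trans[OF K(2) L(2)]])
    then show "H \<in> B" using K L by auto
  qed
  then show ?thesis using assms by (metis subset_antisym)
qed

section \<open>M-ideals of corank one and modular directions\<close>

context hyperplane_arrangement
begin

lemma bottom_of_layers_iff: "bottom_of P (\<supseteq>) X \<longleftrightarrow> X = V"
  using V_layer layer_subset by (auto simp: bottom_of_def)

lemma atoms_layers: "atoms P (\<supseteq>) = A"
proof (intro equalityI subsetI)
  fix a assume "a \<in> atoms P (\<supseteq>)"
  then have a: "a \<in> P" "a \<noteq> V" and min: "\<And>y. y \<in> P \<Longrightarrow> y \<noteq> V \<Longrightarrow> a \<subseteq> y \<Longrightarrow> y = a"
    by (auto simp: atoms_def minimals_def bottom_of_layers_iff)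
  obtain H where "H \<in> A" "a \<subseteq> H" using layer_subset_hyperplane[OF a] by blast
  then show "a \<in> A" using min[of H] hyperplane_layer hyperplane_neq_V by auto
next
  fix a assume a: "a \<in> A"
  have "y = a" if y: "y \<in> P" "y \<noteq> V" "a \<subseteq> y" for y
  proof -
    obtain H where "H \<in> A" "y \<subseteq> H" using layer_subset_hyperplane[OF y(1,2)] by blast
    then show ?thesis using hyperplane_subset_imp_eq[of a H] a y(3) by auto
  qed
  then show "a \<in> atoms P (\<supseteq>)"
    using a by (simp add: atoms_def minimals_def bottom_of_layers_iff hyperplane_layer
      hyperplane_neq_V)
qed

lemma joins_layers:
  assumes "S \<subseteq> P"
  shows "joins P (\<supseteq>) S = (if V \<inter> \<Inter>S = {} then {} else {V \<inter> \<Inter>S})"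
proof (cases "V \<inter> \<Inter>S = {}")
  case True
  have "\<not> (\<forall>s\<in>S. u \<subseteq> s)" if "u \<in> P" for u
    using layer_nonempty[OF that] layer_subset[OF that] True by (auto dest!: Inter_greatest)
  then show ?thesis using True by (auto simp: joins_def minimals_def)
next
  case False
  have "joins P (\<supseteq>) S = {V \<inter> \<Inter>S}"
    using layer_subset by (intro joins_eq_singletonI Inter_layer[OF assms False]) auto
  then show ?thesis using False by simp
qed

lemma joins_layers_pair:
  assumes "X \<in> P" "Y \<in> P"
  shows "joins P (\<supseteq>) {X, Y} = (if X \<inter> Y = {} then {} else {X \<inter> Y})"
proof -
  have "V \<inter> \<Inter>{X, Y} = X \<inter> Y" using layer_subset[OF assms(1)] by auto
  then show ?thesis using joins_layers[of "{X, Y}"] assms by simp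
qed

lemma point_layer_maximal: "{x} \<in> P \<Longrightarrow> {x} \<in> maximals P (\<supseteq>)"
  using layer_nonempty by (auto simp: maximals_def dest: subset_singletonD)

lemma meets_below_point_eq_V_iff:
  assumes X: "X \<in> P" "x \<in> X" and Z: "Z \<in> P"
  shows "meets (below P (\<supseteq>) {x}) (\<supseteq>) {X, Z} = {V} \<longleftrightarrow> localization X \<inter> localization Z = {}"
proof -
  define lower where "lower = {l \<in> below P (\<supseteq>) {x}. \<forall>s\<in>{X, Z}. s \<subseteq> l}"
  have lower: "l \<in> lower \<longleftrightarrow> l \<in> P \<and> X \<subseteq> l \<and> Z \<subseteq> l" for l
    using X(2) by (auto simp: lower_def below_def)
  have bottom: "bottom_of lower (\<supseteq>) V"
    using V_layer layer_subset X(1) Z by (simp add: bottom_of_def lower)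
  then have "meets (below P (\<supseteq>) {x}) (\<supseteq>) {X, Z} = {V} \<longleftrightarrow> lower = {V}"
    unfolding meets_def lower_def[symmetric] by (rule maximals_eq_bottom_iff)
  also have "\<dots> \<longleftrightarrow> localization X \<inter> localization Z = {}"
  proof
    assume "lower = {V}"
    then show "localization X \<inter> localization Z = {}"
      using lower hyperplane_layer hyperplane_neq_V by (auto simp: localization_def)
  next
    assume disjoint: "localization X \<inter> localization Z = {}"
    have "l = V" if "l \<in> lower" for l
    proof (rule ccontr)
      have l: "l \<in> P" "X \<subseteq> l" "Z \<subseteq> l" using that lower by simp_all
      assume "l \<noteq> V"
      then obtain H where H: "H \<in> A" "l \<subseteq> H" using layer_subset_hyperplane[OF l(1)] by blast
      have "H \<in> localization X \<inter> localization Z"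
        using H(1) subset_trans[OF l(2) H(2)] subset_trans[OF l(3) H(2)]
        by (simp add: localization_def)
      then show False using disjoint by simp
    qed
    then show "lower = {V}" using bottom unfolding bottom_of_def by blast
  qed
  finally show ?thesis .
qed

lemma mem_complements_below_point_iff:
  assumes x: "{x} \<in> P" and X: "X \<in> P" "x \<in> X" and Z: "Z \<in> P" "x \<in> Z"
  shows "Z \<in> complements (below P (\<supseteq>) {x}) (\<supseteq>) X \<longleftrightarrow>
    X \<inter> Z = {x} \<and> localization X \<inter> localization Z = {}"
proof -
  let ?L = "below P (\<supseteq>) {x}"
  have L: "Y \<in> ?L \<longleftrightarrow> Y \<in> P \<and> x \<in> Y" for Y by (auto simp: below_def)
  have "x \<in> V" using layer_subset[OF x] by simp
  have max: "maximals ?L (\<supseteq>) = {{x}}" by (rule maximals_eq_singletonI) (use x in \<open>auto simp: L\<close>)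
  have min: "minimals ?L (\<supseteq>) = {V}"
    by (rule minimals_eq_singletonI) (use V_layer layer_subset \<open>x \<in> V\<close> in \<open>auto simp: L\<close>)
  have "X \<inter> Z \<in> P" using Int_layer X Z by blast
  then have join: "joins ?L (\<supseteq>) {X, Z} = {X \<inter> Z}"
    by (intro joins_eq_singletonI) (use X Z in \<open>auto simp: L\<close>)
  show ?thesis
    using L[of Z] Z meets_below_point_eq_V_iff[OF X Z(1)]
    by (simp add: complements_def join max min)
qed

end

definition lineality :: "'v::ab_group_add set \<Rightarrow> 'v set set \<Rightarrow> 'v set" where
  "lineality V A = V \<inter> (\<Inter>H\<in>A. directions H)"

definition parallel_part :: "'v::ab_group_add set set \<Rightarrow> 'v \<Rightarrow> 'v set set" where
  "parallel_part A v = {H \<in> A. v \<in> directions H}"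

abbreviation transverse_part :: "'v::ab_group_add set set \<Rightarrow> 'v \<Rightarrow> 'v set set" where
  "transverse_part A v \<equiv> A - parallel_part A v"

definition modular_direction :: "'v::ab_group_add set set \<Rightarrow> 'v \<Rightarrow> bool" where
  "modular_direction A v \<longleftrightarrow>
     (\<forall>H \<in> transverse_part A v. \<forall>K \<in> transverse_part A v. H \<noteq> K \<longrightarrow> H \<inter> K \<noteq> {} \<longrightarrow>
        (\<exists>L\<in>parallel_part A v. H \<inter> K \<subseteq> L))"

lemma (in hyperplane_arrangement) directions_maximal_layer:
  assumes "Y \<in> maximals P (\<supseteq>)"
  shows "directions Y = lineality V A"
proof
  have Y: "Y \<in> P" and max: "\<And>X. X \<in> P \<Longrightarrow> X \<subseteq> Y \<Longrightarrow> X = Y" using assms by (auto simp: maximals_def)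
  have "directions Y \<subseteq> directions H" if H: "H \<in> A" for H
  proof (cases "Y \<inter> H = {}")
    case True
    then show ?thesis by (rule directions_subset_if_disjoint[OF Y H])
  next
    case False
    then have "Y \<inter> H = Y" using max[of "Y \<inter> H"] Int_layer[OF Y hyperplane_layer[OF H]] by simp
    then show ?thesis using directions_mono[OF Y hyperplane_layer[OF H]] by blast
  qed
  then show "directions Y \<subseteq> lineality V A"
    using directions_subset[OF Y] by (auto simp: lineality_def)
  show "lineality V A \<subseteq> directions Y"
    unfolding lineality_def directions_layer[OF Y] by (auto simp: localization_def)
qed

locale essential_arrangement = hyperplane_arrangement +
  assumes lineality_eq_0: "lineality V A = {0}"
begin

lemma maximal_layer_is_point:
  assumes "Y \<in> maximals P (\<supseteq>)"
  obtains x where "Y = {x}"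
proof -
  have Y: "Y \<in> P" using assms by (simp add: maximals_def)
  obtain x where "x \<in> Y" using layer_nonempty[OF Y] by blast
  then have "Y = {x}"
    using layer_eq_singleton[OF Y] directions_maximal_layer[OF assms] lineality_eq_0 by simp
  then show thesis by (rule that)
qed

lemma point_in_layer:
  assumes "X \<in> P"
  obtains x where "{x} \<in> P" "x \<in> X"
proof -
  obtain Y where Y: "Y \<in> maximals P (\<supseteq>)" "Y \<subseteq> X"
    using exists_maximal_layer[OF order_refl assms] by blast
  obtain x where "Y = {x}" using maximal_layer_is_point[OF Y(1)] .
  then show thesis using Y that by (auto simp: maximals_def)
qed

lemma poset_rank_layers: "poset_rank P (\<supseteq>) = dim V"
proof (rule poset_rank_eqI)
  show "maximals P (\<supseteq>) \<noteq> {}" using exists_maximal_layer[OF order_refl V_layer] by blast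
  fix Y assume "Y \<in> maximals P (\<supseteq>)"
  then have "Y \<in> P" "directions Y = {0}"
    using directions_maximal_layer lineality_eq_0 by (auto simp: maximals_def)
  moreover have "dim {0} = 0" using dim_le_card[of "{0}" "{}"] by simp
  ultimately show "elem_rank P (\<supseteq>) Y = dim V" using elem_rank_layer by simp
qed

end

locale corank_one_M_ideal = essential_arrangement +
  fixes Q
  assumes M_ideal: "M_ideal P (\<supseteq>) Q" and corank_one: "dim V = Suc (poset_rank Q (\<supseteq>))"
    and nonempty: "Q \<noteq> {}"
begin

lemma order_ideal: "order_ideal P (\<supseteq>) Q"
  using M_ideal by (simp add: M_ideal_def)

lemma ideal_subset: "Q \<subseteq> P" and ideal_superset: "Y \<in> Q \<Longrightarrow> X \<in> P \<Longrightarrow> Y \<subseteq> X \<Longrightarrow> X \<in> Q"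
  using order_ideal unfolding order_ideal_def by meson+

lemma ideal_Inter:
  assumes "S \<subseteq> Q" "V \<inter> \<Inter>S \<noteq> {}"
  shows "V \<inter> \<Inter>S \<in> Q"
proof -
  have "joins P (\<supseteq>) S \<subseteq> Q" using M_ideal assms(1) by (simp add: M_ideal_def join_closed_def)
  moreover have "S \<subseteq> P" using assms(1) ideal_subset by (rule subset_trans)
  ultimately show ?thesis using joins_layers assms(2) by simp
qed

lemma ideal_Int: "X \<in> Q \<Longrightarrow> Y \<in> Q \<Longrightarrow> X \<inter> Y \<noteq> {} \<Longrightarrow> X \<inter> Y \<in> Q"
  using ideal_Inter[of "{X, Y}"] ideal_subset layer_subset[of X]
  by (simp add: Int_absorb1 inf.coboundedI1 subset_iff)

lemma hyperplane_outside_meets: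
  assumes "Y \<in> Q" "H \<in> A" "H \<notin> Q"
  shows "Y \<inter> H \<noteq> {}"
proof
  assume "Y \<inter> H = {}"
  then have "joins P (\<supseteq>) {H, Y} = {}"
    using joins_layers_pair[OF hyperplane_layer[OF assms(2)], of Y] assms(1) ideal_subset
    by (simp add: Int_commute subset_iff)
  then show False using M_ideal assms unfolding M_ideal_def atoms_layers by blast
qed

lemma dim_directions_maximal:
  assumes "Y \<in> maximals Q (\<supseteq>)"
  shows "dim (directions Y) = 1"
proof -
  have Y: "Y \<in> Q" "Y \<in> P" using assms ideal_subset by (auto simp: maximals_def)
  have "pure Q (\<supseteq>)" using M_ideal by (simp add: M_ideal_def)
  then have "elem_rank P (\<supseteq>) Y = poset_rank Q (\<supseteq>)"
    using elem_rank_maximal_if_pure[OF _ assms] elem_rank_order_ideal[OF order_ideal Y(1)] by simp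
  then show ?thesis using elem_rank_layer[OF Y(2)] dim_directions_le[OF Y(2)] corank_one by linarith
qed

lemma directions_maximal_subset:
  assumes "Y \<in> maximals Q (\<supseteq>)" "H \<in> A" "H \<in> Q"
  shows "directions Y \<subseteq> directions H"
proof -
  have Y: "Y \<in> Q" and max: "\<And>X. X \<in> Q \<Longrightarrow> X \<subseteq> Y \<Longrightarrow> X = Y" using assms(1) by (auto simp: maximals_def)
  then have "Y \<in> P" using ideal_subset by blast
  show ?thesis
  proof (cases "Y \<inter> H = {}")
    case True
    then show ?thesis by (rule directions_subset_if_disjoint[OF \<open>Y \<in> P\<close> assms(2)])
  next
    case False
    then have "Y \<inter> H = Y" using max[of "Y \<inter> H"] ideal_Int[OF Y assms(3)] by simp
    then show ?thesis using directions_mono[OF \<open>Y \<in> P\<close> hyperplane_layer[OF assms(2)]] by blast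
  qed
qed

lemma maximal_Int_hyperplane_outside:
  assumes "Y \<in> maximals Q (\<supseteq>)" "H \<in> A" "H \<notin> Q" "x \<in> Y \<inter> H"
  shows "Y \<inter> H = {x}"
proof -
  have Y: "Y \<in> Q" "Y \<in> P" using assms(1) ideal_subset by (auto simp: maximals_def)
  have YH: "Y \<inter> H \<in> P" using Int_layer[OF Y(2) hyperplane_layer[OF assms(2)]] assms(4) by auto
  have "\<not> Y \<subseteq> H" using ideal_superset[OF Y(1) hyperplane_layer[OF assms(2)]] assms(3) by metis
  then have "Y \<inter> H \<subset> Y" by blast
  then have "dim (directions (Y \<inter> H)) = 0"
    using dim_directions_strict_mono[OF YH Y(2)] dim_directions_maximal[OF assms(1)] by simp
  then have "directions (Y \<inter> H) = {0}"
    using subspace_eq_zero_if_dim_eq_0[OF directions_subset[OF YH] subspace_directions[OF YH]]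
    by simp
  then show ?thesis using layer_eq_singleton[OF YH] assms(4) by simp
qed

lemma Int_hyperplanes_outside_subset:
  assumes H: "H \<in> A" "H \<notin> Q" and K: "K \<in> A" "K \<notin> Q" and "H \<noteq> K" "H \<inter> K \<noteq> {}"
  shows "\<exists>L\<in>A. L \<in> Q \<and> H \<inter> K \<subseteq> L"
proof (rule ccontr)
  assume no: "\<not> (\<exists>L\<in>A. L \<in> Q \<and> H \<inter> K \<subseteq> L)"
  have HK: "H \<inter> K \<in> P"
    using Int_layer[OF hyperplane_layer[OF H(1)] hyperplane_layer[OF K(1)]] assms by blast
  obtain x where x: "{x} \<in> P" "x \<in> H \<inter> K" using point_in_layer[OF HK] .
  obtain Y where Y: "Y \<in> maximals Q (\<supseteq>)" "modular_in (below P (\<supseteq>) {x}) (\<supseteq>) Y"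
    using M_ideal point_layer_maximal[OF x(1)] by (auto simp: M_ideal_def)
  have "Y \<in> Q" using Y(1) by (simp add: maximals_def)
  have YP: "Y \<in> P" and xY: "x \<in> Y" using Y(2) by (auto simp: modular_in_def below_def)
  have YH: "Y \<inter> H = {x}" using maximal_Int_hyperplane_outside[OF Y(1) H] x(2) xY by simp
  have in_ideal: "L \<in> Q" if "L \<in> localization Y" for L
    using ideal_superset[OF \<open>Y \<in> Q\<close> hyperplane_layer] that by (auto simp: localization_def)
  have "localization H = {H}"
    using hyperplane_subset_imp_eq H(1) by (auto simp: localization_def)
  then have "localization Y \<inter> localization H = {}" using in_ideal H(2) by auto
  then have "H \<in> complements (below P (\<supseteq>) {x}) (\<supseteq>) Y"
    using mem_complements_below_point_iff[OF x(1) YP xY hyperplane_layer[OF H(1)]] x(2) YH by simp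
  moreover have "localization Y \<inter> localization (H \<inter> K) = {}"
    using in_ideal no by (auto simp: localization_def)
  then have "H \<inter> K \<in> complements (below P (\<supseteq>) {x}) (\<supseteq>) Y"
    using mem_complements_below_point_iff[OF x(1) YP xY HK] x(2) YH by auto
  ultimately have "H = H \<inter> K" using Y(2) unfolding modular_in_def by (metis Int_lower1)
  then show False using hyperplane_subset_imp_eq[OF H(1) K(1)] \<open>H \<noteq> K\<close> by blast
qed

lemma mem_ideal_iff_parallel:
  assumes Y: "Y \<in> maximals Q (\<supseteq>)" and v: "v \<in> directions Y" "v \<noteq> 0" and H: "H \<in> A"
  shows "H \<in> Q \<longleftrightarrow> v \<in> directions H"
proof
  show "v \<in> directions H" if "H \<in> Q" using directions_maximal_subset[OF Y H that] v(1) by blast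
  show "H \<in> Q" if "v \<in> directions H"
  proof (rule ccontr)
    assume "H \<notin> Q"
    have "Y \<in> Q" "Y \<in> P" using Y ideal_subset by (auto simp: maximals_def)
    then obtain x where "x \<in> Y \<inter> H" using hyperplane_outside_meets[OF _ H \<open>H \<notin> Q\<close>] by blast
    then have "Y \<inter> H = {x}" by (rule maximal_Int_hyperplane_outside[OF Y H \<open>H \<notin> Q\<close>])
    then have "v \<in> directions {x}"
      using directions_Int[OF \<open>Y \<in> P\<close> hyperplane_layer[OF H]] v(1) that by simp
    then show False using v(2) by (simp add: directions_singleton)
  qed
qed

lemma ideal_eq_layers:
  assumes "\<And>H. H \<in> A \<Longrightarrow> H \<in> Q \<longleftrightarrow> H \<in> B" "B \<subseteq> A"
  shows "Q = layers V B"
proof (intro equalityI subsetI)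
  fix X assume X: "X \<in> Q"
  then have XP: "X \<in> P" using ideal_subset by blast
  have "localization X \<subseteq> B"
    using ideal_superset[OF X hyperplane_layer] assms(1) by (auto simp: localization_def)
  then show "X \<in> layers V B"
    unfolding layers_def mem_Collect_eq
    using layer_eq_Inter_localization[OF XP] layer_nonempty[OF XP] by metis
next
  fix X assume "X \<in> layers V B"
  then obtain S where "S \<subseteq> B" "X = V \<inter> \<Inter>S" "X \<noteq> {}" by (auto simp: layers_def)
  then show "X \<in> Q" using ideal_Inter[of S] assms by (auto simp: subset_iff)
qed

lemma modular_direction_exists:
  obtains v where "v \<in> V" "v \<noteq> 0" "modular_direction A v" "Q = layers V (parallel_part A v)"
proof -
  obtain Y where Y: "Y \<in> maximals Q (\<supseteq>)"
    using exists_maximal_layer[OF ideal_subset] nonempty by blast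
  then have YP: "Y \<in> P" using ideal_subset by (auto simp: maximals_def)
  have "\<not> directions Y \<subseteq> {0}"
    using dim_directions_maximal[OF Y] dim_le_card[of "directions Y" "{}"] by auto
  then obtain v where v: "v \<in> directions Y" "v \<noteq> 0" by blast
  have ideal: "H \<in> Q \<longleftrightarrow> H \<in> parallel_part A v" if "H \<in> A" for H
    using mem_ideal_iff_parallel[OF Y v that] that by (simp add: parallel_part_def)
  have sub: "parallel_part A v \<subseteq> A" by (auto simp: parallel_part_def)
  have "modular_direction A v"
    unfolding modular_direction_def
  proof (intro ballI impI)
    fix H K assume "H \<in> transverse_part A v" "K \<in> transverse_part A v" "H \<noteq> K" "H \<inter> K \<noteq> {}"
    then show "\<exists>L\<in>parallel_part A v. H \<inter> K \<subseteq> L"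
      using Int_hyperplanes_outside_subset[of H K] ideal by auto
  qed
  then show thesis
    using that[of v] v directions_subset[OF YP] ideal_eq_layers[OF ideal sub] by blast
qed

end

locale arrangement_with_modular_direction = essential_arrangement +
  fixes v
  assumes v: "v \<in> V" "v \<noteq> 0" and modular: "modular_direction A v"
begin

sublocale parallel: hyperplane_arrangement scale V "parallel_part A v"
  using arrangement by unfold_locales (auto simp: affine_arrangement_def parallel_part_def)

lemma parallel_layers_subset: "parallel.P \<subseteq> P"
  by (auto simp: layers_def parallel_part_def)

lemma parallel_layer_iff: "X \<in> parallel.P \<longleftrightarrow> X \<in> P \<and> v \<in> directions X"
proof
  assume "X \<in> parallel.P"
  moreover have "v \<in> directions H" if "H \<in> parallel_part A v" for H
    using that by (simp add: parallel_part_def)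
  ultimately show "X \<in> P \<and> v \<in> directions X"
    using parallel_layers_subset v(1) parallel.directions_layer[of X]
    by (auto simp: parallel.localization_def)
next
  assume X: "X \<in> P \<and> v \<in> directions X"
  then have "localization X \<subseteq> parallel_part A v"
    using directions_layer[of X] by (auto simp: localization_def parallel_part_def)
  then show "X \<in> parallel.P"
    unfolding layers_def mem_Collect_eq
    using layer_eq_Inter_localization[of X] layer_nonempty[of X] X by metis
qed

definition line_through :: "'a \<Rightarrow> 'a set" where
  "line_through x = range (\<lambda>t. x + scale t v)"

lemma mem_line_through: "x \<in> line_through x"
  unfolding line_through_def by (rule range_eqI[of _ _ 0]) simp

lemma mem_line_throughI: "x + scale t v \<in> line_through x"
  by (auto simp: line_through_def)

lemma transverse_hyperplane_through_point:
  assumes "{x} \<in> P"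
  obtains H where "H \<in> transverse_part A v" "x \<in> H"
proof -
  have "x + v \<notin> {x}" using v(2) by simp
  moreover have "x + v \<in> V" using layer_subset[OF assms] v(1) V_closed by simp
  ultimately obtain H where "H \<in> A" "x \<in> H" "x + v \<notin> H"
    using mem_layer_iff[OF assms, of "x + v"] by (auto simp: localization_def)
  then show thesis using that[of H] by (auto simp: parallel_part_def directions_def)
qed

lemma parallel_Inter_Int_transverse:
  assumes x: "{x} \<in> P" and H: "H \<in> transverse_part A v" "x \<in> H"
    and y: "y \<in> H" "\<And>L. L \<in> parallel_part A v \<Longrightarrow> x \<in> L \<Longrightarrow> y \<in> L"
  shows "y = x"
proof -
  have "y \<in> K" if K: "K \<in> A" "x \<in> K" for K
  proof (cases "K \<in> parallel_part A v \<or> K = H")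
    case True
    then show ?thesis using y K(2) by blast
  next
    case False
    then obtain L where L: "L \<in> parallel_part A v" "H \<inter> K \<subseteq> L"
      using modular H K unfolding modular_direction_def by (metis Diff_iff IntI empty_iff)
    then have "L \<in> A" "x \<in> L" "H \<noteq> L" using H K by (auto simp: parallel_part_def)
    moreover have "H \<in> A" using H(1) by simp
    ultimately have "H \<inter> L \<subseteq> K"
      using layer_hyperplane_exchange[OF hyperplane_layer K(1)] H(2) K(2) L(2)
        hyperplane_subset_imp_eq by (metis IntI empty_iff)
    then show ?thesis using y(1) y(2)[OF L(1) \<open>x \<in> L\<close>] by blast
  qed
  moreover have "y \<in> V" using y(1) H(1) hyperplane_subset by blast
  ultimately show ?thesis using mem_layer_iff[OF x, of y] by (auto simp: localization_def)
qed

lemma line_through_eq_Inter: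
  assumes x: "{x} \<in> P"
  shows "line_through x = V \<inter> \<Inter>{H \<in> parallel_part A v. x \<in> H}"
proof (intro equalityI subsetI)
  have "x \<in> V" using layer_subset[OF x] by simp
  fix y assume "y \<in> line_through x"
  then obtain t where y: "y = x + scale t v" by (auto simp: line_through_def)
  have "y \<in> H" if "H \<in> parallel_part A v" "x \<in> H" for H
    using that subspace_scale[OF subspace_directions_hyperplane] hyperplane_translate_iff
    by (auto simp: y parallel_part_def)
  then show "y \<in> V \<inter> \<Inter>{H \<in> parallel_part A v. x \<in> H}" using \<open>x \<in> V\<close> v(1) V_closed y by simp
next
  fix y assume "y \<in> V \<inter> \<Inter>{H \<in> parallel_part A v. x \<in> H}"
  then have y: "y \<in> V" "\<And>L. L \<in> parallel_part A v \<Longrightarrow> x \<in> L \<Longrightarrow> y \<in> L" by auto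
  obtain H where H: "H \<in> transverse_part A v" "x \<in> H"
    using transverse_hyperplane_through_point[OF x] .
  then obtain t where t: "y + scale t v \<in> H"
    using transverse_line_meets_hyperplane[of H v y] v(1) y(1) by (auto simp: parallel_part_def)
  have "y + scale t v \<in> L" if "L \<in> parallel_part A v" "x \<in> L" for L
    using that y(2) subspace_scale[OF subspace_directions_hyperplane] hyperplane_translate_iff
    by (auto simp: parallel_part_def)
  then have "y + scale t v = x" by (rule parallel_Inter_Int_transverse[OF x H t])
  then have "y = x + scale (- t) v" by (auto simp: eq_diff_eq)
  then show "y \<in> line_through x" using mem_line_throughI[of x "- t"] by simp
qed

lemma line_through_layer:
  assumes "{x} \<in> P"
  shows "line_through x \<in> parallel.P"
  unfolding layers_def mem_Collect_eq
proof (intro conjI exI)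
  show "line_through x \<noteq> {}" using mem_line_through by blast
  show "line_through x = V \<inter> \<Inter>{H \<in> parallel_part A v. x \<in> H}"
    by (rule line_through_eq_Inter[OF assms])
qed blast

lemma directions_line_through:
  assumes "{x} \<in> P"
  shows "directions (line_through x) = span {v}"
proof -
  have "w \<in> directions (line_through x) \<longleftrightarrow> (\<exists>t. w = scale t v)" for w
    using parallel.layer_translate_iff[OF line_through_layer[OF assms] mem_line_through, of w]
    by (auto simp: line_through_def)
  then show ?thesis by (auto simp: span_singleton)
qed

lemma dim_directions_line_through: "{x} \<in> P \<Longrightarrow> dim (directions (line_through x)) = 1"
  using directions_line_through[of x] dim_span_eq_card_independent[of "{v}"] v(2) by simp

lemma maximal_parallel_layer_is_line:
  assumes "Y \<in> maximals parallel.P (\<supseteq>)"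
  obtains x where "{x} \<in> P" "Y = line_through x"
proof -
  have Y: "Y \<in> parallel.P" and max: "\<And>X. X \<in> parallel.P \<Longrightarrow> X \<subseteq> Y \<Longrightarrow> X = Y"
    using assms by (auto simp: maximals_def)
  then have "Y \<in> P" using parallel_layers_subset by blast
  then obtain x where x: "{x} \<in> P" "x \<in> Y" using point_in_layer by blast
  have "line_through x \<subseteq> Y"
    unfolding line_through_eq_Inter[OF x(1)]
    using parallel.mem_layer_iff[OF Y] x(2) by (auto simp: parallel.localization_def)
  then have "Y = line_through x" using max[OF line_through_layer[OF x(1)]] by simp
  then show thesis using x(1) that by blast
qed

lemma line_through_maximal:
  assumes x: "{x} \<in> P"
  shows "line_through x \<in> maximals parallel.P (\<supseteq>)"
proof -
  note line = line_through_layer[OF x]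
  obtain Y where Y: "Y \<in> maximals parallel.P (\<supseteq>)" "Y \<subseteq> line_through x"
    using parallel.exists_maximal_layer[OF order_refl line] by blast
  obtain z where z: "{z} \<in> P" "Y = line_through z" using maximal_parallel_layer_is_line[OF Y(1)] .
  have "dim (directions Y) = dim (directions (line_through x))"
    using dim_directions_line_through x z by simp
  then have "\<not> Y \<subset> line_through x"
    using parallel.dim_directions_strict_mono[OF line_through_layer[OF z(1)] line] z(2) by auto
  then show ?thesis using Y by (auto simp: psubset_eq)
qed

lemma elem_rank_maximal_parallel_layer:
  assumes "Y \<in> maximals parallel.P (\<supseteq>)"
  shows "elem_rank parallel.P (\<supseteq>) Y = dim V - 1"
proof -
  obtain x where x: "{x} \<in> P" "Y = line_through x" using maximal_parallel_layer_is_line[OF assms] .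
  then show ?thesis
    using parallel.elem_rank_layer[OF line_through_layer[OF x(1)]]
      dim_directions_line_through[OF x(1)] by simp
qed

lemma poset_rank_parallel_layers: "poset_rank parallel.P (\<supseteq>) = dim V - 1"
proof (rule poset_rank_eqI)
  obtain x where "{x} \<in> P" using point_in_layer[OF V_layer] .
  then show "maximals parallel.P (\<supseteq>) \<noteq> {}" using line_through_maximal by blast
qed (rule elem_rank_maximal_parallel_layer)

lemma complement_of_line_is_hyperplane:
  assumes x: "{x} \<in> P" and "Z \<in> complements (below P (\<supseteq>) {x}) (\<supseteq>) (line_through x)"
  shows "Z \<in> A"
proof -
  have line: "line_through x \<in> P" using line_through_layer[OF x] parallel_layers_subset by blast
  have Z: "Z \<in> P" "x \<in> Z" using assms(2) by (auto simp: complements_def below_def)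
  have meet: "line_through x \<inter> Z = {x}"
    and disjoint: "localization (line_through x) \<inter> localization Z = {}"
    using assms(2) mem_complements_below_point_iff[OF x line mem_line_through Z] by auto
  have transverse: "K \<in> transverse_part A v" if "K \<in> localization Z" for K
  proof -
    have K: "K \<in> A" "x \<in> K" using that Z(2) by (auto simp: localization_def)
    have "\<not> line_through x \<subseteq> K" using that disjoint by (auto simp: localization_def)
    then show ?thesis using K line_through_eq_Inter[OF x] by auto
  qed
  have unique: "K = H" if "H \<in> localization Z" "K \<in> localization Z" for H K
  proof (rule ccontr)
    assume "K \<noteq> H"
    moreover have "H \<in> transverse_part A v" "K \<in> transverse_part A v"
      using transverse that by simp_all
    moreover have "x \<in> K \<inter> H" using that Z(2) by (auto simp: localization_def)
    ultimately obtain L where "L \<in> parallel_part A v" "K \<inter> H \<subseteq> L"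
      using modular unfolding modular_direction_def by (metis empty_iff)
    then have "L \<in> localization Z" using that by (auto simp: localization_def parallel_part_def)
    then show False using transverse \<open>L \<in> parallel_part A v\<close> by blast
  qed
  have "x + v \<in> line_through x" using mem_line_throughI[of x 1] by simp
  moreover have "x + v \<notin> {x}" using v(2) by simp
  ultimately have "x + v \<notin> Z" using meet by blast
  moreover have "x + v \<in> V" using v(1) layer_subset[OF x] V_closed by simp
  ultimately obtain H where H: "H \<in> localization Z"
    using mem_layer_iff[OF Z(1), of "x + v"] by blast
  then have "localization Z = {H}" using unique by blast
  then have "Z = V \<inter> H" using layer_eq_Inter_localization[OF Z(1)] by simp
  then show ?thesis using H hyperplane_subset by (auto simp: localization_def Int_absorb1)
qed

lemma modular_line_through:
  assumes x: "{x} \<in> P"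
  shows "modular_in (below P (\<supseteq>) {x}) (\<supseteq>) (line_through x)"
  unfolding modular_in_def
proof (intro conjI ballI impI)
  show "line_through x \<in> below P (\<supseteq>) {x}"
    using line_through_layer[OF x] parallel_layers_subset mem_line_through by (auto simp: below_def)
  fix Z W
  assume "Z \<in> complements (below P (\<supseteq>) {x}) (\<supseteq>) (line_through x)"
    and "W \<in> complements (below P (\<supseteq>) {x}) (\<supseteq>) (line_through x)" and "W \<subseteq> Z"
  then show "Z = W"
    using hyperplane_subset_imp_eq[of W Z] complement_of_line_is_hyperplane[OF x] by simp
qed

lemma order_ideal_parallel_layers: "order_ideal P (\<supseteq>) parallel.P"
  unfolding order_ideal_def
proof (intro conjI ballI impI)
  fix Y X assume "Y \<in> parallel.P" "X \<in> P" "Y \<subseteq> X"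
  then show "X \<in> parallel.P" using directions_mono[of Y X] by (auto simp: parallel_layer_iff)
qed (rule parallel_layers_subset)

lemma M_ideal_parallel_layers: "M_ideal P (\<supseteq>) parallel.P"
  unfolding M_ideal_def
proof (intro conjI ballI impI)
  show "order_ideal P (\<supseteq>) parallel.P" by (rule order_ideal_parallel_layers)
  show "pure parallel.P (\<supseteq>)" using elem_rank_maximal_parallel_layer unfolding pure_def by blast
  show "join_closed P (\<supseteq>) parallel.P"
    unfolding join_closed_def
  proof (intro allI impI)
    fix S assume S: "S \<subseteq> parallel.P"
    then have "S \<subseteq> P" using parallel_layers_subset by (rule subset_trans)
    then show "joins P (\<supseteq>) S \<subseteq> parallel.P" using joins_layers parallel.Inter_layer[OF S] by simp
  qed
next
  fix X H assume X: "X \<in> parallel.P" and H: "H \<in> atoms P (\<supseteq>)" "joins P (\<supseteq>) {H, X} = {}"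
  have "X \<in> P" "v \<in> directions X" "H \<in> A"
    using X H(1) by (auto simp: parallel_layer_iff atoms_layers)
  moreover have "X \<inter> H = {}"
    using H(2) joins_layers_pair[OF hyperplane_layer \<open>X \<in> P\<close>, of H] \<open>H \<in> A\<close>
    by (auto split: if_splits)
  ultimately show "H \<in> parallel.P"
    using directions_subset_if_disjoint hyperplane_layer parallel_layer_iff by blast
next
  fix X assume X: "X \<in> maximals P (\<supseteq>)"
  obtain x where x: "X = {x}" using maximal_layer_is_point[OF X] .
  then have "{x} \<in> P" using X by (simp add: maximals_def)
  then show "\<exists>Y\<in>maximals parallel.P (\<supseteq>). modular_in (below P (\<supseteq>) X) (\<supseteq>) Y"
    using line_through_maximal modular_line_through x by blast
qed

lemma lineality_parallel_part: "lineality V (parallel_part A v) = span {v}"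
proof -
  obtain x where x: "{x} \<in> P" using point_in_layer[OF V_layer] .
  show ?thesis
    using parallel.directions_maximal_layer[OF line_through_maximal[OF x]]
      directions_line_through[OF x] by simp
qed

end

context essential_arrangement
begin

lemma dim_V_pos: "v \<in> V \<Longrightarrow> v \<noteq> 0 \<Longrightarrow> 0 < dim V"
  using subspace_eq_zero_if_dim_eq_0[OF order_refl subspace_V] by auto

theorem supersolvable_iff_modular_direction:
  assumes "V \<noteq> {0}"
  shows "supersolvable P (\<supseteq>) \<longleftrightarrow>
    (\<exists>v\<in>V. v \<noteq> 0 \<and> modular_direction A v \<and> supersolvable (layers V (parallel_part A v)) (\<supseteq>))"
proof
  obtain m where m: "dim V = Suc m"
    using subspace_eq_zero_if_dim_eq_0[OF order_refl subspace_V] assms by (cases "dim V") auto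
  assume "supersolvable P (\<supseteq>)"
  then obtain Q where Q: "M_ideal P (\<supseteq>) Q" "supersolvable Q (\<supseteq>)" "poset_rank Q (\<supseteq>) = m"
    using supersolvable_M_ideal_exists[of P "(\<supseteq>)" m] poset_rank_layers m by metis
  have "Q \<noteq> {}" using Q(2) by (auto simp: supersolvable_def bottom_of_def)
  then interpret corank_one_M_ideal scale V A Q by unfold_locales (simp_all add: Q m)
  obtain v where "v \<in> V" "v \<noteq> 0" "modular_direction A v" "Q = layers V (parallel_part A v)"
    by (rule modular_direction_exists)
  then show "\<exists>v\<in>V. v \<noteq> 0 \<and> modular_direction A v \<and> supersolvable (layers V (parallel_part A v)) (\<supseteq>)"
    using Q(2) by blast
next
  assume "\<exists>v\<in>V. v \<noteq> 0 \<and> modular_direction A v \<and> supersolvable (layers V (parallel_part A v)) (\<supseteq>)"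
  then obtain v where v: "v \<in> V" "v \<noteq> 0" "modular_direction A v"
    and parallel: "supersolvable (layers V (parallel_part A v)) (\<supseteq>)" by blast
  interpret arrangement_with_modular_direction scale V A v by unfold_locales (use v in auto)
  show "supersolvable P (\<supseteq>)"
  proof (rule supersolvable_if_M_ideal[OF _ _ M_ideal_parallel_layers parallel])
    show "bottom_of P (\<supseteq>) V" by (simp add: bottom_of_layers_iff)
    show "poset_rank P (\<supseteq>) = Suc (poset_rank parallel.P (\<supseteq>))"
      using dim_V_pos[OF v(1,2)] by (simp add: poset_rank_layers poset_rank_parallel_layers)
  qed simp
qed

lemma supersolvable_if_dim_1:
  assumes "dim V = 1"
  shows "supersolvable P (\<supseteq>)"
proof -
  have dim_0: "dim {0} = 0" using dim_le_card[of "{0}" "{}"] by simp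
  have hyperplane_directions: "directions H = {0}" if H: "H \<in> A" for H
  proof -
    have "H \<subset> V" using hyperplane_subset[OF H] hyperplane_neq_V[OF H] by blast
    then have "dim (directions H) = 0"
      using dim_directions_strict_mono[OF hyperplane_layer[OF H] V_layer] assms
      by (simp add: directions_V)
    then show ?thesis
      using subspace_eq_zero_if_dim_eq_0 hyperplane_layer[OF H] directions_subset
        subspace_directions by blast
  qed
  have "V \<noteq> {0}" using assms dim_0 by auto
  then obtain v where v: "v \<in> V" "v \<noteq> 0" using V_closed(4) by blast
  have parallel: "parallel_part A v = {}"
    using hyperplane_directions v(2) by (auto simp: parallel_part_def)
  have "modular_direction A v"
    unfolding modular_direction_def
  proof (intro ballI impI)
    fix H K assume HK: "H \<in> transverse_part A v" "K \<in> transverse_part A v" "H \<noteq> K" "H \<inter> K \<noteq> {}"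
    then obtain x where "x \<in> H" "x \<in> K" by blast
    then have "H = {x}" "K = {x}"
      using HK(1,2) layer_eq_singleton hyperplane_layer hyperplane_directions by auto
    then show "\<exists>L\<in>parallel_part A v. H \<inter> K \<subseteq> L" using HK(3) by simp
  qed
  moreover have "layers V (parallel_part A v) = {V}"
    using V_closed(4) by (auto simp: parallel layers_def)
  then have "supersolvable (layers V (parallel_part A v)) (\<supseteq>)"
    by (simp add: supersolvable_singleton)
  ultimately show ?thesis
    unfolding supersolvable_iff_modular_direction[OF \<open>V \<noteq> {0}\<close>] using v by blast
qed

end

section \<open>Ends of a punctured Euclidean space\<close>

fun end_nbhd :: "real \<Rightarrow> 'a::euclidean_space option \<Rightarrow> 'a set" where
  "end_nbhd \<epsilon> None = - cball 0 (1 / \<epsilon>)"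
| "end_nbhd \<epsilon> (Some s) = ball s \<epsilon> - {s}"

definition ends :: "'a set \<Rightarrow> 'a option set" where
  "ends S = insert None (Some ` S)"

lemma finite_ends: "finite S \<Longrightarrow> finite (ends S)"
  and card_ends: "finite S \<Longrightarrow> card (ends S) = Suc (card S)"
  by (simp_all add: ends_def card_image)

lemma open_end_nbhd: "open (end_nbhd \<epsilon> j)"
  by (cases j) (auto intro: open_Diff)

lemma connected_end_nbhd: "2 \<le> DIM('a) \<Longrightarrow> connected (end_nbhd \<epsilon> (j :: 'a::euclidean_space option))"
  by (cases j) (auto intro: connected_complement_bounded_convex connected_punctured_ball)

lemma end_nbhd_mono: "0 < \<delta> \<Longrightarrow> \<delta> \<le> \<epsilon> \<Longrightarrow> end_nbhd \<delta> j \<subseteq> end_nbhd \<epsilon> j"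
proof (cases j)
  case None
  assume "0 < \<delta>" "\<delta> \<le> \<epsilon>"
  then have "1 / \<epsilon> \<le> 1 / \<delta>" by (simp add: frac_le)
  then show ?thesis using None by auto
qed auto

lemma end_nbhd_nonempty:
  assumes "0 < \<epsilon>"
  shows "end_nbhd \<epsilon> j \<noteq> {}"
proof (cases j)
  case None
  have "\<not> bounded (UNIV :: 'a set)" by simp
  then have "\<not> (UNIV :: 'a set) \<subseteq> cball 0 (1 / \<epsilon>)" using bounded_cball bounded_subset by blast
  then show ?thesis using None by auto
next
  case (Some s)
  have "ball s \<epsilon> \<noteq> {s}" using assms not_open_singleton open_ball by metis
  then show ?thesis using Some assms by auto
qed

lemma eventually_end_nbhd_disjoint_compact:
  assumes K: "compact K" and j: "\<And>t. j = Some t \<Longrightarrow> t \<notin> K"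
  shows "\<forall>\<^sub>F \<epsilon> in at_right 0. end_nbhd \<epsilon> j \<inter> K = {}"
proof (cases j)
  case None
  obtain B where B: "B > 0" "\<And>x. x \<in> K \<Longrightarrow> norm x \<le> B"
    using compact_imp_bounded[OF K] by (auto simp: bounded_pos)
  have "end_nbhd \<epsilon> j \<inter> K = {}" if "0 < \<epsilon>" "\<epsilon> < 1 / B" for \<epsilon>
  proof -
    have "B < 1 / \<epsilon>" using that B by (simp add: field_simps)
    then show ?thesis using B None by force
  qed
  then show ?thesis using B by (auto simp: eventually_at_right_field intro!: exI[of _ "1 / B"])
next
  case (Some t)
  have "open (- K)" "t \<in> - K" using K j Some compact_imp_closed by auto
  then obtain e where e: "e > 0" "ball t e \<subseteq> - K" using open_contains_ball by blast
  have "end_nbhd \<epsilon> j \<inter> K = {}" if "0 < \<epsilon>" "\<epsilon> < e" for \<epsilon>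
    using e(2) Some subset_ball[of \<epsilon> e t] that by auto
  then show ?thesis using e by (auto simp: eventually_at_right_field intro!: exI[of _ e])
qed

lemma eventually_ends_disjoint_compact:
  assumes "finite S" "compact K" "K \<inter> S = {}"
  shows "\<forall>\<^sub>F \<epsilon> in at_right 0. \<forall>j\<in>ends S. end_nbhd \<epsilon> j \<inter> (S \<union> K) = {}"
proof (intro eventually_ball_finite finite_ends assms(1) ballI)
  fix j assume "j \<in> ends S"
  have "compact ((S - {t. j = Some t}) \<union> K)"
    using assms(1,2) by (simp add: compact_Un finite_imp_compact)
  then have "\<forall>\<^sub>F \<epsilon> in at_right 0. end_nbhd \<epsilon> j \<inter> ((S - {t. j = Some t}) \<union> K) = {}"
    using \<open>j \<in> ends S\<close> assms(3)
    by (intro eventually_end_nbhd_disjoint_compact) (auto simp: ends_def)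
  then show "\<forall>\<^sub>F \<epsilon> in at_right 0. end_nbhd \<epsilon> j \<inter> (S \<union> K) = {}"
    by eventually_elim (cases j, auto)
qed

lemma eventually_end_nbhd_disjoint:
  assumes "i \<noteq> j"
  shows "\<forall>\<^sub>F \<epsilon> in at_right 0. end_nbhd \<epsilon> i \<inter> end_nbhd \<epsilon> j = {}"
proof -
  have None_Some: "\<forall>\<^sub>F \<epsilon> in at_right 0. end_nbhd \<epsilon> None \<inter> end_nbhd \<epsilon> (Some t) = {}" for t :: 'a
  proof -
    have "\<forall>\<^sub>F \<epsilon> in at_right 0. end_nbhd \<epsilon> None \<inter> cball t 1 = {}"
      by (rule eventually_end_nbhd_disjoint_compact) auto
    moreover have "\<forall>\<^sub>F \<epsilon> in at_right (0::real). \<epsilon> < 1"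
      by (auto simp: eventually_at_right_field intro!: exI[of _ 1])
    ultimately show ?thesis by eventually_elim auto
  qed
  have Some_Some: "\<forall>\<^sub>F \<epsilon> in at_right 0. end_nbhd \<epsilon> (Some s) \<inter> end_nbhd \<epsilon> (Some t) = {}"
    if "s \<noteq> t" for s t :: 'a
  proof -
    have "\<forall>\<^sub>F \<epsilon> in at_right 0. \<epsilon> < dist s t / 2"
      using that by (auto simp: eventually_at_right_field intro!: exI[of _ "dist s t / 2"])
    then show ?thesis
    proof eventually_elim
      case (elim \<epsilon>)
      then have "ball s \<epsilon> \<inter> ball t \<epsilon> = {}" by (intro disjoint_ballI) simp
      then show ?case by auto
    qed
  qed
  show ?thesis
  proof (cases i; cases j)
    fix t assume "i = Some t" "j = None"
    then show ?thesis using None_Some[of t] by (simp add: Int_commute)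
  qed (use assms None_Some Some_Some in auto)
qed

lemma eventually_ends_disjoint:
  assumes "finite S"
  shows "\<forall>\<^sub>F \<epsilon> in at_right 0. \<forall>i\<in>ends S. \<forall>j\<in>ends S. i \<noteq> j \<longrightarrow> end_nbhd \<epsilon> i \<inter> end_nbhd \<epsilon> j = {}"
proof (intro eventually_ball_finite finite_ends[OF assms] ballI)
  fix i j :: "'a option"
  show "\<forall>\<^sub>F \<epsilon> in at_right 0. i \<noteq> j \<longrightarrow> end_nbhd \<epsilon> i \<inter> end_nbhd \<epsilon> j = {}"
    using eventually_end_nbhd_disjoint by (cases "i = j") auto
qed

lemma compact_complement_ends:
  assumes "finite S" "0 < \<epsilon>"
  shows "compact (- S - (\<Union>j\<in>ends S. end_nbhd \<epsilon> j))"
proof -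
  have "- S - (\<Union>j\<in>ends S. end_nbhd \<epsilon> j) = cball 0 (1 / \<epsilon>) - (\<Union>s\<in>S. ball s \<epsilon>)"
    using assms(2) by (auto simp: ends_def)
  moreover have "compact (cball 0 (1 / \<epsilon>) - (\<Union>s\<in>S. ball s \<epsilon>))" by (intro compact_diff) auto
  ultimately show ?thesis by simp
qed

definition inside_compact :: "'a::topological_space set \<Rightarrow> 'a set \<Rightarrow> bool" where
  "inside_compact X U \<longleftrightarrow> (\<exists>C. compact C \<and> U \<subseteq> C \<and> C \<subseteq> X)"

lemma inside_compact_homeomorphic_image:
  assumes hom: "homeomorphism X Y h k" and "U \<subseteq> X" and "inside_compact Y (h ` U)"
  shows "inside_compact X U"
proof -
  obtain C where C: "compact C" "h ` U \<subseteq> C" "C \<subseteq> Y"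
    using assms(3) by (auto simp: inside_compact_def)
  have "compact (k ` C)"
    using C(1,3) homeomorphism_cont2[OF hom]
    by (meson continuous_on_subset compact_continuous_image)
  moreover have "U \<subseteq> k ` C"
  proof
    fix x assume "x \<in> U"
    then have "x = k (h x)" "h x \<in> C"
      using C(2) assms(2) homeomorphism_apply1[OF hom, of x] by auto
    then show "x \<in> k ` C" by (rule image_eqI)
  qed
  moreover have "k ` C \<subseteq> X" using C(3) homeomorphism_image2[OF hom] by blast
  ultimately show ?thesis unfolding inside_compact_def by blast
qed

lemma end_nbhd_not_inside_compact:
  assumes "i \<in> ends S" "0 < \<epsilon>"
  shows "\<not> inside_compact (- S) (end_nbhd \<epsilon> i)"
proof
  assume "inside_compact (- S) (end_nbhd \<epsilon> i)"
  then obtain C where C: "compact C" "end_nbhd \<epsilon> i \<subseteq> C" "C \<subseteq> - S" by (auto simp: inside_compact_def)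
  have "\<forall>\<^sub>F \<delta> in at_right 0. end_nbhd \<delta> i \<inter> C = {}"
    using C(1,3) assms(1) by (intro eventually_end_nbhd_disjoint_compact) (auto simp: ends_def)
  moreover have "\<forall>\<^sub>F \<delta> in at_right 0. 0 < \<delta> \<and> \<delta> < \<epsilon>"
    using assms(2) by (auto simp: eventually_at_right_field)
  then have "\<forall>\<^sub>F \<delta> in at_right 0. end_nbhd \<delta> i \<noteq> {} \<and> end_nbhd \<delta> i \<subseteq> C"
    by eventually_elim (use end_nbhd_nonempty end_nbhd_mono C(2) less_imp_le in blast)
  ultimately have "\<forall>\<^sub>F \<delta> in at_right (0::real). False" by eventually_elim blast
  then show False by simp
qed

lemma exists_disjoint_end_nbhds:
  assumes "finite S"
  obtains \<epsilon> where "0 < \<epsilon>" "\<And>i. i \<in> ends S \<Longrightarrow> end_nbhd \<epsilon> i \<inter> S = {}"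
    "\<And>i j. i \<in> ends S \<Longrightarrow> j \<in> ends S \<Longrightarrow> i \<noteq> j \<Longrightarrow> end_nbhd \<epsilon> i \<inter> end_nbhd \<epsilon> j = {}"
proof -
  have "\<forall>\<^sub>F \<epsilon> in at_right (0::real). 0 < \<epsilon>" by (rule eventually_at_right_less)
  moreover have "\<forall>\<^sub>F \<epsilon> in at_right 0. \<forall>i\<in>ends S. end_nbhd \<epsilon> i \<inter> (S \<union> {}) = {}"
    by (rule eventually_ends_disjoint_compact[OF assms]) auto
  ultimately have "\<forall>\<^sub>F \<epsilon> in at_right 0. 0 < \<epsilon> \<and> (\<forall>i\<in>ends S. end_nbhd \<epsilon> i \<inter> S = {}) \<and>
      (\<forall>i\<in>ends S. \<forall>j\<in>ends S. i \<noteq> j \<longrightarrow> end_nbhd \<epsilon> i \<inter> end_nbhd \<epsilon> j = {})"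
    using eventually_ends_disjoint[OF assms] by eventually_elim simp
  from eventually_happens'[OF trivial_limit_at_right_real this] show thesis using that by blast
qed

text \<open>Removing the compact set \<open>K\<close> from \<open>X\<close> separates at least \<open>card \<U>\<close> ends of \<open>X\<close>. For a
  punctured space the maximal such number is one more than the number of punctures.\<close>

definition separates_ends :: "'a::topological_space set \<Rightarrow> 'a set \<Rightarrow> 'a set set \<Rightarrow> bool" where
  "separates_ends X K \<U> \<longleftrightarrow> compact K \<and> K \<subseteq> X \<and> X - K \<subseteq> \<Union>\<U> \<and> disjoint \<U> \<and>
     (\<forall>U\<in>\<U>. openin (top_of_set X) U \<and> \<not> inside_compact X U)"

lemma separates_ends_subset: "separates_ends X K \<U> \<Longrightarrow> U \<in> \<U> \<Longrightarrow> U \<subseteq> X"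
  unfolding separates_ends_def by (meson openin_imp_subset)

lemma separates_ends_homeomorphic_image:
  assumes hom: "homeomorphism X Y h k" and ends: "separates_ends X K \<U>"
  shows "separates_ends Y (h ` K) ((`) h ` \<U>)"
  unfolding separates_ends_def
proof (intro conjI ballI)
  have K: "compact K" "K \<subseteq> X" and cover: "X - K \<subseteq> \<Union>\<U>" and disjoint: "disjoint \<U>"
    and \<U>: "\<And>U. U \<in> \<U> \<Longrightarrow> openin (top_of_set X) U" "\<And>U. U \<in> \<U> \<Longrightarrow> \<not> inside_compact X U"
    using ends by (auto simp: separates_ends_def)
  note \<U>_subset = separates_ends_subset[OF ends]
  have h: "h ` X = Y" and k: "k ` Y = X" "\<And>y. y \<in> Y \<Longrightarrow> h (k y) = y" and inj: "inj_on h X"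
    using hom by (auto simp: homeomorphism_def intro: inj_on_inverseI)
  show "compact (h ` K)"
    using K homeomorphism_cont1[OF hom] by (meson continuous_on_subset compact_continuous_image)
  show "h ` K \<subseteq> Y" using K(2) h by blast
  show "Y - h ` K \<subseteq> \<Union>((`) h ` \<U>)"
  proof
    fix y assume y: "y \<in> Y - h ` K"
    then have "k y \<in> X - K" using k by (metis Diff_iff image_eqI)
    then obtain U where "U \<in> \<U>" "k y \<in> U" using cover by blast
    then show "y \<in> \<Union>((`) h ` \<U>)" using y k(2)[of y] by force
  qed
  show "disjoint ((`) h ` \<U>)"
  proof (rule pairwise_imageI)
    fix U W assume "U \<in> \<U>" "W \<in> \<U>" "U \<noteq> W"
    then have "U \<inter> W = {}" "U \<subseteq> X" "W \<subseteq> X"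
      using disjoint \<U>_subset by (auto simp: pairwise_def disjnt_def)
    then show "disjnt (h ` U) (h ` W)"
      using inj_on_image_Int[OF inj, of U W] by (simp add: disjnt_def)
  qed
  fix V assume "V \<in> (`) h ` \<U>"
  then obtain U where U: "U \<in> \<U>" "V = h ` U" by blast
  show "openin (top_of_set Y) V" using homeomorphism_imp_open_map[OF hom \<U>(1)[OF U(1)]] U(2) by simp
  show "\<not> inside_compact Y V"
    using inside_compact_homeomorphic_image[OF hom \<U>_subset[OF U(1)]] \<U>(2)[OF U(1)] U(2) by blast
qed

lemma card_homeomorphic_image_family:
  assumes "homeomorphism X Y h k" "separates_ends X K \<U>"
  shows "card ((`) h ` \<U>) = card \<U>"
proof (rule card_image)
  have "inj_on h X" using assms(1) by (auto simp: homeomorphism_def intro: inj_on_inverseI)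
  then have "inj_on ((`) h) (Pow X)" by (rule inj_on_image_Pow)
  moreover have "\<U> \<subseteq> Pow X" using separates_ends_subset[OF assms(2)] by blast
  ultimately show "inj_on ((`) h) \<U>" by (rule inj_on_subset)
qed

lemma punctured_space_separates_ends:
  fixes S :: "'a::euclidean_space set"
  assumes S: "finite S"
  shows "\<exists>K \<U>. separates_ends (- S) K \<U> \<and> card \<U> = Suc (card S)"
proof -
  obtain \<epsilon> where \<epsilon>: "0 < \<epsilon>" and avoids: "\<And>i. i \<in> ends S \<Longrightarrow> end_nbhd \<epsilon> i \<inter> S = {}"
    and disjoint: "\<And>i j. i \<in> ends S \<Longrightarrow> j \<in> ends S \<Longrightarrow> i \<noteq> j \<Longrightarrow> end_nbhd \<epsilon> i \<inter> end_nbhd \<epsilon> j = {}"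
    using exists_disjoint_end_nbhds[OF S] by blast
  define \<U> where "\<U> = end_nbhd \<epsilon> ` ends S"
  have "inj_on (end_nbhd \<epsilon>) (ends S)"
    using disjoint end_nbhd_nonempty[OF \<epsilon>] by (metis inf.idem inj_onI)
  then have "card \<U> = Suc (card S)" by (simp add: \<U>_def card_image card_ends[OF S])
  moreover have "separates_ends (- S) (- S - \<Union>\<U>) \<U>"
    unfolding separates_ends_def
  proof (intro conjI ballI)
    show "compact (- S - \<Union>\<U>)" using compact_complement_ends[OF S \<epsilon>] by (simp add: \<U>_def)
    show "disjoint \<U>"
      unfolding \<U>_def using disjoint by (auto intro!: pairwise_imageI simp: disjnt_def)
    fix U assume "U \<in> \<U>"
    then obtain i where i: "i \<in> ends S" "U = end_nbhd \<epsilon> i" by (auto simp: \<U>_def)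
    show "openin (top_of_set (- S)) U"
      using avoids[OF i(1)] open_end_nbhd i(2) by (intro open_subset) auto
    show "\<not> inside_compact (- S) U" using end_nbhd_not_inside_compact[OF i(1) \<epsilon>] i(2) by simp
  qed auto
  ultimately show ?thesis by blast
qed

lemma connected_subset_member_of_disjoint_open_cover:
  assumes "connected C" "\<And>U. U \<in> \<U> \<Longrightarrow> open U" "C \<subseteq> \<Union>\<U>" "disjoint \<U>" "U \<in> \<U>" "C \<inter> U \<noteq> {}"
  shows "C \<subseteq> U"
proof -
  let ?W = "\<Union>(\<U> - {U})"
  have "open ?W" "open U" using assms(2,5) by auto
  moreover have "U \<inter> ?W \<inter> C = {}" using assms(4,5) by (auto simp: pairwise_def disjnt_def)
  moreover have "C \<subseteq> U \<union> ?W" using assms(3) by blast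
  ultimately have "?W \<inter> C = {}" using connectedD[OF assms(1), of U ?W] assms(6) by blast
  then show ?thesis using \<open>C \<subseteq> U \<union> ?W\<close> by blast
qed

lemma card_separates_ends_le:
  fixes T :: "'a::euclidean_space set"
  assumes dim: "2 \<le> DIM('a)" and T: "finite T" and ends: "separates_ends (- T) K \<U>"
  shows "card \<U> \<le> Suc (card T)"
proof -
  have K: "compact K" "K \<inter> T = {}" and cover: "- T - K \<subseteq> \<Union>\<U>" and disjoint: "disjoint \<U>"
    and open_\<U>: "\<And>U. U \<in> \<U> \<Longrightarrow> openin (top_of_set (- T)) U"
    and not_inside_compact: "\<And>U. U \<in> \<U> \<Longrightarrow> \<not> inside_compact (- T) U"
    using ends by (auto simp: separates_ends_def)
  have "open (- T)" using T by (simp add: finite_imp_closed open_Compl)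
  then have \<U>: "open U" "U \<subseteq> - T" if "U \<in> \<U>" for U
    using open_\<U>[OF that] by (auto simp: openin_open_eq)
  obtain \<delta> :: real where \<delta>: "0 < \<delta>" and avoids: "\<And>j. j \<in> ends T \<Longrightarrow> end_nbhd \<delta> j \<inter> (T \<union> K) = {}"
    using eventually_happens'[OF trivial_limit_at_right_real eventually_conj[OF
          eventually_at_right_less eventually_ends_disjoint_compact[OF T K]]] by blast
  have "\<exists>j\<in>ends T. end_nbhd \<delta> j \<inter> U \<noteq> {}" if U: "U \<in> \<U>" for U
  proof (rule ccontr)
    assume "\<not> ?thesis"
    then have "U \<subseteq> - T - (\<Union>j\<in>ends T. end_nbhd \<delta> j)" using \<U>(2)[OF U] by blast
    then have "inside_compact (- T) U"
      using compact_complement_ends[OF T \<delta>] unfolding inside_compact_def by blast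
    then show False using not_inside_compact[OF U] by simp
  qed
  then obtain \<sigma> where \<sigma>: "\<And>U. U \<in> \<U> \<Longrightarrow> \<sigma> U \<in> ends T \<and> end_nbhd \<delta> (\<sigma> U) \<inter> U \<noteq> {}" by metis
  have end_subset: "end_nbhd \<delta> (\<sigma> U) \<subseteq> U" if U: "U \<in> \<U>" for U
  proof (rule connected_subset_member_of_disjoint_open_cover[OF
        connected_end_nbhd[OF dim] \<U>(1) _ disjoint U])
    show "end_nbhd \<delta> (\<sigma> U) \<subseteq> \<Union>\<U>" using avoids[of "\<sigma> U"] \<sigma>[OF U] cover by blast
  qed (use \<sigma>[OF U] in blast)+
  have "inj_on \<sigma> \<U>"
  proof (rule inj_onI, rule ccontr)
    fix U W assume UW: "U \<in> \<U>" "W \<in> \<U>" "\<sigma> U = \<sigma> W" "U \<noteq> W"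
    then have "end_nbhd \<delta> (\<sigma> U) \<subseteq> U \<inter> W" using end_subset[of U] end_subset[of W] by auto
    moreover have "U \<inter> W = {}" using disjoint UW by (auto simp: pairwise_def disjnt_def)
    ultimately show False using end_nbhd_nonempty[OF \<delta>] by auto
  qed
  then have "card \<U> \<le> card (ends T)" by (rule card_inj_on_le) (use \<sigma> finite_ends[OF T] in auto)
  then show ?thesis by (simp add: card_ends[OF T])
qed

lemma card_punctures_eq:
  fixes S T :: "'a::euclidean_space set"
  assumes "2 \<le> DIM('a)" "finite S" "finite T" "(- S) homeomorphic (- T)"
  shows "card S = card T"
proof -
  have le: "card S \<le> card T"
    if finite: "finite S" "finite T" and hom: "homeomorphism (- S) (- T) h k"
    for S T :: "'a set" and h k
  proof -
    obtain K \<U> where \<U>: "separates_ends (- S) K \<U>" "card \<U> = Suc (card S)"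
      using punctured_space_separates_ends[OF finite(1)] by blast
    show ?thesis
      using card_separates_ends_le[OF assms(1) finite(2)
          separates_ends_homeomorphic_image[OF hom \<U>(1)]]
        card_homeomorphic_image_family[OF hom \<U>(1)] \<U>(2) by simp
  qed
  obtain h k where "homeomorphism (- S) (- T) h k" using assms(4) by (auto simp: homeomorphic_def)
  then show ?thesis
    using le[OF assms(2,3)] le[OF assms(3,2) homeomorphism_symD] by (metis le_antisym)
qed

section \<open>Complements of graphs as fiber bundles\<close>

lemma
  fixes d :: "'a::banach \<Rightarrow> 'a"
  assumes d: "c-lipschitz_on UNIV d" and "c < 1"
  shows contraction_perturbation_expanding: "(1 - c) * dist y y' \<le> dist (y + d y) (y' + d y')"
    and contraction_perturbation_bij: "bij (\<lambda>y. y + d y)"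
proof -
  have c: "0 \<le> c" and lip: "dist (d y) (d y') \<le> c * dist y y'" for y y'
    using d by (auto simp: lipschitz_on_def)
  have expanding: "(1 - c) * dist y y' \<le> dist (y + d y) (y' + d y')" for y y'
  proof -
    have "y - y' = (y + d y - (y' + d y')) - (d y - d y')" by simp
    then have "dist y y' \<le> dist (y + d y) (y' + d y') + dist (d y) (d y')"
      unfolding dist_norm by (metis norm_triangle_ineq4)
    then show ?thesis using lip[of y y'] by (simp add: algebra_simps)
  qed
  show "(1 - c) * dist y y' \<le> dist (y + d y) (y' + d y')" by (rule expanding)
  have "inj (\<lambda>y. y + d y)"
  proof (rule injI)
    fix y y' assume "y + d y = y' + d y'"
    then have "(1 - c) * dist y y' \<le> 0" using expanding[of y y'] by simp
    then show "y = y'" using \<open>c < 1\<close> by (simp add: mult_le_0_iff)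
  qed
  moreover have "\<exists>y. y + d y = z" for z
  proof -
    have "dist (z - d y) (z - d y') \<le> c * dist y y'" for y y'
      using lip[of y' y] by (simp add: dist_norm norm_minus_commute)
    then obtain y where "z - d y = y" using banach_fix_type[OF c \<open>c < 1\<close>, of "\<lambda>y. z - d y"] by auto
    then show ?thesis by (intro exI[of _ y]) (simp add: algebra_simps)
  qed
  ultimately show "bij (\<lambda>y. y + d y)" unfolding bij_def surj_def by metis
qed

lemma continuous_on_parametrized_inverse:
  fixes f :: "'b::topological_space \<Rightarrow> 'a::metric_space \<Rightarrow> 'c::metric_space"
  assumes cont: "continuous_on (U \<times> UNIV) (\<lambda>(b, y). f b y)" and "0 < c"
    and expanding: "\<And>b y y'. b \<in> U \<Longrightarrow> c * dist y y' \<le> dist (f b y) (f b y')"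
    and surj: "\<And>b. b \<in> U \<Longrightarrow> surj (f b)"
  shows "continuous_on (U \<times> UNIV) (\<lambda>(b, z). inv (f b) z)"
  unfolding continuous_on_def
proof
  fix p :: "'b \<times> 'c" assume p: "p \<in> U \<times> UNIV"
  obtain b1 z1 where p_eq: "p = (b1, z1)" and b1: "b1 \<in> U" using p by auto
  define y1 where "y1 = inv (f b1) z1"
  have z1: "f b1 y1 = z1" unfolding y1_def by (rule surj_f_inv_f[OF surj[OF b1]])
  let ?F = "at p within U \<times> UNIV"
  have "continuous_on (U \<times> UNIV) (\<lambda>q. (\<lambda>(b, y). f b y) (fst q, y1))"
    by (rule continuous_on_compose2[OF cont]) (auto intro!: continuous_intros)
  then have "continuous_on (U \<times> UNIV) (\<lambda>q. dist (snd q) (f (fst q) y1) / c)"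
    using \<open>0 < c\<close> by (auto intro!: continuous_intros)
  then have "((\<lambda>q. dist (snd q) (f (fst q) y1) / c) \<longlongrightarrow> dist (snd p) (f (fst p) y1) / c) ?F"
    using p unfolding continuous_on_def by blast
  then have lim: "((\<lambda>q. dist (snd q) (f (fst q) y1) / c) \<longlongrightarrow> 0) ?F" using z1 p_eq by simp
  have bound: "dist (inv (f b) z) y1 \<le> dist z (f b y1) / c" if "b \<in> U" for b z
    using expanding[OF that, of "inv (f b) z" y1] \<open>0 < c\<close>
    by (simp add: surj_f_inv_f[OF surj[OF that]] field_simps)
  have "\<forall>\<^sub>F q in ?F. dist (case q of (b, z) \<Rightarrow> inv (f b) z) y1
      \<le> dist (dist (snd q) (f (fst q) y1) / c) 0"
    unfolding eventually_at_filter using bound \<open>0 < c\<close> by (intro always_eventually) auto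
  from metric_tendsto_imp_tendsto[OF lim this]
  show "((\<lambda>(b, z). inv (f b) z) \<longlongrightarrow> (case p of (b, z) \<Rightarrow> inv (f b) z)) ?F"
    by (simp add: p_eq y1_def)
qed

definition bump_displacement ::
  "'i set \<Rightarrow> real \<Rightarrow> ('i \<Rightarrow> 'a::real_normed_vector) \<Rightarrow> ('i \<Rightarrow> 'a) \<Rightarrow> 'a \<Rightarrow> 'a" where
  "bump_displacement I r p w y = (\<Sum>i\<in>I. max 0 (1 - dist y (p i) / r) *\<^sub>R w i)"

lemma lipschitz_on_bump_displacement:
  assumes "0 < r"
  shows "((\<Sum>i\<in>I. norm (w i)) / r)-lipschitz_on UNIV (bump_displacement I r p w)"
proof (rule lipschitz_onI)
  let ?bump = "\<lambda>i y. max 0 (1 - dist y (p i) / r)"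
  have bump: "\<bar>?bump i y - ?bump i y'\<bar> \<le> dist y y' / r" for i y y'
  proof -
    have "\<bar>dist y (p i) - dist y' (p i)\<bar> \<le> dist y y'"
      using abs_dist_diff_le[of y "p i" y'] by (simp add: dist_commute)
    then have "\<bar>dist y (p i) / r - dist y' (p i) / r\<bar> \<le> dist y y' / r"
      using assms by (simp add: diff_divide_distrib[symmetric] divide_right_mono)
    then show ?thesis by linarith
  qed
  fix y y'
  have "dist (bump_displacement I r p w y) (bump_displacement I r p w y')
      = norm (\<Sum>i\<in>I. (?bump i y - ?bump i y') *\<^sub>R w i)"
    by (simp add: bump_displacement_def dist_norm scaleR_left_diff_distrib sum_subtractf)
  also have "\<dots> \<le> (\<Sum>i\<in>I. \<bar>?bump i y - ?bump i y'\<bar> * norm (w i))"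
    by (rule order_trans[OF norm_sum]) simp
  also have "\<dots> \<le> (\<Sum>i\<in>I. dist y y' / r * norm (w i))" by (intro sum_mono mult_right_mono bump) simp
  also have "\<dots> = (\<Sum>i\<in>I. norm (w i)) / r * dist y y'"
    by (simp add: sum_distrib_left sum_divide_distrib mult.commute)
  finally show "dist (bump_displacement I r p w y) (bump_displacement I r p w y')
      \<le> (\<Sum>i\<in>I. norm (w i)) / r * dist y y'" .
qed (use assms in \<open>simp add: sum_nonneg\<close>)

lemma bump_displacement_center:
  assumes "finite I" "i \<in> I" "0 < r" "\<And>j. j \<in> I \<Longrightarrow> j \<noteq> i \<Longrightarrow> r \<le> dist (p i) (p j)"
  shows "bump_displacement I r p w (p i) = w i"
proof -
  have "max 0 (1 - dist (p i) (p j) / r) *\<^sub>R w j = (if j = i then w i else 0)" if "j \<in> I" for j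
    using assms(3) assms(4)[OF that] by auto
  then have "bump_displacement I r p w (p i) = (\<Sum>j\<in>I. if j = i then w i else 0)"
    unfolding bump_displacement_def by (rule sum.cong[OF refl])
  then show ?thesis using assms(1,2) by simp
qed

lemma finite_points_separated:
  fixes p :: "'i \<Rightarrow> 'a::metric_space"
  assumes "finite I" "inj_on p I"
  obtains r where "0 < r" "\<And>i j. i \<in> I \<Longrightarrow> j \<in> I \<Longrightarrow> i \<noteq> j \<Longrightarrow> r \<le> dist (p i) (p j)"
proof -
  have "\<forall>\<^sub>F r in at_right 0. i \<noteq> j \<longrightarrow> r \<le> dist (p i) (p j)" if "i \<in> I" "j \<in> I" for i j
    using that assms(2)
    by (auto simp: eventually_at_right_field inj_on_def intro!: exI[of _ "dist (p i) (p j)"])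
  then have "\<forall>\<^sub>F r in at_right 0. \<forall>i\<in>I. \<forall>j\<in>I. i \<noteq> j \<longrightarrow> r \<le> dist (p i) (p j)"
    by (intro eventually_ball_finite assms(1) ballI)
  then have "\<forall>\<^sub>F r in at_right 0. 0 < r \<and> (\<forall>i\<in>I. \<forall>j\<in>I. i \<noteq> j \<longrightarrow> r \<le> dist (p i) (p j))"
    by (intro eventually_conj eventually_at_right_less)
  from eventually_happens'[OF trivial_limit_at_right_real this] show thesis using that by blast
qed

text \<open>The points \<open>g i b0\<close> are pushed to \<open>g i b\<close> by bump functions; for \<open>b\<close> close to \<open>b0\<close> the
  displacement is a contraction.\<close>

lemma local_straightening:
  fixes X :: "'b::topological_space set" and g :: "'i \<Rightarrow> 'b \<Rightarrow> 'a::banach"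
  assumes I: "finite I" and cont: "\<And>i. i \<in> I \<Longrightarrow> continuous_on X (g i)" and b0: "b0 \<in> X"
    and inj: "inj_on (\<lambda>i. g i b0) I"
  obtains U \<Phi> where "openin (top_of_set X) U" "b0 \<in> U"
    "continuous_on (U \<times> UNIV) (\<lambda>(b, y). \<Phi> b y)" "continuous_on (U \<times> UNIV) (\<lambda>(b, z). inv (\<Phi> b) z)"
    "\<And>b. b \<in> U \<Longrightarrow> bij (\<Phi> b)" "\<And>b i. b \<in> U \<Longrightarrow> i \<in> I \<Longrightarrow> \<Phi> b (g i b0) = g i b"
proof -
  obtain r where r: "0 < r" "\<And>i j. i \<in> I \<Longrightarrow> j \<in> I \<Longrightarrow> i \<noteq> j \<Longrightarrow> r \<le> dist (g i b0) (g j b0)"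
    using finite_points_separated[OF I inj] by blast
  define w where "w b i = g i b - g i b0" for b i
  define U where "U = X \<inter> (\<lambda>b. \<Sum>i\<in>I. norm (w b i)) -` {..<r / 2}"
  define d where "d b = bump_displacement I r (\<lambda>i. g i b0) (w b)" for b
  define \<Phi> where "\<Phi> b y = y + d b y" for b y
  have lipschitz: "(1 / 2)-lipschitz_on UNIV (d b)" if "b \<in> U" for b
  proof -
    have "(\<Sum>i\<in>I. norm (w b i)) / r \<le> 1 / 2" using that r(1) by (simp add: U_def field_simps)
    then show ?thesis
      unfolding d_def by (intro lipschitz_on_le[OF lipschitz_on_bump_displacement[OF r(1)]])
  qed
  have bij: "bij (\<Phi> b)" if "b \<in> U" for b
    unfolding \<Phi>_def using contraction_perturbation_bij[OF lipschitz[OF that]] by simp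
  have "continuous_on X (\<lambda>b. \<Sum>i\<in>I. norm (w b i))"
    unfolding w_def by (intro continuous_intros cont)
  then have "openin (top_of_set X) U"
    unfolding U_def by (rule continuous_openin_preimage_gen) simp
  moreover have "b0 \<in> U" using b0 r(1) by (simp add: U_def w_def)
  moreover have cont_\<Phi>: "continuous_on (U \<times> UNIV) (\<lambda>(b, y). \<Phi> b y)"
  proof -
    have "continuous_on (U \<times> UNIV) (\<lambda>p. g i (fst p))" if "i \<in> I" for i
      by (rule continuous_on_compose2[OF cont[OF that]]) (auto intro: continuous_intros simp: U_def)
    then show ?thesis
      unfolding \<Phi>_def d_def bump_displacement_def w_def case_prod_beta using r(1)
      by (intro continuous_intros) auto
  qed
  moreover have "continuous_on (U \<times> UNIV) (\<lambda>(b, z). inv (\<Phi> b) z)"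
  proof (rule continuous_on_parametrized_inverse[OF cont_\<Phi>, of "1 / 2"])
    show "1 / 2 * dist y y' \<le> dist (\<Phi> b y) (\<Phi> b y')" if "b \<in> U" for b y y'
      using contraction_perturbation_expanding[OF lipschitz[OF that]] by (simp add: \<Phi>_def)
  qed (simp_all add: bij bij_is_surj)
  moreover have "\<Phi> b (g i b0) = g i b" if "b \<in> U" "i \<in> I" for b i
    using bump_displacement_center[OF I that(2) r(1), of "\<lambda>i. g i b0" "w b"] r(2)[OF that(2)]
    by (auto simp: \<Phi>_def d_def w_def)
  ultimately show thesis using that bij by blast
qed

lemma homeomorphism_moving_finite:
  fixes p q :: "'i \<Rightarrow> 'a::euclidean_space"
  assumes "2 \<le> DIM('a)" "finite I" "inj_on p I" "inj_on q I"
  obtains f f' where "homeomorphism UNIV UNIV f f'" "\<And>i. i \<in> I \<Longrightarrow> f (p i) = q i"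
proof -
  have pairwise: "pairwise (\<lambda>i j. p i \<noteq> p j \<and> q i \<noteq> q j) I"
    using assms(3,4) by (auto simp: pairwise_def inj_on_def)
  show thesis
  proof (rule homeomorphism_moving_points_exists[of UNIV UNIV I p q])
    fix f f' assume "homeomorphism (UNIV :: 'a set) UNIV f f'" "\<And>i. i \<in> I \<Longrightarrow> f (p i) = q i"
    then show thesis by (rule that)
  qed (use assms(1,2) pairwise in auto)
qed

lemma local_trivialization:
  fixes X :: "'b::topological_space set" and g :: "'i \<Rightarrow> 'b \<Rightarrow> 'a::euclidean_space" and \<sigma> :: "'i \<Rightarrow> 'a"
  assumes dim: "2 \<le> DIM('a)" and I: "finite I" and cont: "\<And>i. i \<in> I \<Longrightarrow> continuous_on X (g i)"
    and b0: "b0 \<in> X" and inj: "inj_on (\<lambda>i. g i b0) I" and \<sigma>: "inj_on \<sigma> I"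
  obtains U \<Psi> \<Psi>' where "openin (top_of_set X) U" "b0 \<in> U"
    "continuous_on (U \<times> UNIV) (\<lambda>(b, y). \<Psi> b y)" "continuous_on (U \<times> UNIV) (\<lambda>(b, z). \<Psi>' b z)"
    "\<And>b y. b \<in> U \<Longrightarrow> \<Psi>' b (\<Psi> b y) = y" "\<And>b z. b \<in> U \<Longrightarrow> \<Psi> b (\<Psi>' b z) = z"
    "\<And>b i. b \<in> U \<Longrightarrow> i \<in> I \<Longrightarrow> \<Psi> b (\<sigma> i) = g i b"
proof -
  obtain U \<Phi> where U: "openin (top_of_set X) U" "b0 \<in> U"
    and \<Phi>: "continuous_on (U \<times> UNIV) (\<lambda>(b, y). \<Phi> b y)"
      "continuous_on (U \<times> UNIV) (\<lambda>(b, z). inv (\<Phi> b) z)"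
      "\<And>b. b \<in> U \<Longrightarrow> bij (\<Phi> b)" "\<And>b i. b \<in> U \<Longrightarrow> i \<in> I \<Longrightarrow> \<Phi> b (g i b0) = g i b"
    using local_straightening[OF I cont b0 inj] by blast
  obtain f f' where f: "homeomorphism UNIV UNIV f f'" "\<And>i. i \<in> I \<Longrightarrow> f (\<sigma> i) = g i b0"
    using homeomorphism_moving_finite[OF dim I \<sigma> inj] by blast
  then have f': "f' (f y) = y" "f (f' y) = y" "continuous_on UNIV f" "continuous_on UNIV f'" for y
    by (auto simp: homeomorphism_def)
  have "continuous_on (U \<times> UNIV) (\<lambda>q. (\<lambda>(b, y). \<Phi> b y) (fst q, f (snd q)))"
    by (rule continuous_on_compose2[OF \<Phi>(1)])
      (auto intro!: continuous_intros continuous_on_compose2[OF f'(3)])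
  then have "continuous_on (U \<times> UNIV) (\<lambda>(b, y). \<Phi> b (f y))" by (simp add: case_prod_beta)
  moreover have "continuous_on (U \<times> UNIV) (\<lambda>(b, z). f' (inv (\<Phi> b) z))"
    using continuous_on_compose2[OF f'(4) \<Phi>(2)] by (simp add: case_prod_beta)
  moreover have "f' (inv (\<Phi> b) (\<Phi> b (f y))) = y" "\<Phi> b (f (f' (inv (\<Phi> b) z))) = z" if "b \<in> U"
    for b y z
    using \<Phi>(3)[OF that] f'(1,2) by (simp_all add: bij_is_inj bij_is_surj surj_f_inv_f)
  moreover have "\<Phi> b (f (\<sigma> i)) = g i b" if "b \<in> U" "i \<in> I" for b i using that \<Phi>(4) f(2) by simp
  ultimately show thesis using that[OF U, of "\<lambda>b y. \<Phi> b (f y)" "\<lambda>b z. f' (inv (\<Phi> b) z)"] by blast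
qed

abbreviation preimage_topology :: "'a topology \<Rightarrow> ('a \<Rightarrow> 'b) \<Rightarrow> 'b set \<Rightarrow> 'a topology" where
  "preimage_topology E p U \<equiv> subtopology E {e \<in> topspace E. p e \<in> U}"

lemma top_of_set_restrict:
  "subtopology (top_of_set E) {e \<in> topspace (top_of_set E). Q e} = top_of_set {e \<in> E. Q e}"
proof -
  have "E \<inter> {e \<in> E. Q e} = {e \<in> E. Q e}" by blast
  then show ?thesis by (simp add: subtopology_subtopology)
qed

lemma prod_top_of_set:
  "U \<subseteq> X \<Longrightarrow> prod_topology (subtopology (top_of_set X) U) (top_of_set F) = top_of_set (U \<times> F)"
  by (simp add: subtopology_subtopology Int_absorb1)

lemma homeomorphic_maps_fiberwise:
  assumes cont: "continuous_on E (\<lambda>(b, z). \<Psi>' b z)" "continuous_on (U \<times> F) (\<lambda>(b, y). \<Psi> b y)"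
    and inverse: "\<And>b y. b \<in> U \<Longrightarrow> \<Psi>' b (\<Psi> b y) = y" "\<And>b z. b \<in> U \<Longrightarrow> \<Psi> b (\<Psi>' b z) = z"
    and E: "\<And>b z. (b, z) \<in> E \<longleftrightarrow> b \<in> U \<and> \<Psi>' b z \<in> F"
  shows "homeomorphic_maps (top_of_set E) (top_of_set (U \<times> F))
    (\<lambda>(b, z). (b, \<Psi>' b z)) (\<lambda>(b, y). (b, \<Psi> b y))"
  unfolding homeomorphic_maps_def
proof (intro conjI ballI)
  show "continuous_map (top_of_set E) (top_of_set (U \<times> F)) (\<lambda>(b, z). (b, \<Psi>' b z))"
    using cont(1) E unfolding case_prod_beta by (auto intro!: continuous_intros)
  show "continuous_map (top_of_set (U \<times> F)) (top_of_set E) (\<lambda>(b, y). (b, \<Psi> b y))"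
    using cont(2) E inverse(1) unfolding case_prod_beta by (auto intro!: continuous_intros)
qed (use E inverse in auto)

lemma fiber_bundle_graph_complement:
  fixes X :: "'b::topological_space set" and g :: "'i \<Rightarrow> 'b \<Rightarrow> 'a::euclidean_space" and S :: "'a set"
  assumes dim: "2 \<le> DIM('a)" and I: "finite I" and cont: "\<And>i. i \<in> I \<Longrightarrow> continuous_on X (g i)"
    and inj: "\<And>b. b \<in> X \<Longrightarrow> inj_on (\<lambda>i. g i b) I"
    and S: "finite S" "card S = card I"
  shows "fiber_bundle (top_of_set {(b, z). b \<in> X \<and> (\<forall>i\<in>I. z \<noteq> g i b)}) (top_of_set X) fst
    (top_of_set (- S))" (is "fiber_bundle (top_of_set ?E) _ _ _")
  unfolding fiber_bundle_def
proof (intro conjI ballI)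
  show "continuous_map (top_of_set ?E) (top_of_set X) fst"
    by (auto intro!: continuous_on_fst continuous_on_id)
  obtain \<sigma> where \<sigma>: "bij_betw \<sigma> I S" using finite_same_card_bij[OF I S(1)] S(2) by auto
  then have \<sigma>_inj: "inj_on \<sigma> I" and \<sigma>_image: "\<sigma> ` I = S" by (auto simp: bij_betw_def)
  fix b0 assume "b0 \<in> topspace (top_of_set X)"
  then have b0: "b0 \<in> X" by simp
  obtain U \<Psi> \<Psi>' where U: "openin (top_of_set X) U" "b0 \<in> U"
    and cont_\<Psi>: "continuous_on (U \<times> UNIV) (\<lambda>(b, y). \<Psi> b y)"
    and cont_\<Psi>': "continuous_on (U \<times> UNIV) (\<lambda>(b, z). \<Psi>' b z)"
    and inverse: "\<And>b y. b \<in> U \<Longrightarrow> \<Psi>' b (\<Psi> b y) = y" "\<And>b z. b \<in> U \<Longrightarrow> \<Psi> b (\<Psi>' b z) = z"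
    and \<Psi>_\<sigma>: "\<And>b i. b \<in> U \<Longrightarrow> i \<in> I \<Longrightarrow> \<Psi> b (\<sigma> i) = g i b"
    using local_trivialization[OF dim I cont b0 inj[OF b0] \<sigma>_inj] by blast
  have UX: "U \<subseteq> X" using U(1) by (rule openin_imp_subset)
  let ?EU = "{q \<in> ?E. fst q \<in> U}" and ?h = "\<lambda>(b, z). (b, \<Psi>' b z)"
  have puncture_iff: "z = g i b \<longleftrightarrow> \<Psi>' b z = \<sigma> i" if "b \<in> U" "i \<in> I" for b i z
    using inverse[OF that(1)] \<Psi>_\<sigma>[OF that] by metis
  then have fiber_iff: "(\<forall>i\<in>I. z \<noteq> g i b) \<longleftrightarrow> \<Psi>' b z \<in> - S" if "b \<in> U" for b z
    unfolding \<sigma>_image[symmetric] using that by blast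
  have "homeomorphic_maps (top_of_set ?EU) (top_of_set (U \<times> - S)) ?h (\<lambda>(b, y). (b, \<Psi> b y))"
  proof (rule homeomorphic_maps_fiberwise[OF _ _ inverse])
    show "continuous_on ?EU (\<lambda>(b, z). \<Psi>' b z)" by (rule continuous_on_subset[OF cont_\<Psi>']) auto
    show "continuous_on (U \<times> - S) (\<lambda>(b, y). \<Psi> b y)" by (rule continuous_on_subset[OF cont_\<Psi>]) auto
    show "(b, z) \<in> ?EU \<longleftrightarrow> b \<in> U \<and> \<Psi>' b z \<in> - S" for b z
      using fiber_iff[of b z] UX by auto
  qed
  then have "homeomorphic_map (preimage_topology (top_of_set ?E) fst U)
      (prod_topology (subtopology (top_of_set X) U) (top_of_set (- S))) ?h"
    unfolding homeomorphic_map_maps top_of_set_restrict prod_top_of_set[OF UX] by blast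
  then show "\<exists>U h. openin (top_of_set X) U \<and> b0 \<in> U \<and>
      homeomorphic_map (preimage_topology (top_of_set ?E) fst U)
        (prod_topology (subtopology (top_of_set X) U) (top_of_set (- S))) h \<and>
      (\<forall>e\<in>topspace (top_of_set ?E). fst e \<in> U \<longrightarrow> fst (h e) = fst e)"
    using U by (intro exI[of _ U] exI[of _ ?h]) (simp add: case_prod_beta)
qed

lemma fiber_bundle_local_trivialization:
  assumes "fiber_bundle E B p F" "b \<in> topspace B"
  obtains U h where "openin B U" "b \<in> U"
    "homeomorphic_map (preimage_topology E p U) (prod_topology (subtopology B U) F) h"
    "\<And>e. e \<in> topspace E \<Longrightarrow> p e \<in> U \<Longrightarrow> fst (h e) = p e"
  using assms unfolding fiber_bundle_def by meson

lemma fiber_bundle_homeomorphic_total_space: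
  assumes f: "homeomorphic_map E' E f" and E_bundle: "fiber_bundle E B p F"
    and p': "\<And>e. e \<in> topspace E' \<Longrightarrow> p' e = p (f e)"
  shows "fiber_bundle E' B p' F"
  unfolding fiber_bundle_def
proof (intro conjI ballI)
  have f_image: "f ` topspace E' = topspace E" using f by (rule homeomorphic_imp_surjective_map)
  have "continuous_map E' B (p \<circ> f)"
    by (rule continuous_map_compose[OF homeomorphic_imp_continuous_map[OF f]])
      (use E_bundle in \<open>simp add: fiber_bundle_def\<close>)
  then show "continuous_map E' B p'" by (rule continuous_map_eq) (simp add: p')
  fix b assume "b \<in> topspace B"
  then obtain U h where U: "openin B U" "b \<in> U"
    and h: "homeomorphic_map (preimage_topology E p U) (prod_topology (subtopology B U) F) h"
    and fst: "\<And>e. e \<in> topspace E \<Longrightarrow> p e \<in> U \<Longrightarrow> fst (h e) = p e"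
    using fiber_bundle_local_trivialization[OF E_bundle] by blast
  have "homeomorphic_map (preimage_topology E' p' U) (preimage_topology E p U) f"
    by (rule homeomorphic_map_subtopologies_alt[OF f]) (use p' in auto)
  then have
    "homeomorphic_map (preimage_topology E' p' U) (prod_topology (subtopology B U) F) (h \<circ> f)"
    using h by (rule homeomorphic_map_compose)
  moreover have "fst ((h \<circ> f) e) = p' e" if "e \<in> topspace E'" "p' e \<in> U" for e
    using that fst[of "f e"] f_image p' by auto
  ultimately show "\<exists>U h. openin B U \<and> b \<in> U \<and>
      homeomorphic_map (preimage_topology E' p' U) (prod_topology (subtopology B U) F) h \<and>
      (\<forall>e\<in>topspace E'. p' e \<in> U \<longrightarrow> fst (h e) = p' e)"
    using U by blast
qed

lemma fiber_bundle_fiber: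
  assumes "fiber_bundle E B p F" "b \<in> topspace B"
  shows "F homeomorphic_space subtopology E {e \<in> topspace E. p e = b}"
proof -
  obtain U h where U: "openin B U" "b \<in> U"
    and h: "homeomorphic_map (preimage_topology E p U) (prod_topology (subtopology B U) F) h"
    and fst: "\<And>e. e \<in> topspace E \<Longrightarrow> p e \<in> U \<Longrightarrow> fst (h e) = p e"
    using fiber_bundle_local_trivialization[OF assms] by blast
  have UB: "U \<subseteq> topspace B" using U(1) by (rule openin_subset)
  let ?EU = "{e \<in> topspace E. p e \<in> U}" and ?Eb = "{e \<in> topspace E. p e = b}"
  have "homeomorphic_map (subtopology (subtopology E ?EU) ?Eb)
      (subtopology (prod_topology (subtopology B U) F) ({b} \<times> topspace F)) h"
    by (rule homeomorphic_map_subtopologies_alt[OF h]) (use fst in \<open>auto simp: mem_Times_iff\<close>)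
  moreover have "?EU \<inter> ?Eb = ?Eb" using U(2) by auto
  then have "subtopology (subtopology E ?EU) ?Eb = subtopology E ?Eb"
    by (simp add: subtopology_subtopology)
  moreover have "subtopology (prod_topology (subtopology B U) F) ({b} \<times> topspace F)
      = prod_topology (subtopology (subtopology B U) {b}) F"
    by (simp add: prod_topology_subtopology(1))
  ultimately have "homeomorphic_map (subtopology E ?Eb)
      (prod_topology (subtopology (subtopology B U) {b}) F) h"
    by (simp only:)
  then have "subtopology E ?Eb homeomorphic_space
      prod_topology (subtopology (subtopology B U) {b}) F"
    by (rule homeomorphic_map_imp_homeomorphic_space)
  moreover have "F homeomorphic_space prod_topology (subtopology (subtopology B U) {b}) F"
    using U(2) UB by (intro homeomorphic_space_prod_topology_sing2) auto
  ultimately show ?thesis using homeomorphic_space_trans homeomorphic_space_sym by blast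
qed

subsection \<open>Projections of coordinate space\<close>

lemma Cn_scale: "x \<in> Cn n \<Longrightarrow> fun_scale c x \<in> Cn n"
  and Cn_Suc: "x \<in> Cn n \<Longrightarrow> x \<in> Cn (Suc n)"
  and unit_seq_in_Cn: "unit_seq n \<in> Cn (Suc n)"
  by (auto simp: Cn_def fun_scale_def unit_seq_def)

lemma proj_add: "proj m (x + y) = proj m x + proj m y"
  and proj_scale: "proj m (fun_scale c x) = fun_scale c (proj m x)"
  and proj_in_Cn: "proj m x \<in> Cn m"
  and proj_id: "x \<in> Cn m \<Longrightarrow> proj m x = x"
  by (auto simp: proj_def Cn_def fun_scale_def fun_eq_iff)

lemma proj_fun_upd: "b \<in> Cn m \<Longrightarrow> proj m (b(m := z)) = b"
  and fun_upd_in_Cn: "b \<in> Cn m \<Longrightarrow> b(m := z) \<in> Cn (Suc m)"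
  and proj_upd_last: "x \<in> Cn (Suc m) \<Longrightarrow> (proj m x)(m := x m) = x"
  and Cn_Suc_decomp: "x \<in> Cn (Suc m) \<Longrightarrow> x = proj m x + fun_scale (x m) (unit_seq m)"
  by (auto simp: proj_def Cn_def fun_scale_def unit_seq_def fun_eq_iff)

lemma continuous_on_apply_index: "continuous_on S (\<lambda>x :: 'i \<Rightarrow> 'a::topological_space. x i)"
  by (rule continuous_on_subset[OF continuous_on_product_coordinates]) simp

lemma continuous_on_proj: "continuous_on S (proj m)"
proof (rule continuous_on_coordinatewise_then_product)
  fix i show "continuous_on S (\<lambda>x. proj m x i)"
    by (cases "i < m") (simp_all add: proj_def continuous_on_apply_index)
qed

lemma continuous_on_fun_upd:
  assumes "continuous_on S f" "continuous_on S g"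
  shows "continuous_on S (\<lambda>x. (f x)(i := g x))"
proof (rule continuous_on_coordinatewise_then_product)
  fix j show "continuous_on S (\<lambda>x. ((f x)(i := g x)) j)"
    using assms continuous_on_product_then_coordinatewise[OF assms(1), of j] by (cases "j = i") auto
qed

lemma continuous_on_linear_Cn:
  assumes "Vector_Spaces.linear fun_scale (*) f" "S \<subseteq> Cn m"
  shows "continuous_on S f"
proof -
  interpret Vector_Spaces.linear fun_scale "(*)" f by fact
  have "f b = (\<Sum>j<m. b j * f (unit_seq j))" if "b \<in> S" for b
  proof -
    have "b = (\<Sum>j<m. fun_scale (b j) (unit_seq j))"
      using that assms(2) by (auto simp: fun_eq_iff sum_unit_seq Cn_def not_less)
    then have "f b = f (\<Sum>j<m. fun_scale (b j) (unit_seq j))" by simp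
    also have "\<dots> = (\<Sum>j<m. b j * f (unit_seq j))" by (simp add: sum scale)
    finally show ?thesis .
  qed
  moreover have "continuous_on S (\<lambda>b. \<Sum>j<m. b j * f (unit_seq j))"
    by (intro continuous_intros continuous_on_apply_index)
  ultimately show ?thesis by (simp cong: continuous_on_cong)
qed

lemma homeomorphic_map_split_last:
  assumes "E \<subseteq> Cn (Suc m)"
  shows "homeomorphic_map (top_of_set E) (top_of_set ((\<lambda>x. (proj m x, x m)) ` E))
    (\<lambda>x. (proj m x, x m))" (is "homeomorphic_map _ (top_of_set (?split ` E)) _")
proof -
  have "homeomorphic_maps (top_of_set E) (top_of_set (?split ` E)) ?split
      (\<lambda>q. (fst q)(m := snd q))"
    unfolding homeomorphic_maps_def
  proof (intro conjI ballI)
    show "continuous_map (top_of_set E) (top_of_set (?split ` E)) ?split"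
      by (auto intro!: continuous_on_Pair continuous_on_proj continuous_on_apply_index)
    show "continuous_map (top_of_set (?split ` E)) (top_of_set E) (\<lambda>q. (fst q)(m := snd q))"
      using assms proj_upd_last
      by (auto intro!: continuous_on_fun_upd continuous_on_fst continuous_on_snd continuous_on_id
          simp: subset_iff)
  qed (use assms proj_upd_last in \<open>auto simp: subset_iff\<close>)
  then show ?thesis unfolding homeomorphic_map_maps by blast
qed

lemma fiber_bundle_proj_graph_complement:
  fixes g :: "'i \<Rightarrow> (nat \<Rightarrow> complex) \<Rightarrow> complex" and S :: "complex set"
  assumes "X \<subseteq> Cn m" "finite I" "\<And>i. i \<in> I \<Longrightarrow> continuous_on X (g i)"
    and "\<And>b. b \<in> X \<Longrightarrow> inj_on (\<lambda>i. g i b) I" "finite S" "card S = card I"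
    and E: "E = {x \<in> Cn (Suc m). proj m x \<in> X \<and> (\<forall>i\<in>I. x m \<noteq> g i (proj m x))}"
  shows "fiber_bundle (top_of_set E) (top_of_set X) (proj m) (top_of_set (UNIV - S))"
proof -
  have image: "(\<lambda>x. (proj m x, x m)) ` E = {(b, z). b \<in> X \<and> (\<forall>i\<in>I. z \<noteq> g i b)}"
  proof (intro equalityI subsetI)
    fix q assume "q \<in> {(b, z). b \<in> X \<and> (\<forall>i\<in>I. z \<noteq> g i b)}"
    moreover have "fst q \<in> Cn m" if "fst q \<in> X" using that assms(1) by blast
    ultimately show "q \<in> (\<lambda>x. (proj m x, x m)) ` E"
      by (intro image_eqI[of _ _ "(fst q)(m := snd q)"]) (auto simp: E proj_fun_upd fun_upd_in_Cn)
  qed (auto simp: E)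
  have "E \<subseteq> Cn (Suc m)" by (auto simp: E)
  then have "homeomorphic_map (top_of_set E)
      (top_of_set {(b, z). b \<in> X \<and> (\<forall>i\<in>I. z \<noteq> g i b)}) (\<lambda>x. (proj m x, x m))"
    unfolding image[symmetric] by (rule homeomorphic_map_split_last)
  moreover have "fiber_bundle (top_of_set {(b, z). b \<in> X \<and> (\<forall>i\<in>I. z \<noteq> g i b)}) (top_of_set X) fst
      (top_of_set (- S))"
    by (rule fiber_bundle_graph_complement) (use assms in auto)
  ultimately show ?thesis
    unfolding Compl_eq_Diff_UNIV[symmetric] by (rule fiber_bundle_homeomorphic_total_space) simp
qed

lemma homeomorphic_if_top_of_set_homeomorphic_space:
  assumes "top_of_set S homeomorphic_space top_of_set T"
  shows "S homeomorphic T"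
proof -
  obtain f g where "homeomorphic_maps (top_of_set S) (top_of_set T) f g"
    using assms by (auto simp: homeomorphic_space_def)
  then have "homeomorphism S T f g"
    by (intro homeomorphismI) (auto simp: homeomorphic_maps_def image_subset_iff_funcset)
  then show ?thesis by (auto simp: homeomorphic_def)
qed

lemma fiber_bundle_proj_fiber:
  assumes E_bundle: "fiber_bundle (top_of_set E) (top_of_set X) (proj m) (top_of_set F)"
    and E: "E \<subseteq> Cn (Suc m)" and b: "b \<in> X" "b \<in> Cn m"
  shows "F homeomorphic {z. b(m := z) \<in> E}"
proof -
  have "top_of_set F homeomorphic_space top_of_set {e \<in> E. proj m e = b}"
    using fiber_bundle_fiber[OF E_bundle, of b] b(1) unfolding top_of_set_restrict by simp
  then have "F homeomorphic {e \<in> E. proj m e = b}"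
    by (rule homeomorphic_if_top_of_set_homeomorphic_space)
  moreover have "homeomorphism {e \<in> E. proj m e = b} {z. b(m := z) \<in> E} (\<lambda>e. e m) (\<lambda>z. b(m := z))"
  proof (rule homeomorphismI)
    show "continuous_on {z. b(m := z) \<in> E} (\<lambda>z. b(m := z))"
      by (intro continuous_on_fun_upd continuous_on_const continuous_on_id)
    have "b(m := e m) = e" if "e \<in> E" "proj m e = b" for e using that E proj_upd_last by blast
    then show "(\<lambda>e. e m) ` {e \<in> E. proj m e = b} \<subseteq> {z. b(m := z) \<in> E}"
      and "\<And>e. e \<in> {e \<in> E. proj m e = b} \<Longrightarrow> b(m := e m) = e" by auto
  qed (auto simp: continuous_on_apply_index proj_fun_upd[OF b(2)])
  ultimately show ?thesis using homeomorphic_trans unfolding homeomorphic_def by blast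
qed

section \<open>Coordinate systems\<close>

lemma Cn_eq_span: "Cn n = fun_vs.span (unit_seq ` {..<n})"
proof
  show "Cn n \<subseteq> fun_vs.span (unit_seq ` {..<n})"
  proof
    fix x assume "x \<in> Cn n"
    then have "x = (\<Sum>j<n. fun_scale (x j) (unit_seq j))"
      by (auto simp: fun_eq_iff sum_unit_seq Cn_def not_less)
    also have "\<dots> \<in> fun_vs.span (unit_seq ` {..<n})"
      by (intro fun_vs.span_sum fun_vs.span_scale fun_vs.span_base) auto
    finally show "x \<in> fun_vs.span (unit_seq ` {..<n})" .
  qed
  show "fun_vs.span (unit_seq ` {..<n}) \<subseteq> Cn n"
    by (rule fun_vs.span_minimal[OF _ subspace_Cn]) (auto simp: Cn_def unit_seq_def)
qed

lemma finite_dim_subspace_Cn: "finite_dim_subspace fun_scale (Cn n)"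
proof unfold_locales
  show "\<exists>B. finite B \<and> Cn n \<subseteq> fun_vs.span B"
    by (intro exI[of _ "unit_seq ` {..<n}"]) (simp add: Cn_eq_span)
qed (rule subspace_Cn)

locale indexed_basis = vector_space scale
  for scale :: "complex \<Rightarrow> 'v::ab_group_add \<Rightarrow> 'v" +
  fixes b :: "nat \<Rightarrow> 'v" and d :: nat
  assumes inj: "inj_on b {..<d}" and independent: "independent (b ` {..<d})"
begin

abbreviation basis :: "'v set" where
  "basis \<equiv> b ` {..<d}"

definition coordinate :: "'v \<Rightarrow> nat \<Rightarrow> complex" where
  "coordinate x i = (if i < d then representation basis x (b i) else 0)"

lemma coordinate_add: "x \<in> span basis \<Longrightarrow> y \<in> span basis \<Longrightarrow>
    coordinate (x + y) = coordinate x + coordinate y"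
  and coordinate_scale: "x \<in> span basis \<Longrightarrow> coordinate (scale c x) = fun_scale c (coordinate x)"
  by (auto simp: coordinate_def fun_scale_def fun_eq_iff representation_add representation_scale
    independent)

lemma coordinate_basis: "j < d \<Longrightarrow> coordinate (b j) = unit_seq j"
  using inj by (auto simp: coordinate_def unit_seq_def fun_eq_iff representation_basis independent
    inj_on_def)

lemma coordinate_sum:
  assumes "\<And>i. i \<in> I \<Longrightarrow> f i \<in> span basis"
  shows "coordinate (\<Sum>i\<in>I. f i) = (\<Sum>i\<in>I. coordinate (f i))"
  using assms
proof (induction I rule: infinite_finite_induct)
  case (insert i I)
  then show ?case by (simp add: coordinate_add span_sum)
qed (auto simp: coordinate_def representation_zero fun_eq_iff)

lemma coordinate_combination:
  assumes "z \<in> Cn d"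
  shows "coordinate (\<Sum>i<d. scale (z i) (b i)) = z"
proof -
  have "coordinate (\<Sum>i<d. scale (z i) (b i)) = (\<Sum>i<d. fun_scale (z i) (unit_seq i))"
    by (subst coordinate_sum)
      (auto simp: coordinate_scale coordinate_basis span_base span_scale intro!: sum.cong)
  also have "\<dots> = z" using assms by (auto simp: fun_eq_iff sum_unit_seq Cn_def not_less)
  finally show ?thesis .
qed

lemma combination_coordinate:
  assumes "x \<in> span basis"
  shows "(\<Sum>i<d. scale (coordinate x i) (b i)) = x"
proof -
  have "(\<Sum>i<d. scale (coordinate x i) (b i)) = (\<Sum>v\<in>basis. scale (representation basis x v) v)"
    using inj by (simp add: sum.reindex coordinate_def)
  also have "\<dots> = x" by (rule sum_representation_eq[OF independent assms]) auto
  finally show ?thesis .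
qed

lemma coordinates_coordinate: "coordinates scale (span basis) d coordinate"
  unfolding coordinates_def
proof (intro conjI ballI allI)
  show "bij_betw coordinate (span basis) (Cn d)"
  proof (rule bij_betw_byWitness[where f' = "\<lambda>z. \<Sum>i<d. scale (z i) (b i)"])
    show "(\<lambda>z. \<Sum>i<d. scale (z i) (b i)) ` Cn d \<subseteq> span basis"
      by (auto intro!: span_sum span_scale intro: span_base)
    show "coordinate ` span basis \<subseteq> Cn d" by (auto simp: coordinate_def Cn_def)
  qed (auto simp: combination_coordinate coordinate_combination)
qed (simp_all add: coordinate_add coordinate_scale)

end

lemma coordinates_exist:
  fixes scale :: "complex \<Rightarrow> 'v::ab_group_add \<Rightarrow> 'v"
  assumes "finite_dim_subspace scale V" "v \<in> V" "v \<noteq> 0" "vector_space.dim scale V = Suc m"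
  obtains \<phi> where "coordinates scale V (Suc m) \<phi>" "\<phi> v = unit_seq m"
proof -
  interpret finite_dim_subspace scale V by fact
  have "independent {v}" using assms(3) by simp
  then obtain B where B: "{v} \<subseteq> B" "B \<subseteq> V" "independent B" "V \<subseteq> span B"
    using maximal_independent_subset_extend[of "{v}" V] assms(2) by blast
  then have span: "span B = V" using span_minimal[OF B(2) subspace_V] by blast
  have card: "card B = Suc m" using basis_card_eq_dim[OF B(2,4,3)] assms(4) by simp
  then have "finite B" by (auto intro: card_ge_0_finite)
  then obtain b where b: "bij_betw b {..<m} (B - {v})"
    using ex_bij_betw_nat_finite[of "B - {v}"] card B(1) by (auto simp: atLeast0LessThan)
  define b' where "b' = b(m := v)"
  have b': "b' ` {..<Suc m} = B" "inj_on b' {..<Suc m}"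
    using b B(1) by (auto simp: b'_def lessThan_Suc bij_betw_def inj_on_def)
  interpret indexed_basis scale b' "Suc m" by unfold_locales (use b' B(3) in auto)
  show thesis
  proof (rule that)
    show "coordinates scale V (Suc m) coordinate"
      using coordinates_coordinate by (simp add: b'(1) span)
    show "coordinate v = unit_seq m" using coordinate_basis[of m] by (simp add: b'_def)
  qed
qed

locale coordinate_system = finite_dim_subspace scale V
  for scale :: "complex \<Rightarrow> 'v::ab_group_add \<Rightarrow> 'v" and V +
  fixes n :: nat and \<phi> :: "'v \<Rightarrow> nat \<Rightarrow> complex"
  assumes coordinates: "coordinates scale V n \<phi>"
begin

abbreviation lift :: "(nat \<Rightarrow> complex) \<Rightarrow> 'v" where
  "lift \<equiv> inv_into V \<phi>"

lemma bij: "bij_betw \<phi> V (Cn n)"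
  and coordinates_add: "x \<in> V \<Longrightarrow> y \<in> V \<Longrightarrow> \<phi> (x + y) = \<phi> x + \<phi> y"
  and coordinates_scale: "x \<in> V \<Longrightarrow> \<phi> (scale c x) = fun_scale c (\<phi> x)"
  using coordinates by (auto simp: coordinates_def)

lemma coordinates_in_Cn: "x \<in> V \<Longrightarrow> \<phi> x \<in> Cn n"
  and lift_in_V: "z \<in> Cn n \<Longrightarrow> lift z \<in> V"
  and coordinates_lift: "z \<in> Cn n \<Longrightarrow> \<phi> (lift z) = z"
  and lift_coordinates: "x \<in> V \<Longrightarrow> lift (\<phi> x) = x"
  using bij by (auto simp: bij_betw_def inv_into_into f_inv_into_f inv_into_f_f)

lemma lift_add: assumes "x \<in> Cn n" "y \<in> Cn n" shows "lift (x + y) = lift x + lift y"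
proof -
  have "x + y = \<phi> (lift x + lift y)"
    using assms by (simp add: coordinates_add lift_in_V coordinates_lift)
  then show ?thesis
    using assms by (simp add: lift_coordinates lift_in_V subspace_add[OF subspace_V])
qed

lemma lift_scale: assumes "x \<in> Cn n" shows "lift (fun_scale c x) = scale c (lift x)"
proof -
  have "fun_scale c x = \<phi> (scale c (lift x))"
    using assms by (simp add: coordinates_scale lift_in_V coordinates_lift)
  then show ?thesis
    using assms by (simp add: lift_coordinates lift_in_V subspace_scale[OF subspace_V])
qed

lemma coordinates_0: "\<phi> 0 = 0"
  using coordinates_add[of 0 0] subspace_0[OF subspace_V] by simp

lemma coordinates_compose_lift:
  assumes "coordinates scale V k \<eta>"
  shows "coordinates fun_scale (Cn n) k (\<eta> \<circ> lift)"
proof -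
  have "bij_betw (\<eta> \<circ> lift) (Cn n) (Cn k)"
    using bij_betw_trans[OF bij_betw_inv_into[OF bij]] assms by (auto simp: coordinates_def)
  then show ?thesis
    using assms by (auto simp: coordinates_def lift_in_V lift_add lift_scale)
qed

end

lemma coordinates_dim:
  fixes scale :: "complex \<Rightarrow> 'v::ab_group_add \<Rightarrow> 'v"
  assumes V: "finite_dim_subspace scale V" "vector_space.dim scale V = Suc m"
    and "coordinates scale V k \<phi>"
  shows "k = Suc m"
proof -
  interpret finite_dim_subspace scale V by fact
  have "\<not> V \<subseteq> {0}" using V(2) dim_le_card[of V "{}"] by auto
  then obtain v where "v \<in> V" "v \<noteq> 0" by blast
  then obtain \<eta> where "coordinates scale V (Suc m) \<eta>" using coordinates_exist[OF V(1)] V(2) by blast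
  then interpret coordinate_system scale V "Suc m" \<eta> by unfold_locales
  show ?thesis using coordinates_Cn_dim[OF coordinates_compose_lift[OF assms(3)]] .
qed

section \<open>The projection along a coordinate direction\<close>

locale coordinatized_arrangement =
  hyperplane_arrangement scale V A + coordinate_system scale V "Suc m" \<phi>
  for scale :: "complex \<Rightarrow> 'v::ab_group_add \<Rightarrow> 'v" and V A m \<phi>
begin

definition vertical :: 'v where
  "vertical = lift (unit_seq m)"

definition base_proj :: "'v \<Rightarrow> nat \<Rightarrow> complex" where
  "base_proj x = proj m (\<phi> x)"

abbreviation parallels :: "'v set set" where
  "parallels \<equiv> parallel_part A vertical"

abbreviation transversals :: "'v set set" where
  "transversals \<equiv> transverse_part A vertical"

definition base_arrangement :: "(nat \<Rightarrow> complex) set set" where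
  "base_arrangement = (\<lambda>H. base_proj ` H) ` parallels"

definition height :: "'v set \<Rightarrow> (nat \<Rightarrow> complex) \<Rightarrow> complex" where
  "height H b = (level H - linear_form H (lift b)) / linear_form H vertical"

abbreviation heights :: "(nat \<Rightarrow> complex) \<Rightarrow> complex set" where
  "heights b \<equiv> (\<lambda>H. height H b) ` transversals"

abbreviation base_complement :: "(nat \<Rightarrow> complex) set" where
  "base_complement \<equiv> arr_complement (Cn m) base_arrangement"

abbreviation total_space :: "(nat \<Rightarrow> complex) set" where
  "total_space \<equiv> \<phi> ` arr_complement V A"

abbreviation projection_bundle :: "(nat \<Rightarrow> complex) set \<Rightarrow> complex set \<Rightarrow> bool" where
  "projection_bundle X S \<equiv>
    fiber_bundle (top_of_set total_space) (top_of_set X) (proj m) (top_of_set (UNIV - S))"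

lemma vertical_in_V: "vertical \<in> V" and vertical_nonzero: "vertical \<noteq> 0"
proof -
  show "vertical \<in> V" by (simp add: vertical_def lift_in_V unit_seq_in_Cn)
  have "\<phi> vertical = unit_seq m" by (simp add: vertical_def coordinates_lift unit_seq_in_Cn)
  then have "\<phi> vertical \<noteq> 0" by (auto simp: unit_seq_def fun_eq_iff)
  then show "vertical \<noteq> 0" using coordinates_0 by auto
qed

lemma base_proj_in_Cn: "base_proj x \<in> Cn m"
  by (simp add: base_proj_def proj_in_Cn)

lemma base_proj_lift: "b \<in> Cn m \<Longrightarrow> base_proj (lift b) = b"
  by (simp add: base_proj_def coordinates_lift Cn_Suc proj_id)

lemma base_proj_image: "base_proj ` V = Cn m"
  using base_proj_in_Cn base_proj_lift lift_in_V Cn_Suc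
  by (metis image_subset_iff subset_antisym image_eqI subsetI)

lemma vertical_decomposition:
  assumes "x \<in> V"
  shows "x = lift (base_proj x) + scale (\<phi> x m) vertical"
proof -
  have "\<phi> x = proj m (\<phi> x) + fun_scale (\<phi> x m) (unit_seq m)"
    by (rule Cn_Suc_decomp[OF coordinates_in_Cn[OF assms]])
  then have "lift (\<phi> x) = lift (base_proj x) + lift (fun_scale (\<phi> x m) (unit_seq m))"
    unfolding base_proj_def by (metis lift_add Cn_Suc proj_in_Cn Cn_scale unit_seq_in_Cn)
  then show ?thesis
    using assms by (simp add: lift_coordinates lift_scale unit_seq_in_Cn vertical_def)
qed

lemma linear_form_decomposition:
  assumes "H \<in> A" "x \<in> V"
  shows "linear_form H x = linear_form H (lift (base_proj x)) + \<phi> x m * linear_form H vertical"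
  using arg_cong[OF vertical_decomposition[OF assms(2)], of "linear_form H"]
  by (simp add: linear_form_simps[OF assms(1)])

lemma mem_parallels: "H \<in> parallels \<longleftrightarrow> H \<in> A \<and> linear_form H vertical = 0"
  using mem_directions_hyperplane vertical_in_V by (auto simp: parallel_part_def)

lemma mem_parallel_hyperplane_iff:
  assumes "H \<in> parallels" "x \<in> V"
  shows "x \<in> H \<longleftrightarrow> linear_form H (lift (base_proj x)) = level H"
  using assms linear_form_decomposition[of H x] by (simp add: mem_parallels mem_hyperplane_iff)

lemma mem_transverse_hyperplane_iff:
  assumes "H \<in> transversals" "x \<in> V"
  shows "x \<in> H \<longleftrightarrow> \<phi> x m = height H (base_proj x)"
  using assms linear_form_decomposition[of H x]
  by (auto simp: mem_parallels mem_hyperplane_iff height_def field_simps)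

lemma base_hyperplane_eq:
  assumes "H \<in> parallels"
  shows "base_proj ` H = {b \<in> Cn m. linear_form H (lift b) = level H}"
proof -
  have HV: "H \<subseteq> V" using assms hyperplane_subset by (auto simp: parallel_part_def)
  show ?thesis
  proof (intro equalityI subsetI)
    fix b assume "b \<in> {b \<in> Cn m. linear_form H (lift b) = level H}"
    then have b: "b \<in> Cn m" "lift b \<in> H"
      using mem_parallel_hyperplane_iff[OF assms, of "lift b"]
      by (auto simp: lift_in_V Cn_Suc base_proj_lift)
    then show "b \<in> base_proj ` H" using base_proj_lift by (metis image_eqI)
  next
    fix b assume "b \<in> base_proj ` H"
    then show "b \<in> {b \<in> Cn m. linear_form H (lift b) = level H}"
      using mem_parallel_hyperplane_iff[OF assms] HV base_proj_in_Cn by auto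
  qed
qed

lemma mem_parallel_hyperplane_iff_base_proj:
  "H \<in> parallels \<Longrightarrow> x \<in> V \<Longrightarrow> x \<in> H \<longleftrightarrow> base_proj x \<in> base_proj ` H"
  by (simp add: base_hyperplane_eq mem_parallel_hyperplane_iff base_proj_in_Cn)

lemma linear_form_lift_linear:
  assumes "H \<in> A"
  shows "Vector_Spaces.linear fun_scale (*) (\<lambda>b. linear_form H (lift (proj m b)))"
proof unfold_locales
  fix b b' c
  show "linear_form H (lift (proj m (b + b')))
      = linear_form H (lift (proj m b)) + linear_form H (lift (proj m b'))"
    by (simp add: proj_add lift_add proj_in_Cn Cn_Suc linear_form_simps[OF assms])
  show "linear_form H (lift (proj m (fun_scale c b))) = c * linear_form H (lift (proj m b))"
    by (simp add: proj_scale lift_scale proj_in_Cn Cn_Suc linear_form_simps[OF assms])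
qed

sublocale base: hyperplane_arrangement fun_scale "Cn m" base_arrangement
proof (intro hyperplane_arrangement.intro finite_dim_subspace_Cn
  hyperplane_arrangement_axioms.intro)
  show "affine_arrangement fun_scale (Cn m) base_arrangement"
    unfolding affine_arrangement_def
  proof (intro conjI ballI)
    show "finite base_arrangement"
      using finite_A by (simp add: base_arrangement_def parallel_part_def)
    fix K assume "K \<in> base_arrangement"
    then obtain H where H: "H \<in> parallels" "K = base_proj ` H" by (auto simp: base_arrangement_def)
    then have HA: "H \<in> A" "linear_form H vertical = 0" by (simp_all add: mem_parallels)
    obtain w where "w \<in> V" "linear_form H w \<noteq> 0" using linear_form_nonzero[OF HA(1)] by blast
    then have "linear_form H (lift (proj m (base_proj w))) \<noteq> 0"
      using linear_form_decomposition[OF HA(1)] HA(2) by (simp add: proj_id base_proj_in_Cn)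
    moreover have "K = {b \<in> Cn m. linear_form H (lift (proj m b)) = level H}"
      using base_hyperplane_eq[OF H(1)] H(2) by (auto simp: proj_id)
    ultimately show "affine_hyperplane fun_scale (Cn m) K"
      unfolding affine_hyperplane_def
        using linear_form_lift_linear[OF HA(1)] base_proj_in_Cn by blast
  qed
qed

lemma supersolvable_base_iff:
  "supersolvable (layers V (parallels)) (\<supseteq>) \<longleftrightarrow> supersolvable base.P (\<supseteq>)"
proof -
  have "V \<inter> base_proj -` (base_proj ` H) = H" if "H \<in> parallels" for H
    using mem_parallel_hyperplane_iff_base_proj[OF that] hyperplane_subset[of H] that
    by (auto simp: parallel_part_def)
  then have "(\<lambda>K. V \<inter> base_proj -` K) ` base_arrangement = parallels"
    by (simp add: base_arrangement_def image_image)
  then show ?thesis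
    using supersolvable_layers_vimage[OF base_proj_image, of base_arrangement] by simp
qed

lemma mem_complement_iff:
  assumes "x \<in> V"
  shows "x \<in> arr_complement V A \<longleftrightarrow>
    base_proj x \<in> base_complement \<and> (\<forall>H\<in>transversals. \<phi> x m \<noteq> height H (base_proj x))"
proof -
  have "x \<notin> \<Union>A \<longleftrightarrow> (\<forall>H\<in>parallels. x \<notin> H) \<and> (\<forall>H\<in>transversals. x \<notin> H)"
    by (auto simp: parallel_part_def)
  then show ?thesis
    using assms mem_parallel_hyperplane_iff_base_proj[OF _ assms]
      mem_transverse_hyperplane_iff[OF _ assms]
    by (simp add: arr_complement_def base_arrangement_def base_proj_in_Cn)
qed

lemma complement_coordinates_eq:
  "total_space =
    {z \<in> Cn (Suc m). proj m z \<in> base_complement \<and> (\<forall>H\<in>transversals. z m \<noteq> height H (proj m z))}"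
proof (intro equalityI subsetI)
  fix z assume "z \<in> total_space"
  then obtain x where x: "x \<in> V" "x \<in> arr_complement V A" "z = \<phi> x"
    by (auto simp: arr_complement_def)
  then show "z \<in> {z \<in> Cn (Suc m). proj m z \<in> base_complement \<and>
      (\<forall>H\<in>transversals. z m \<noteq> height H (proj m z))}"
    using mem_complement_iff[OF x(1)] coordinates_in_Cn[OF x(1)] by (simp add: base_proj_def)
next
  fix z assume z: "z \<in> {z \<in> Cn (Suc m). proj m z \<in> base_complement \<and>
      (\<forall>H\<in>transversals. z m \<noteq> height H (proj m z))}"
  then have "lift z \<in> arr_complement V A"
    using mem_complement_iff[of "lift z"] by (simp add: lift_in_V base_proj_def coordinates_lift)
  then show "z \<in> total_space"
    using z coordinates_lift by (metis (no_types, lifting) image_eqI mem_Collect_eq)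
qed

lemma base_complement_subset: "base_complement \<subseteq> Cn m"
  by (auto simp: arr_complement_def)

lemma fun_upd_mem_complement_iff:
  assumes "b \<in> Cn m"
  shows "b(m := z) \<in> total_space \<longleftrightarrow> b \<in> base_complement \<and> z \<notin> heights b"
  unfolding complement_coordinates_eq using assms by (auto simp: proj_fun_upd fun_upd_in_Cn)

lemma heights_injective_if_modular:
  assumes modular: "modular_direction A vertical" and b: "b \<in> base_complement"
  shows "inj_on (\<lambda>H. height H b) transversals"
proof (rule inj_onI, rule ccontr)
  fix H K assume HK: "H \<in> transversals" "K \<in> transversals" "height H b = height K b" "H \<noteq> K"
  have "b \<in> Cn m" using b base_complement_subset by blast
  define x where "x = lift (b(m := height H b))"
  have x: "x \<in> V" "base_proj x = b" "\<phi> x m = height H b"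
    using \<open>b \<in> Cn m\<close>
    by (simp_all add: x_def lift_in_V fun_upd_in_Cn base_proj_def coordinates_lift proj_fun_upd)
  then have "x \<in> H \<inter> K" using HK mem_transverse_hyperplane_iff[OF _ x(1)] by simp
  then obtain L where "L \<in> parallels" "x \<in> L"
    using modular HK unfolding modular_direction_def by blast
  then have "b \<in> \<Union>base_arrangement" using x(2) by (auto simp: base_arrangement_def)
  then show False using b by (simp add: arr_complement_def)
qed

lemma coincidence_hyperplane:
  assumes "H \<in> transversals" "K \<in> transversals" "H \<noteq> K"
    and nonempty: "{b \<in> Cn m. height H b = height K b} \<noteq> {}"
  shows "affine_hyperplane fun_scale (Cn m) {b \<in> Cn m. height H b = height K b}"
proof -
  have HA: "H \<in> A" "linear_form H vertical \<noteq> 0" and KA: "K \<in> A" "linear_form K vertical \<noteq> 0"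
    using assms(1,2) by (auto simp: mem_parallels)
  define f where "f b = linear_form H (lift (proj m b)) / linear_form H vertical
    - linear_form K (lift (proj m b)) / linear_form K vertical" for b
  define c where "c = level H / linear_form H vertical - level K / linear_form K vertical"
  have f: "height H b = height K b \<longleftrightarrow> f b = c" if "b \<in> Cn m" for b
    using that by (auto simp: height_def f_def c_def proj_id diff_divide_distrib algebra_simps)
  interpret H: Vector_Spaces.linear fun_scale "(*)" "\<lambda>b. linear_form H (lift (proj m b))"
    by (rule linear_form_lift_linear[OF HA(1)])
  interpret K: Vector_Spaces.linear fun_scale "(*)" "\<lambda>b. linear_form K (lift (proj m b))"
    by (rule linear_form_lift_linear[OF KA(1)])
  have "Vector_Spaces.linear fun_scale (*) f"
    by unfold_locales
      (simp_all add: f_def H.add K.add H.scale K.scale add_divide_distrib algebra_simps)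
  moreover have "\<exists>w\<in>Cn m. f w \<noteq> 0"
  proof (rule ccontr)
    assume "\<not> ?thesis"
    then have "height H b = height K b" if "b \<in> Cn m" for b using nonempty that f by auto
    then have "x \<in> H \<longleftrightarrow> x \<in> K" if "x \<in> V" for x
      using mem_transverse_hyperplane_iff[OF _ that] assms(1,2) base_proj_in_Cn by simp
    then show False using hyperplane_subset HA(1) KA(1) assms(3) by blast
  qed
  moreover have "{b \<in> Cn m. height H b = height K b} = {b \<in> Cn m. f b = c}" using f by blast
  ultimately show ?thesis unfolding affine_hyperplane_def by blast
qed

lemma modular_if_heights_injective:
  assumes inj: "\<And>b. b \<in> base_complement \<Longrightarrow> inj_on (\<lambda>H. height H b) transversals"
  shows "modular_direction A vertical"
  unfolding modular_direction_def
proof (intro ballI impI)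
  fix H K assume HK: "H \<in> transversals" "K \<in> transversals" "H \<noteq> K" "H \<inter> K \<noteq> {}"
  let ?C = "{b \<in> Cn m. height H b = height K b}"
  have proj_in_C: "x \<in> V \<and> base_proj x \<in> ?C" if "x \<in> H \<inter> K" for x
  proof -
    have "x \<in> V" using that HK(1) hyperplane_subset by blast
    then show ?thesis using that HK mem_transverse_hyperplane_iff[of _ x] base_proj_in_Cn by auto
  qed
  have "?C \<inter> base_complement = {}" using inj HK(1-3) by (auto dest: inj_onD)
  then have "?C \<subseteq> \<Union>base_arrangement" by (auto simp: arr_complement_def)
  moreover have "?C \<noteq> {}" using proj_in_C HK(4) by blast
  ultimately obtain M where M: "M \<in> base_arrangement" "?C \<subseteq> M"
    using base.affine_hyperplane_subset_if_subset_Union[OF coincidence_hyperplane[OF HK(1-3)]]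
    by blast
  then obtain L where L: "L \<in> parallels" "M = base_proj ` L" by (auto simp: base_arrangement_def)
  have "x \<in> L" if "x \<in> H \<inter> K" for x
    using mem_parallel_hyperplane_iff_base_proj[OF L(1)] proj_in_C[OF that] M(2) L(2) by auto
  then show "\<exists>L\<in>parallels. H \<inter> K \<subseteq> L" using L(1) by blast
qed

lemma continuous_on_height:
  assumes "H \<in> transversals" "S \<subseteq> Cn m"
  shows "continuous_on S (height H)"
proof -
  have H: "H \<in> A" "linear_form H vertical \<noteq> 0" using assms(1) by (auto simp: mem_parallels)
  have "continuous_on S (\<lambda>b. (level H - linear_form H (lift (proj m b))) / linear_form H vertical)"
    using H by (intro continuous_intros
      continuous_on_linear_Cn[OF linear_form_lift_linear assms(2)]) auto
  moreover have "height H b = (level H - linear_form H (lift (proj m b))) / linear_form H vertical"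
    if "b \<in> S" for b
    using that assms(2) by (simp add: height_def proj_id subset_iff)
  ultimately show ?thesis by (simp cong: continuous_on_cong)
qed

lemma generic_base_point:
  obtains b where "b \<in> base_complement" "inj_on (\<lambda>H. height H b) transversals"
proof -
  define coincidence where "coincidence H K = {b \<in> Cn m. height H b = height K b}" for H K
  define C where "C = base_arrangement \<union>
    {coincidence H K | H K. H \<in> transversals \<and> K \<in> transversals \<and> H \<noteq> K \<and> coincidence H K \<noteq> {}}"
  have "finite {coincidence H K | H K. H \<in> transversals \<and> K \<in> transversals \<and> H \<noteq> K \<and>
      coincidence H K \<noteq> {}}"
    by (rule finite_subset[of _ "(\<lambda>(H, K). coincidence H K) ` (A \<times> A)"]) (use finite_A in auto)
  then have "affine_arrangement fun_scale (Cn m) C"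
    using base.arrangement coincidence_hyperplane
    by (auto simp: affine_arrangement_def C_def coincidence_def)
  then interpret C: hyperplane_arrangement fun_scale "Cn m" C by unfold_locales
  obtain b where "b \<in> arr_complement (Cn m) C" using C.complement_nonempty by blast
  then have b: "b \<in> Cn m" "b \<notin> \<Union>C" by (simp_all add: arr_complement_def)
  show thesis
  proof (rule that)
    show "b \<in> base_complement" using b by (auto simp: arr_complement_def C_def)
    show "inj_on (\<lambda>H. height H b) transversals"
    proof (rule inj_onI, rule ccontr)
      fix H K assume HK: "H \<in> transversals" "K \<in> transversals" "height H b = height K b" "H \<noteq> K"
      then have "b \<in> coincidence H K" using b(1) by (simp add: coincidence_def)
      then have "coincidence H K \<in> C" using HK(1,2,4) unfolding C_def by blast
      then show False using b(2) \<open>b \<in> coincidence H K\<close> by blast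
    qed
  qed
qed

lemma fiber_bundle_if_modular:
  assumes "modular_direction A vertical" "finite S" "card S = card transversals"
  shows "projection_bundle base_complement S"
  using assms finite_A continuous_on_height[OF _ base_complement_subset]
  by (intro fiber_bundle_proj_graph_complement[OF base_complement_subset _ _ _ _ _
        complement_coordinates_eq]
      heights_injective_if_modular) auto

lemma base_eq_if_fiber_bundle:
  assumes E_bundle: "projection_bundle X S"
    and X: "X \<subseteq> Cn m" and S: "finite S"
  shows "X = base_complement"
proof (intro equalityI subsetI)
  have E: "total_space \<subseteq> Cn (Suc m)" using complement_coordinates_eq by blast
  fix b assume b: "b \<in> X"
  then have "(UNIV - S) homeomorphic {z. b(m := z) \<in> total_space}"
    using fiber_bundle_proj_fiber[OF E_bundle E] X by blast
  moreover have "UNIV - S \<noteq> {}"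
    using S infinite_UNIV_char_0[where 'a = complex] finite_subset[of UNIV S] by auto
  ultimately have "{z. b(m := z) \<in> total_space} \<noteq> {}" using homeomorphic_empty(1) by metis
  then show "b \<in> base_complement" using fun_upd_mem_complement_iff[of b] b X by blast
next
  fix b assume b: "b \<in> base_complement"
  then have "b \<in> Cn m" using base_complement_subset by blast
  have "finite (heights b)" using finite_A by simp
  then obtain z where "z \<notin> heights b"
    using ex_new_if_finite[OF infinite_UNIV_char_0] by blast
  then have "b(m := z) \<in> total_space" using fun_upd_mem_complement_iff[OF \<open>b \<in> Cn m\<close>] b by blast
  moreover have "proj m \<in> total_space \<rightarrow> X"
    using E_bundle by (simp add: fiber_bundle_def continuous_map_def)
  ultimately have "proj m (b(m := z)) \<in> X" by blast
  then show "b \<in> X" by (simp add: proj_fun_upd[OF \<open>b \<in> Cn m\<close>])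
qed

text \<open>All fibers have as many punctures as a generic one, namely one for each transverse
  hyperplane.\<close>

lemma modular_if_fiber_bundle:
  assumes E_bundle: "projection_bundle base_complement S"
    and S: "finite S"
  shows "modular_direction A vertical"
proof (rule modular_if_heights_injective)
  have E: "total_space \<subseteq> Cn (Suc m)" using complement_coordinates_eq by blast
  have card_heights: "card (heights b) = card S" if b: "b \<in> base_complement" for b
  proof -
    have "b \<in> Cn m" using b base_complement_subset by blast
    then have "{z. b(m := z) \<in> total_space} = - (heights b)"
      using fun_upd_mem_complement_iff[of b] b by blast
    then have "(- S) homeomorphic (- (heights b))"
      using fiber_bundle_proj_fiber[OF E_bundle E b \<open>b \<in> Cn m\<close>] by (simp add: Compl_eq_Diff_UNIV)
    then show ?thesis using card_punctures_eq[of S "heights b"] S finite_A by simp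
  qed
  obtain b0 where b0: "b0 \<in> base_complement" "inj_on (\<lambda>H. height H b0) transversals"
    by (rule generic_base_point)
  fix b assume "b \<in> base_complement"
  then have "card (heights b) = card transversals"
    using card_heights b0(1) card_image[OF b0(2)] by simp
  then show "inj_on (\<lambda>H. height H b) transversals" using finite_A by (simp add: eq_card_imp_inj_on)
qed

theorem fiber_bundle_iff_modular:
  assumes "affine_arrangement fun_scale (Cn m) B"
  shows "(\<exists>S. finite S \<and> projection_bundle (arr_complement (Cn m) B) S)
    \<longleftrightarrow> B = base_arrangement \<and> modular_direction A vertical"
proof
  interpret B: hyperplane_arrangement fun_scale "Cn m" B
    by (intro hyperplane_arrangement.intro finite_dim_subspace_Cn
      hyperplane_arrangement_axioms.intro assms)
  assume "\<exists>S. finite S \<and> projection_bundle (arr_complement (Cn m) B) S"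
  then obtain S where S: "finite S" and E_bundle: "projection_bundle (arr_complement (Cn m) B) S"
    by blast
  have base: "arr_complement (Cn m) B = base_complement"
    using base_eq_if_fiber_bundle[OF E_bundle _ S] by (auto simp: arr_complement_def)
  then have "B = base_arrangement"
    using arr_complement_inject[OF B.hyperplane_arrangement_axioms
        base.hyperplane_arrangement_axioms] by simp
  moreover have "modular_direction A vertical"
    using modular_if_fiber_bundle E_bundle S unfolding base .
  ultimately show "B = base_arrangement \<and> modular_direction A vertical" ..
next
  assume B: "B = base_arrangement \<and> modular_direction A vertical"
  obtain S :: "complex set" where "finite S" "card S = card transversals"
    using infinite_arbitrarily_large[OF infinite_UNIV_char_0] by blast
  then show "\<exists>S. finite S \<and> projection_bundle (arr_complement (Cn m) B) S"
    using fiber_bundle_if_modular B by blast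
qed

lemma lineality_base:
  assumes "lineality V A = {0}" "modular_direction A vertical"
  shows "lineality (Cn m) base_arrangement = {0}"
proof -
  interpret arrangement_with_modular_direction scale V A vertical
    by unfold_locales (use assms vertical_in_V vertical_nonzero in auto)
  have "w = 0" if w: "w \<in> lineality (Cn m) base_arrangement" for w
  proof -
    have wC: "w \<in> Cn m" using w by (simp add: lineality_def)
    have "lift w \<in> directions H" if H: "H \<in> parallels" for H
    proof -
      have HA: "H \<in> A" using H by (simp add: parallel_part_def)
      obtain x where "x \<in> H" using hyperplane_nonempty[OF HA] by blast
      then have "base_proj x + w \<in> base_proj ` H" "base_proj x \<in> base_proj ` H"
        using w H by (auto simp: lineality_def base_arrangement_def directions_def)
      then have "linear_form H (lift (base_proj x + w)) = linear_form H (lift (base_proj x))"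
        by (simp add: base_hyperplane_eq[OF H])
      then show ?thesis
        using wC by (simp add: lift_add base_proj_in_Cn Cn_Suc linear_form_simps[OF HA]
            mem_directions_hyperplane[OF HA] lift_in_V)
    qed
    then have "lift w \<in> span {vertical}"
      using lineality_parallel_part lift_in_V[OF Cn_Suc[OF wC]] by (auto simp: lineality_def)
    then obtain t where "lift w = scale t vertical" by (auto simp: span_singleton)
    then have "w = fun_scale t (unit_seq m)"
      using coordinates_lift[OF Cn_Suc[OF wC]] coordinates_lift[OF unit_seq_in_Cn]
        coordinates_scale[OF vertical_in_V] by (simp add: vertical_def)
    moreover have "w m = 0" using wC by (simp add: Cn_def)
    ultimately have "w = fun_scale t (unit_seq m)" "t = 0"
      by (auto simp: fun_scale_def unit_seq_def)
    then show "w = 0" by (simp add: fun_scale_def fun_eq_iff)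
  qed
  moreover have "0 \<in> lineality (Cn m) base_arrangement"
    by (auto simp: lineality_def Cn_def directions_def)
  ultimately show ?thesis by blast
qed

end

section \<open>The induction on the dimension\<close>

context essential_arrangement
begin

lemma dim_Suc_nonzero: "dim V = Suc m \<Longrightarrow> V \<noteq> {0}"
  using dim_le_card[of V "{}"] by auto

lemma fibers_over_if_supersolvable:
  assumes dim: "dim V = Suc m"
    and base_iff: "\<And>B. essential_arrangement fun_scale (Cn m) B \<Longrightarrow>
      supersolvable (layers (Cn m) B) (\<supseteq>) \<longleftrightarrow> coord_fiber_type m B"
    and "supersolvable P (\<supseteq>)"
  shows "\<exists>B. coord_fiber_type m B \<and> fibers_over scale V A m B"
proof -
  obtain v where v: "v \<in> V" "v \<noteq> 0" "modular_direction A v"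
    and parallel: "supersolvable (layers V (parallel_part A v)) (\<supseteq>)"
    using assms(3)
    unfolding supersolvable_iff_modular_direction[OF dim_Suc_nonzero[OF dim]] by blast
  obtain \<phi> where \<phi>: "coordinates scale V (Suc m) \<phi>" "\<phi> v = unit_seq m"
    using coordinates_exist[OF finite_dim_subspace_axioms v(1,2) dim] by blast
  interpret coordinatized_arrangement scale V A m \<phi> by unfold_locales (rule \<phi>(1))
  have vertical: "vertical = v" using lift_coordinates[OF v(1)] \<phi>(2) by (simp add: vertical_def)
  have "essential_arrangement fun_scale (Cn m) base_arrangement"
    using lineality_base[OF lineality_eq_0] v(3) vertical by unfold_locales simp
  then have "coord_fiber_type m base_arrangement"
    using base_iff parallel supersolvable_base_iff vertical by simp
  moreover have "fibers_over scale V A m base_arrangement"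
    using fiber_bundle_iff_modular[OF base.arrangement] v(3) vertical \<phi>(1)
    by (auto simp: fibers_over_def)
  ultimately show ?thesis by blast
qed

lemma supersolvable_if_fibers_over:
  assumes dim: "dim V = Suc m"
    and base_iff: "\<And>B. essential_arrangement fun_scale (Cn m) B \<Longrightarrow>
      supersolvable (layers (Cn m) B) (\<supseteq>) \<longleftrightarrow> coord_fiber_type m B"
    and B: "coord_fiber_type n B" "fibers_over scale V A n B"
  shows "supersolvable P (\<supseteq>)"
proof -
  obtain \<phi> where \<phi>: "coordinates scale V (Suc n) \<phi>"
    and bundle_exists: "\<exists>S. finite S \<and> fiber_bundle (top_of_set (\<phi> ` arr_complement V A))
      (top_of_set (arr_complement (Cn n) B)) (proj n) (top_of_set (UNIV - S :: complex set))"
    using B(2) unfolding fibers_over_def by blast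
  have "n = m" using coordinates_dim[OF finite_dim_subspace_axioms dim \<phi>] by simp
  interpret coordinatized_arrangement scale V A m \<phi> by unfold_locales (use \<phi> \<open>n = m\<close> in simp)
  have "affine_arrangement fun_scale (Cn m) B" using B(1) \<open>n = m\<close> by cases auto
  then have modular: "B = base_arrangement" "modular_direction A vertical"
    using fiber_bundle_iff_modular bundle_exists \<open>n = m\<close> by auto
  then have "essential_arrangement fun_scale (Cn m) base_arrangement"
    using lineality_base[OF lineality_eq_0] by unfold_locales simp
  then have "supersolvable (layers V parallels) (\<supseteq>)"
    using base_iff B(1) modular(1) \<open>n = m\<close> supersolvable_base_iff by simp
  then show ?thesis
    unfolding supersolvable_iff_modular_direction[OF dim_Suc_nonzero[OF dim]]
    using vertical_in_V vertical_nonzero modular(2) by blast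
qed

lemma supersolvable_iff_fiber_type_if_base:
  assumes "dim V \<ge> 1"
    and "\<And>m B. dim V = Suc m \<Longrightarrow> m \<ge> 1 \<Longrightarrow> essential_arrangement fun_scale (Cn m) B \<Longrightarrow>
      supersolvable (layers (Cn m) B) (\<supseteq>) \<longleftrightarrow> coord_fiber_type m B"
  shows "supersolvable P (\<supseteq>) \<longleftrightarrow> fiber_type scale V A"
proof (cases "dim V = 1")
  case True
  then show ?thesis using supersolvable_if_dim_1 arrangement by (simp add: fiber_type_def)
next
  case False
  then obtain m where m: "dim V = Suc m" "m \<ge> 1" using assms(1) by (cases "dim V") auto
  have "supersolvable P (\<supseteq>) \<longleftrightarrow> (\<exists>n B. coord_fiber_type n B \<and> fibers_over scale V A n B)"
    using fibers_over_if_supersolvable[OF m(1) assms(2)[OF m]]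
      supersolvable_if_fibers_over[OF m(1) assms(2)[OF m]] by blast
  then show ?thesis using arrangement False by (simp add: fiber_type_def)
qed

end

lemma supersolvable_iff_coord_fiber_type:
  assumes "essential_arrangement fun_scale (Cn n) A" "n \<ge> 1"
  shows "supersolvable (layers (Cn n) A) (\<supseteq>) \<longleftrightarrow> coord_fiber_type n A"
  using assms
proof (induction n arbitrary: A)
  case (Suc n)
  then interpret essential_arrangement fun_scale "Cn (Suc n)" A by simp
  show ?case
    unfolding coord_fiber_type_iff
    by (rule supersolvable_iff_fiber_type_if_base) (use Suc.IH in \<open>simp_all add: dim_Cn\<close>)
qed simp

lemma lineality_eq_0_if_essential:
  fixes scale :: "complex \<Rightarrow> 'v::ab_group_add \<Rightarrow> 'v" and Basis :: "'v set"
  assumes "finite_dimensional_vector_space scale Basis" and ess: "essential scale A"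
  shows "lineality UNIV A = {0}"
proof -
  interpret finite_dimensional_vector_space scale Basis by fact
  have "v = 0" if v: "v \<in> lineality UNIV A" for v
  proof -
    have "f v = 0" if f: "f \<in> linear_parts scale A" for f
    proof -
      obtain c where c: "{x. f x = c} \<in> A" and f: "Vector_Spaces.linear scale (*) f" "f \<noteq> 0"
        using f by (auto simp: linear_parts_def dual_space_def)
      interpret f: Vector_Spaces.linear scale "(*)" f by (rule f(1))
      obtain w where "f w \<noteq> 0" using f(2) by (auto simp: fun_eq_iff)
      then have w: "f (scale (c / f w) w) = c" by (simp add: f.scale)
      have "v \<in> directions {x. f x = c}" using v c by (auto simp: lineality_def)
      then have "f (scale (c / f w) w + v) = c" using w by (simp add: directions_def)
      then show ?thesis using w by (simp add: f.add)
    qed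
    then have "linear_parts scale A \<subseteq> {f. f v = 0}" by blast
    moreover have "fun_vs.subspace {f. f v = 0}" by (auto simp: fun_vs.subspace_def fun_scale_def)
    ultimately have "fun_vs.span (linear_parts scale A) \<subseteq> {f. f v = 0}"
      by (rule fun_vs.span_minimal)
    then have "f v = 0" if "Vector_Spaces.linear scale (*) f" for f
      using ess that by (auto simp: essential_def dual_space_def)
    then have "representation Basis v b = 0" for b
      using linear_representation[OF independent_Basis span_Basis] by blast
    moreover have "(\<Sum>b\<in>Basis. scale (representation Basis v b) b) = v"
      by (rule sum_representation_eq) (auto simp: independent_Basis span_Basis finite_Basis)
    ultimately show ?thesis by simp
  qed
  then show ?thesis by (auto simp: lineality_def directions_def)
qed

theorem theorem4p10:
  fixes scale :: "complex \<Rightarrow> 'v::ab_group_add \<Rightarrow> 'v"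
    and Basis :: "'v set"
    and A :: "'v set set"
  assumes "finite_dimensional_vector_space scale Basis"
    and "vector_space.dim scale (UNIV :: 'v set) \<ge> 1"
    and "affine_arrangement scale UNIV A"
    and "essential scale A"
  shows "supersolvable (layers UNIV A) (\<lambda>X Y. Y \<subseteq> X) \<longleftrightarrow> fiber_type scale UNIV A"
proof -
  interpret finite_dimensional_vector_space scale Basis by fact
  interpret essential_arrangement scale UNIV A
  proof unfold_locales
    show "\<exists>B. finite B \<and> UNIV \<subseteq> span B" using finite_Basis span_Basis by auto
    show "lineality UNIV A = {0}" using assms(1,4) by (rule lineality_eq_0_if_essential)
  qed (use assms(3) subspace_UNIV in auto)
  show ?thesis
    using assms(2) supersolvable_iff_coord_fiber_type by (rule supersolvable_iff_fiber_type_if_base)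
qed

end
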